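(* Let $p$ be a fixed prime, $\delta>0$ a fixed constant and $n$ a fixed positive integer. Then there is a constant $\overline{Q}$ such that, for any $q=p^{h}$ with $h\in\mathbb{N}$ and $q\geq\overline{Q}$, and any $c\in C_{n}(\mathcal{H}(2n+1,q^{2}))^{\perp}$ with $\mathrm{wt}(c)\leq\delta q^{2n-1}$, $c$ is a linear combination of code words of the form $\alpha(v_{\pi}-v_{\pi^{\sigma}})$, where $\alpha\in\mathbb{F}_p$ and $\pi$ is an $n$-space of $\mathrm{PG}(2n+1,q^2)$.
   Context: $\mathcal{H}(2n+1,q^2)$ is the non-singular Hermitian variety $X_0^{q+1}+\dots+X_{2n+1}^{q+1}=0$ in $\mathrm{PG}(2n+1,q^2)$ with associated Hermitian polarity $\sigma$; generators are its $n$-dimensional subspaces. $C_{n}(\mathcal{H}(2n+1,q^{2}))^{\perp}$ is the set of $c\in\mathbb{F}_p^{\mathcal{P}}$ ($\mathcal{P}$ the point set of the variety) with $\sum_{P\in\mu}c_P=0$ for every generator $\mu$; $\mathrm{wt}(c)$ is the number of nonzero entries. For an $n$-space $\pi$, $v_\pi$ and $v_{\pi^\sigma}$ are the incidence vectors in $\mathbb{F}_p^{\mathcal{P}}$ of $\pi\cap\mathcal{H}(2n+1,q^2)$ and $\pi^\sigma\cap\mathcal{H}(2n+1,q^2)$; each $\alpha(v_\pi-v_{\pi^\sigma})$ is a code word. *)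

theory Defs
  imports "Jordan_Normal_Form.Missing_VectorSpace" "HOL-Number_Theory.Residues"
begin

text \<open>
  The ground field is an HOL-Algebra field \<open>F\<close> with \<open>q\<^sup>2\<close> elements, so that \<open>q\<close> can be
  quantified inside a formula. Vectors with homogeneous coordinates \<open>X\<^sub>0, \<dots>, X\<^sub>N\<close> are
  extensional functions on \<open>{0..N}\<close>; a subspace of the projective space is identified with
  the corresponding linear subspace, i.e. a set of vectors.
\<close>

definition coord_space :: "'a ring \<Rightarrow> nat \<Rightarrow> ('a, nat \<Rightarrow> 'a) module"
  where "coord_space F N = ring.func_space F {0..N}"

text \<open>The \<open>k\<close>-spaces of \<open>PG(N, F)\<close>: projective dimension is vector space dimension minus one.\<close>

definition pg_spaces :: "'a ring \<Rightarrow> nat \<Rightarrow> nat \<Rightarrow> (nat \<Rightarrow> 'a) set set"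
  where "pg_spaces F N k =
    {W. VectorSpace.subspace F W (coord_space F N) \<and>
        vectorspace.dim F ((coord_space F N)\<lparr>carrier := W\<rparr>) = k + 1}"

definition pg_points :: "'a ring \<Rightarrow> nat \<Rightarrow> (nat \<Rightarrow> 'a) set set"
  where "pg_points F N = pg_spaces F N 0"

definition hermitian_points :: "'a ring \<Rightarrow> nat \<Rightarrow> nat \<Rightarrow> (nat \<Rightarrow> 'a) set set"
  where "hermitian_points F N q =
    {P \<in> pg_points F N. \<forall>x\<in>P. (\<Oplus>\<^bsub>F\<^esub> i\<in>{0..N}. x i [^]\<^bsub>F\<^esub> (q + 1)) = \<zero>\<^bsub>F\<^esub>}"

text \<open>The sesquilinear form polarising \<open>X\<^sub>0\<^sup>q\<^sup>+\<^sup>1 + \<dots> + X\<^sub>N\<^sup>q\<^sup>+\<^sup>1\<close>.\<close>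

definition hermitian_form :: "'a ring \<Rightarrow> nat \<Rightarrow> nat \<Rightarrow> (nat \<Rightarrow> 'a) \<Rightarrow> (nat \<Rightarrow> 'a) \<Rightarrow> 'a"
  where "hermitian_form F N q x y = (\<Oplus>\<^bsub>F\<^esub> i\<in>{0..N}. x i \<otimes>\<^bsub>F\<^esub> (y i [^]\<^bsub>F\<^esub> q))"

definition hermitian_polarity :: "'a ring \<Rightarrow> nat \<Rightarrow> nat \<Rightarrow> (nat \<Rightarrow> 'a) set \<Rightarrow> (nat \<Rightarrow> 'a) set"
  where "hermitian_polarity F N q W =
    {y \<in> carrier (coord_space F N). \<forall>x\<in>W. hermitian_form F N q x y = \<zero>\<^bsub>F\<^esub>}"

definition hermitian_generators :: "'a ring \<Rightarrow> nat \<Rightarrow> nat \<Rightarrow> (nat \<Rightarrow> 'a) set set"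
  where "hermitian_generators F n q =
    {\<mu> \<in> pg_spaces F (2 * n + 1) n.
       \<forall>P \<in> pg_points F (2 * n + 1). P \<subseteq> \<mu> \<longrightarrow> P \<in> hermitian_points F (2 * n + 1) q}"

abbreviation prime_field :: "nat \<Rightarrow> int ring"
  where "prime_field p \<equiv> residue_ring (int p)"

text \<open>The space of all functions from the points of \<open>\<H>(N, q\<^sup>2)\<close> to \<open>\<int>/p\<int>\<close>.\<close>

definition word_space ::
    "nat \<Rightarrow> 'a ring \<Rightarrow> nat \<Rightarrow> nat \<Rightarrow> (int, (nat \<Rightarrow> 'a) set \<Rightarrow> int) module"
  where "word_space p F N q = ring.func_space (prime_field p) (hermitian_points F N q)"

definition dual_code :: "nat \<Rightarrow> 'a ring \<Rightarrow> nat \<Rightarrow> nat \<Rightarrow> ((nat \<Rightarrow> 'a) set \<Rightarrow> int) set"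
  where "dual_code p F n q =
    {c \<in> carrier (word_space p F (2 * n + 1) q). \<forall>\<mu> \<in> hermitian_generators F n q.
       (\<Oplus>\<^bsub>prime_field p\<^esub> P \<in> {P \<in> hermitian_points F (2 * n + 1) q. P \<subseteq> \<mu>}. c P)
         = \<zero>\<^bsub>prime_field p\<^esub>}"

definition wt ::
    "nat \<Rightarrow> 'a ring \<Rightarrow> nat \<Rightarrow> nat \<Rightarrow> ((nat \<Rightarrow> 'a) set \<Rightarrow> int) \<Rightarrow> nat"
  where "wt p F N q c = card {P \<in> hermitian_points F N q. c P \<noteq> \<zero>\<^bsub>prime_field p\<^esub>}"

definition incidence_vector ::
    "nat \<Rightarrow> 'a ring \<Rightarrow> nat \<Rightarrow> nat \<Rightarrow> (nat \<Rightarrow> 'a) set \<Rightarrow> ((nat \<Rightarrow> 'a) set \<Rightarrow> int)"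
  where "incidence_vector p F N q W =
    (\<lambda>P \<in> hermitian_points F N q.
       if P \<subseteq> W then \<one>\<^bsub>prime_field p\<^esub> else \<zero>\<^bsub>prime_field p\<^esub>)"

definition polar_pair_words ::
    "nat \<Rightarrow> 'a ring \<Rightarrow> nat \<Rightarrow> nat \<Rightarrow> ((nat \<Rightarrow> 'a) set \<Rightarrow> int) set"
  where "polar_pair_words p F n q =
    {\<alpha> \<odot>\<^bsub>word_space p F (2 * n + 1) q\<^esub>
       (incidence_vector p F (2 * n + 1) q \<pi> \<ominus>\<^bsub>word_space p F (2 * n + 1) q\<^esub>
        incidence_vector p F (2 * n + 1) q (hermitian_polarity F (2 * n + 1) q \<pi>))
     | \<alpha> \<pi>. \<alpha> \<in> carrier (prime_field p) \<and> \<pi> \<in> pg_spaces F (2 * n + 1) n}"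

end

theory Submission
  imports Defs
begin

text \<open>Write \<open>M = q\<^sup>2\<^sup>n\<^sup>-\<^sup>1\<close> and let \<open>S\<close> be the support of a nonzero code word \<open>c\<close> with
  \<open>|S| \<le> D M\<close>. The number of generators through a point \<open>R\<close> is \<open>M + 1\<close> times the number of
  generators through \<open>R\<close> and any other given point perpendicular to \<open>R\<close>. A generator through
  \<open>R \<in> S\<close> contains a second point of \<open>S\<close>, so \<open>R\<close> is perpendicular to at least \<open>M\<close> points of \<open>S\<close>,
  and choosing \<open>n + 1\<close> independent points of \<open>S\<close> greedily yields an \<open>n\<close>-space \<open>\<pi>\<close>, the polar of
  their span, that contains a positive proportion of \<open>S\<close>. A point outside \<open>\<pi>\<^sup>\<sigma>\<close> is perpendicular to
  few points of \<open>\<pi>\<close>. Hence for most \<open>R \<in> S \<inter> \<pi>\<close> almost every generator through \<open>R\<close> meets \<open>S\<close> only in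
  \<open>R\<close> and in points of \<open>\<pi>\<^sup>\<sigma>\<close>; as almost all of them meet \<open>\<pi>\<^sup>\<sigma>\<close> in a single point \<open>X\<close>, this forces
  \<open>c X = - c R\<close> for almost all points \<open>X\<close> of \<open>\<pi>\<^sup>\<sigma>\<close>. By symmetry \<open>c\<close> is almost constant on \<open>\<pi>\<close> too, so
  subtracting a multiple of \<open>v\<^sub>\<pi> - v\<^sub>\<pi>\<^sub>\<sigma>\<close> lowers the weight by at least \<open>M\<close>, and induction on \<open>D\<close>
  applies. Dimensions are measured throughout by the number of vectors.\<close>

section \<open>Low-weight words in a polar configuration\<close>

text \<open>There are two scales. As \<open>b * q = 2 * M\<close>, a multiple of \<open>b\<close> by
  a constant depending on \<open>D\<close> and \<open>n\<close> drops below \<open>M\<close> once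
  \<open>q\<close> is large; the bound on \<open>q\<close> makes all error terms small at once. In
  the induction, \<open>D\<close> stays that of the original word inside these constants, so one
  bound serves every step. The greedy choice stops after \<open>n + 1\<close> points because the
  polar of their span then has the dimension of the span itself. The delicate case is an n-space
  that meets its polar or equals it. A support point with few perpendicular support points off the
  polar cannot lie in the polar, because too few generators through it would meet the polar again.
  Such a point shows that neither space is totally isotropic, and only then is the bound
  \<open>M + b\<close> on the points of the polar available. Since \<open>M + 1\<close> points are
  needed for every generator through R to meet the polar, this leaves room for few generators that
  meet it twice. Words are treated as integer functions with congruences modulo \<open>p\<close>, so
  that sums and counts stay in the integers.\<close>

lemma double_count:
  assumes "finite A" "finite B"
  shows "(\<Sum>a\<in>A. card {b \<in> B. P a b}) = (\<Sum>b\<in>B. card {a \<in> A. P a b})"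
proof -
  have "(\<Sum>a\<in>A. card {b \<in> B. P a b}) = (\<Sum>a\<in>A. \<Sum>b\<in>B. if P a b then 1 else 0)"
    using assms by (simp add: sum.If_cases Int_def)
  also have "\<dots> = (\<Sum>b\<in>B. \<Sum>a\<in>A. if P a b then 1 else 0)"
    by (rule sum.swap)
  finally show ?thesis
    using assms by (simp add: sum.If_cases Int_def)
qed

lemma card_bex_le:
  assumes "finite B" "\<And>x. x \<in> B \<Longrightarrow> card {y \<in> G. P x y} \<le> k"
  shows "card {y \<in> G. \<exists>x\<in>B. P x y} \<le> card B * k"
proof -
  have "{y \<in> G. \<exists>x\<in>B. P x y} = (\<Union>x\<in>B. {y \<in> G. P x y})"
    by blast
  then have "card {y \<in> G. \<exists>x\<in>B. P x y} \<le> (\<Sum>x\<in>B. card {y \<in> G. P x y})"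
    using card_UN_le[OF assms(1)] by simp
  also have "\<dots> \<le> card B * k"
    using sum_bounded_above[of B "\<lambda>x. card {y \<in> G. P x y}" k] assms(2) by simp
  finally show ?thesis .
qed

text \<open>The model is a Hermitian variety with its generators, its sections \<open>pts i\<close> by \<open>n\<close>-spaces \<open>i\<close>, and
  polarity \<open>pol\<close>. In \<open>flat k L N\<close>, \<open>L\<close> is the section by a subspace of vector space dimension \<open>k\<close> and
  \<open>N\<close> the section by its polar. The constants are \<open>M = q\<^sup>2\<^sup>n\<^sup>-\<^sup>1\<close> and \<open>b = 2 q\<^sup>2\<^sup>n\<^sup>-\<^sup>2\<close>; an error
  term is negligible when it is a bounded multiple of \<open>b\<close>.\<close>

locale polar_configuration =
  fixes Pts :: "'x set" and perp :: "'x \<Rightarrow> 'x \<Rightarrow> bool" and Gens :: "'x set set"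
    and Sub :: "'i set" and pts :: "'i \<Rightarrow> 'x set" and pol :: "'i \<Rightarrow> 'i"
    and flat :: "nat \<Rightarrow> 'x set \<Rightarrow> 'x set \<Rightarrow> bool"
    and q n M b g :: nat
  assumes finite_Pts: "finite Pts"
    and perp_sym: "perp X Y \<Longrightarrow> perp Y X"
    and Gens_subset: "\<mu> \<in> Gens \<Longrightarrow> \<mu> \<subseteq> Pts"
    and Gens_perp: "\<lbrakk>\<mu> \<in> Gens; X \<in> \<mu>; Y \<in> \<mu>\<rbrakk> \<Longrightarrow> perp X Y"
    and g_pos: "g > 0" and M_pos: "M > 0" and b_q: "b * q = 2 * M"
    and card_Gens_through_pair:
      "\<lbrakk>X \<in> Pts; Y \<in> Pts; X \<noteq> Y; perp X Y\<rbrakk> \<Longrightarrow> card {\<mu> \<in> Gens. X \<in> \<mu> \<and> Y \<in> \<mu>} = g"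
    and card_Gens_through_point: "X \<in> Pts \<Longrightarrow> card {\<mu> \<in> Gens. X \<in> \<mu>} = g * (M + 1)"
    and pts_subset: "i \<in> Sub \<Longrightarrow> pts i \<subseteq> Pts"
    and pol_Sub: "i \<in> Sub \<Longrightarrow> pol i \<in> Sub"
    and pol_pol: "i \<in> Sub \<Longrightarrow> pol (pol i) = i"
    and perp_pol: "\<lbrakk>i \<in> Sub; X \<in> pts i; Y \<in> pts (pol i)\<rbrakk> \<Longrightarrow> perp X Y"
    and card_hyperplane_section:
      "\<lbrakk>i \<in> Sub; Y \<in> Pts; Y \<notin> pts (pol i)\<rbrakk> \<Longrightarrow> card {X \<in> pts i. perp X Y} \<le> b"
    and card_Gens_meeting_pol:
      "\<lbrakk>i \<in> Sub; X \<in> pts i; X \<in> pts (pol i)\<rbrakk> \<Longrightarrow>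
         card {\<mu> \<in> Gens. X \<in> \<mu> \<and> (\<exists>Y\<in>pts (pol i). Y \<in> \<mu> \<and> Y \<noteq> X)} \<le> g * b"
    and Gens_meet_pol:
      "\<lbrakk>i \<in> Sub; X \<in> pts i; X \<notin> pts (pol i); \<mu> \<in> Gens; X \<in> \<mu>\<rbrakk> \<Longrightarrow> \<mu> \<inter> pts (pol i) \<noteq> {}"
    and card_pts_pol_le:
      "\<lbrakk>i \<in> Sub; X \<in> pts i; X \<notin> pts (pol i)\<rbrakk> \<Longrightarrow> card (pts (pol i)) \<le> M + b"
    and card_Gens_Int_pol:
      "\<lbrakk>i \<in> Sub; \<mu> \<in> Gens\<rbrakk> \<Longrightarrow> card (\<mu> \<inter> pts i) = card (\<mu> \<inter> pts (pol i))"
    and flat_0: "flat 0 {} Pts"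
    and flat_subset: "flat k L N \<Longrightarrow> L \<subseteq> Pts"
    and card_flat_le: "\<lbrakk>flat k L N; k \<le> n\<rbrakk> \<Longrightarrow> card L \<le> b"
    and flat_Suc: "\<lbrakk>flat k L N; k \<le> n; P \<in> Pts; P \<notin> L\<rbrakk> \<Longrightarrow>
         \<exists>L'. flat (Suc k) L' {X \<in> N. perp X P}"
    and flat_full: "flat (Suc n) L N \<Longrightarrow> \<exists>i\<in>Sub. pts i = N"
begin

lemma finite_Gens: "finite Gens"
  using finite_Pts Gens_subset by (meson Pow_iff finite_Pow_iff finite_subset subsetI)

lemma finite_pts: "i \<in> Sub \<Longrightarrow> finite (pts i)"
  using finite_Pts pts_subset finite_subset by blast

lemma b_times_le:
  assumes "2 * k \<le> q"
  shows "b * k \<le> M"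
proof -
  have "b * (2 * k) \<le> b * q" using assms by (rule mult_left_mono) simp
  then show ?thesis using b_q by simp
qed

end

section \<open>A word of low weight and a dense n-space for its support\<close>

locale code_word = polar_configuration Pts perp Gens Sub pts pol flat q n M b g
  for Pts :: "'x set" and perp Gens and Sub :: "'i set" and pts pol flat q n M b g +
  fixes p :: int and c :: "'x \<Rightarrow> int" and D :: nat
  assumes sum_Gens: "\<mu> \<in> Gens \<Longrightarrow> p dvd (\<Sum>P\<in>\<mu>. c P)"
    and D_pos: "D > 0"
    and weight_le: "card {P \<in> Pts. \<not> p dvd c P} \<le> D * M"
    and q_large: "16 * (2 * D) ^ Suc n * (2 * D * (2 * D) ^ Suc n + 2) \<le> q"
begin

definition S :: "'x set" where "S = {P \<in> Pts. \<not> p dvd c P}"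
text \<open>Some n-space will contain at least M / E points of the support: each of the n + 1 points
  chosen in \<open>exists_dense_flat\<close> preserves at least a fraction 1 / (2 * D).\<close>

definition E :: nat where "E = (2 * D) ^ Suc n"
text \<open>Chosen so that, by averaging in \<open>many_good\<close>, at most M / (2 * E) points of
  a dense section are bad, which is half of the guaranteed M / E.\<close>

definition K :: nat where "K = 2 * D * E"

lemma finite_S: "finite S" and S_subset: "S \<subseteq> Pts"
  using finite_Pts by (auto simp: S_def)

lemma card_S_le: "card S \<le> D * M"
  using weight_le by (simp add: S_def)

lemma E_ge: "E \<ge> 2"
proof -
  have "(2::nat) ^ 1 \<le> 2 ^ Suc n" by (rule power_increasing) auto
  also have "\<dots> \<le> (2 * D) ^ Suc n" using D_pos by (intro power_mono) auto
  finally show ?thesis by (simp add: E_def)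
qed

lemma q_ge: "16 * E * (K + 2) \<le> q"
  using q_large by (simp add: E_def K_def)

text \<open>The exceptional sets below have at most \<open>(K + 2) * b\<close> points. The extra
  factor \<open>E\<close> is there to compare them with the number of good points, which is only
  known to be at least M / (2 * E).\<close>

lemma b_E_le: "8 * E * (K + 2) * b \<le> M"
  using b_times_le[of "8 * E * (K + 2)"] q_ge by (simp add: mult.commute algebra_simps)

lemma b_K_le: "16 * (K + 2) * b \<le> M"
proof -
  define Z where "Z = (K + 2) * b"
  have "2 * Z \<le> E * Z" using E_ge by (rule mult_right_mono) simp
  moreover have "8 * (E * Z) \<le> M" "16 * (K + 2) * b = 16 * Z"
    using b_E_le by (simp_all only: Z_def mult.assoc)
  ultimately show ?thesis by linarith
qed

lemma b_le_M: "2 * b \<le> M"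
proof -
  have "2 * b \<le> 16 * (K + 2) * b" by simp
  then show ?thesis using b_K_le by linarith
qed

text \<open>If R were the only support point on a generator, the sum over it would be congruent to
  \<open>c R\<close>, which is nonzero modulo \<open>p\<close>.\<close>

lemma other_point_of_generator:
  assumes "\<mu> \<in> Gens" "R \<in> S" "R \<in> \<mu>"
  shows "\<exists>X\<in>S. X \<in> \<mu> \<and> X \<noteq> R"
proof (rule ccontr)
  assume *: "\<not> ?thesis"
  have fin: "finite \<mu>" using Gens_subset[OF assms(1)] finite_Pts finite_subset by blast
  have "p dvd c X" if "X \<in> \<mu> - {R}" for X
    using that * Gens_subset[OF assms(1)] by (auto simp: S_def)
  then have "p dvd (\<Sum>X\<in>\<mu> - {R}. c X)" by (rule dvd_sum)
  moreover have "(\<Sum>X\<in>\<mu>. c X) = c R + (\<Sum>X\<in>\<mu> - {R}. c X)"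
    using fin assms(3) by (rule sum.remove)
  ultimately have "p dvd c R" using sum_Gens[OF assms(1)] by (metis dvd_add_left_iff)
  then show False using assms(2) by (simp add: S_def)
qed

lemma Gens_through_le: "\<lbrakk>X \<in> Pts; Y \<in> Pts; X \<noteq> Y\<rbrakk> \<Longrightarrow> card {\<mu> \<in> Gens. X \<in> \<mu> \<and> Y \<in> \<mu>} \<le> g"
proof (cases "perp X Y")
  case False
  then have "{\<mu> \<in> Gens. X \<in> \<mu> \<and> Y \<in> \<mu>} = {}" using Gens_perp by blast
  then show ?thesis by (metis card.empty zero_le)
qed (simp add: card_Gens_through_pair)

lemma card_Gens_blocked_le:
  assumes "R \<in> Pts" "B \<subseteq> Pts" "R \<notin> B"
  shows "card {\<mu> \<in> Gens. R \<in> \<mu> \<and> (\<exists>X\<in>B. X \<in> \<mu>)} \<le> card B * g"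
proof -
  have "finite B" using assms finite_Pts finite_subset by blast
  moreover have "card {\<mu> \<in> {\<mu> \<in> Gens. R \<in> \<mu>}. X \<in> \<mu>} \<le> g" if "X \<in> B" for X
    using Gens_through_le[of R X] assms that by auto
  ultimately have "card {\<mu> \<in> {\<mu> \<in> Gens. R \<in> \<mu>}. \<exists>X\<in>B. X \<in> \<mu>} \<le> card B * g"
    by (rule card_bex_le)
  then show ?thesis by (simp add: conj_assoc)
qed

text \<open>All \<open>g * (M + 1)\<close> generators through R contain a second support point, and
  each candidate accounts for at most \<open>g\<close> of them.\<close>

lemma card_perp_ge:
  assumes "R \<in> S"
  shows "M \<le> card {X \<in> S. perp R X}"
proof -
  let ?B = "{X \<in> S. perp R X \<and> X \<noteq> R}"
  have "{\<mu> \<in> Gens. R \<in> \<mu>} \<subseteq> {\<mu> \<in> Gens. R \<in> \<mu> \<and> (\<exists>X\<in>?B. X \<in> \<mu>)}"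
    using other_point_of_generator[OF _ assms] Gens_perp by fastforce
  then have "card {\<mu> \<in> Gens. R \<in> \<mu>} \<le> card {\<mu> \<in> Gens. R \<in> \<mu> \<and> (\<exists>X\<in>?B. X \<in> \<mu>)}"
    using finite_Gens by (intro card_mono) auto
  also have "\<dots> \<le> card ?B * g"
    using assms S_subset by (intro card_Gens_blocked_le) auto
  finally have "g * (M + 1) \<le> g * card ?B"
    using card_Gens_through_point[of R] assms S_subset by (auto simp: mult.commute)
  then have "M + 1 \<le> card ?B" using nat_mult_le_cancel1[OF g_pos] by blast
  also have "\<dots> \<le> card {X \<in> S. perp R X}"
    using finite_S by (intro card_mono) auto
  finally show ?thesis by simp
qed

text \<open>Each R in A is perpendicular to at least \<open>M - b\<close>, hence to at least M / 2,
  points of \<open>S - L\<close>, while S has at most \<open>D * M\<close> points. So some X in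
  \<open>S - L\<close> is perpendicular to at least a fraction 1 / (2 * D) of A. Discarding L makes
  X independent of the points chosen before.\<close>

lemma exists_dense_flat:
  assumes "S \<noteq> {}" "k \<le> Suc n"
  shows "\<exists>L N A. flat k L N \<and> A \<subseteq> S \<inter> N \<and> M \<le> (2 * D) ^ k * card A"
  using assms(2)
proof (induction k)
  case 0
  obtain R where "R \<in> S" using assms(1) by blast
  then have "M \<le> card {X \<in> S. perp R X}" by (rule card_perp_ge)
  also have "\<dots> \<le> card S" using finite_S by (intro card_mono) auto
  finally have "M \<le> card S" .
  then show ?case
    using flat_0 S_subset by (intro exI[of _ "{}"] exI[of _ Pts] exI[of _ S]) auto
next
  case (Suc k)
  then obtain L N A where *: "flat k L N" "A \<subseteq> S \<inter> N" "M \<le> (2 * D) ^ k * card A"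
    by auto
  have fA: "finite A" using *(2) finite_S finite_subset by blast
  have cL: "card L \<le> b" using card_flat_le *(1) Suc.prems by simp
  have step: "M \<le> b + card {X \<in> S - L. perp R X}" if "R \<in> A" for R
  proof -
    have "{X \<in> S. perp R X} \<subseteq> (L \<inter> S) \<union> {X \<in> S - L. perp R X}" by blast
    then have "card {X \<in> S. perp R X} \<le> card (L \<inter> S) + card {X \<in> S - L. perp R X}"
      using finite_S by (intro order.trans[OF card_mono card_Un_le]) auto
    moreover have "M \<le> card {X \<in> S. perp R X}" using card_perp_ge *(2) that by blast
    moreover have "card (L \<inter> S) \<le> card L"
      using flat_subset[OF *(1)] finite_Pts finite_subset by (intro card_mono) auto
    ultimately show ?thesis using cL by linarith
  qed
  have "card A * (M - b) \<le> (\<Sum>R\<in>A. card {X \<in> S - L. perp R X})"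
    using sum_bounded_below[of A "M - b" "\<lambda>R. card {X \<in> S - L. perp R X}"] step
    by (simp add: le_diff_conv add.commute)
  also have "\<dots> = (\<Sum>X\<in>S - L. card {R \<in> A. perp R X})"
    using fA finite_S by (intro double_count) auto
  finally have sum_ge: "card A * (M - b) \<le> (\<Sum>X\<in>S - L. card {R \<in> A. perp R X})" .
  have "\<exists>X\<in>S - L. card A \<le> 2 * D * card {R \<in> A. perp R X}"
  proof (rule ccontr)
    assume "\<not> ?thesis"
    \<comment> \<open>Integrality turns strictness into a gain of 1 for each X. Summed up, this gain
      must vanish, so \<open>S - L\<close> is empty, against the positive lower bound
      \<open>card A * (M - b)\<close> for a sum over it.\<close>
    then have "2 * D * card {R \<in> A. perp R X} + 1 \<le> card A" if "X \<in> S - L" for X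
      using that by force
    then have "(\<Sum>X\<in>S - L. 2 * D * card {R \<in> A. perp R X} + 1) \<le> card (S - L) * card A"
      using sum_bounded_above[of "S - L" _ "card A"] by force
    then have le: "2 * D * (\<Sum>X\<in>S - L. card {R \<in> A. perp R X}) + card (S - L) \<le> card (S - L) * card A"
      by (simp add: sum_Suc sum_distrib_left[symmetric])
    also have "\<dots> \<le> D * M * card A"
      using card_S_le card_mono[OF finite_S, of "S - L"] by (intro mult_right_mono) auto
    finally have le: "2 * D * (\<Sum>X\<in>S - L. card {R \<in> A. perp R X}) + card (S - L) \<le> D * M * card A" .
    have "D * M * card A \<le> 2 * D * (card A * (M - b))"
    proof -
      have "M \<le> 2 * (M - b)" using b_le_M by linarith
      then have "D * card A * M \<le> D * card A * (2 * (M - b))" by (rule mult_left_mono) simp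
      then show ?thesis by (simp only: ac_simps)
    qed
    also have "\<dots> \<le> 2 * D * (\<Sum>X\<in>S - L. card {R \<in> A. perp R X})"
      using sum_ge by (rule mult_left_mono) simp
    finally have "card (S - L) = 0" using le by linarith
    then have "S - L = {}" using finite_S by simp
    then have "card A * (M - b) = 0" using sum_ge by (metis le_zero_eq sum.empty)
    moreover have "card A > 0" using *(3) M_pos by (cases "card A = 0") auto
    ultimately show False using b_le_M M_pos by simp
  qed
  then obtain X where X: "X \<in> S" "X \<notin> L" "card A \<le> 2 * D * card {R \<in> A. perp R X}" by blast
  then obtain L' where L': "flat (Suc k) L' {Y \<in> N. perp Y X}"
    using flat_Suc[OF *(1), of X] Suc.prems S_subset by auto
  have "M \<le> (2 * D) ^ k * card A" by (rule *)
  also have "\<dots> \<le> (2 * D) ^ k * (2 * D * card {R \<in> A. perp R X})"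
    using X(3) by (rule mult_left_mono) simp
  finally have "M \<le> (2 * D) ^ Suc k * card {R \<in> A. perp R X}" by (simp add: algebra_simps)
  then show ?case using L' *(2) by (intro exI[of _ L'] exI conjI) auto
qed

lemma exists_dense_subspace:
  assumes "S \<noteq> {}"
  shows "\<exists>i\<in>Sub. M \<le> E * card (S \<inter> pts i)"
proof -
  obtain L N A where A: "flat (Suc n) L N" "A \<subseteq> S \<inter> N" "M \<le> E * card A"
    using exists_dense_flat[OF assms, of "Suc n"] by (auto simp: E_def)
  then obtain i where i: "i \<in> Sub" "pts i = N" using flat_full by blast
  have "card A \<le> card (S \<inter> pts i)" using A i finite_S by (intro card_mono) auto
  then have "E * card A \<le> E * card (S \<inter> pts i)" by simp
  then show ?thesis using A(3) i(1) le_trans by blast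
qed

section \<open>Good points and the values of the word on the polar\<close>

definition good :: "'i \<Rightarrow> 'x \<Rightarrow> bool" where
  "good i R \<longleftrightarrow> R \<in> S \<inter> pts i \<and> card {X \<in> S - pts (pol i). perp R X} \<le> K * b"

text \<open>A support point off the polar is perpendicular to at most \<open>b\<close> points of the
  section, so there are at most \<open>D * M * b\<close> perpendicular pairs. A bad point uses up at
  least \<open>K * b\<close> of them, so at most M / (2 * E) points are bad.\<close>

lemma many_good:
  assumes "i \<in> Sub" "M \<le> E * card (S \<inter> pts i)"
  shows "M \<le> 2 * E * card {R. good i R}"
proof -
  let ?A = "S \<inter> pts i" and ?Y = "S - pts (pol i)"
  let ?bad = "{R \<in> ?A. \<not> good i R}" and ?good = "{R \<in> ?A. good i R}"
  have "(\<Sum>R\<in>?A. card {X \<in> ?Y. perp R X}) = (\<Sum>X\<in>?Y. card {R \<in> ?A. perp R X})"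
    using finite_S by (intro double_count) auto
  also have "\<dots> \<le> card ?Y * b"
  proof -
    have "card {R \<in> ?A. perp R X} \<le> b" if "X \<in> ?Y" for X
    proof -
      have "card {R \<in> ?A. perp R X} \<le> card {R \<in> pts i. perp R X}"
        using finite_pts[OF assms(1)] by (intro card_mono) auto
      then show ?thesis using card_hyperplane_section[OF assms(1), of X] that S_subset by auto
    qed
    then show ?thesis using sum_bounded_above[of ?Y _ b] by force
  qed
  also have "\<dots> \<le> D * M * b"
    using card_S_le card_mono[OF finite_S, of ?Y] by (intro mult_right_mono) auto
  finally have le: "(\<Sum>R\<in>?A. card {X \<in> ?Y. perp R X}) \<le> D * M * b" .
  have "card ?bad * (K * b) \<le> (\<Sum>R\<in>?bad. card {X \<in> ?Y. perp R X})"
  proof -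
    have "K * b \<le> card {X \<in> ?Y. perp R X}" if "R \<in> ?bad" for R
      using that unfolding good_def by simp linarith
    then show ?thesis using sum_bounded_below[of ?bad "K * b"] by simp
  qed
  also have "\<dots> \<le> (\<Sum>R\<in>?A. card {X \<in> ?Y. perp R X})"
    using finite_S by (intro sum_mono2) auto
  also note le
  finally have "(D * b) * (2 * E * card ?bad) \<le> (D * b) * M"
    by (simp add: K_def algebra_simps)
  moreover have "b > 0" using b_q M_pos by (cases "b = 0") auto
  ultimately have "2 * E * card ?bad \<le> M" using D_pos by simp
  moreover have "card ?A = card ?good + card ?bad"
  proof -
    have "?A = ?good \<union> ?bad" "?good \<inter> ?bad = {}" by blast+
    moreover have "finite ?good" "finite ?bad" using finite_S by auto
    ultimately show ?thesis by (metis (no_types) card_Un_disjoint[of ?good ?bad])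
  qed
  then have "2 * E * card ?A = 2 * E * card ?good + 2 * E * card ?bad"
    by (simp add: distrib_left)
  ultimately have "M \<le> 2 * E * card ?good" using assms(2) by linarith
  moreover have "?good = {R. good i R}" by (auto simp: good_def)
  ultimately show ?thesis by simp
qed

text \<open>Suppose R lay in the polar as well. The second support point on a generator through R is
  either off the polar, which covers at most \<open>K * b * g\<close> generators, or in the polar,
  which covers at most \<open>g * b\<close>. Together these fall short of
  \<open>g * (M + 1)\<close>.\<close>

lemma good_notin_pol:
  assumes "i \<in> Sub" "good i R"
  shows "R \<notin> pts (pol i)"
proof
  assume R: "R \<in> pts (pol i)"
  have RS: "R \<in> S" "R \<in> pts i" using assms(2) by (auto simp: good_def)
  let ?B = "{X \<in> S - pts (pol i). perp R X}"
  let ?G1 = "{\<mu> \<in> Gens. R \<in> \<mu> \<and> (\<exists>X\<in>?B. X \<in> \<mu>)}"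
  let ?G2 = "{\<mu> \<in> Gens. R \<in> \<mu> \<and> (\<exists>Y\<in>pts (pol i). Y \<in> \<mu> \<and> Y \<noteq> R)}"
  have "{\<mu> \<in> Gens. R \<in> \<mu>} \<subseteq> ?G1 \<union> ?G2"
    using other_point_of_generator[OF _ RS(1)] Gens_perp by fastforce
  then have "card {\<mu> \<in> Gens. R \<in> \<mu>} \<le> card (?G1 \<union> ?G2)"
    using finite_Gens by (intro card_mono) auto
  also have "\<dots> \<le> card ?G1 + card ?G2" by (rule card_Un_le)
  also have "\<dots> \<le> card ?B * g + g * b"
    using RS R S_subset
    by (intro add_mono card_Gens_blocked_le card_Gens_meeting_pol assms) auto
  also have "\<dots> \<le> K * b * g + g * b"
    using assms(2) by (simp add: good_def)
  finally have "g * (M + 1) \<le> g * ((K + 1) * b)"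
    using card_Gens_through_point[of R] RS S_subset by (auto simp: algebra_simps)
  then have "M + 1 \<le> (K + 1) * b" using nat_mult_le_cancel1[OF g_pos] by blast
  also have "\<dots> \<le> 16 * (K + 2) * b" by (rule mult_right_mono) auto
  finally show False using b_K_le by linarith
qed

text \<open>Generators through a good point \<open>R\<close> mostly meet the support of \<open>c\<close> in \<open>R\<close> and a single
  point \<open>X\<close> of the polar subspace, which forces \<open>c X = - c R\<close>.\<close>

lemma good_constant:
  assumes "i \<in> Sub" "good i R"
  shows "card {X \<in> pts (pol i). \<not> p dvd c X + c R} \<le> (K + 2) * b"
    and "M \<le> card (pts (pol i))"
proof -
  have RS: "R \<in> S" "R \<in> pts i" "R \<in> Pts" using assms(2) S_subset by (auto simp: good_def)
  have RT: "R \<notin> pts (pol i)" using good_notin_pol assms by blast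
  let ?T = "pts (pol i)"
  have fT: "finite ?T" and TP: "?T \<subseteq> Pts" using finite_pts pts_subset pol_Sub assms(1) by auto
  let ?B = "{X \<in> S - ?T. perp R X} - {R}"
  let ?G = "{\<mu> \<in> Gens. R \<in> \<mu>}"
  let ?b1 = "{\<mu> \<in> Gens. R \<in> \<mu> \<and> (\<exists>X\<in>?B. X \<in> \<mu>)}"
  let ?X = "{X \<in> ?T. \<not> p dvd c X + c R}"
  have cG: "card ?G = g * (M + 1)" using card_Gens_through_point RS by simp
  have finG: "finite ?G" using finite_Gens by simp
  have b1: "card ?b1 \<le> K * b * g"
  proof -
    have "card ?b1 \<le> card ?B * g"
      using RS S_subset by (intro card_Gens_blocked_le) auto
    also have "card ?B \<le> card {X \<in> S - ?T. perp R X}"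
      using finite_S by (intro card_mono) auto
    also have "\<dots> \<le> K * b" using assms(2) by (simp add: good_def)
    finally show ?thesis by simp
  qed
  have meets: "1 \<le> card {X \<in> ?T. X \<in> \<mu>}" if "\<mu> \<in> ?G" for \<mu>
  proof -
    have "{X \<in> ?T. X \<in> \<mu>} \<noteq> {}" using Gens_meet_pol[OF assms(1) RS(2) RT, of \<mu>] that by auto
    then show ?thesis using fT by (simp add: Suc_le_eq card_gt_0_iff)
  qed
  have through: "card {\<mu> \<in> ?G. X \<in> \<mu>} = g" if "X \<in> ?T" for X
    using card_Gens_through_pair[of R X] perp_pol[OF assms(1) RS(2) that] that RT RS TP
    by (auto simp: conj_assoc)
  have total: "(\<Sum>\<mu>\<in>?G. card {X \<in> ?T. X \<in> \<mu>}) = card ?T * g"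
    using double_count[OF finG fT, of "\<lambda>\<mu> X. X \<in> \<mu>"] through by simp
  \<comment> \<open>Every generator through R meets T, and each point of T lies on exactly
    \<open>g\<close> of them.\<close>
  have "g * (M + 1) \<le> g * card ?T"
    using sum_bounded_below[of ?G 1 "\<lambda>\<mu>. card {X \<in> ?T. X \<in> \<mu>}"] meets cG total by (simp add: mult.commute)
  then have T_ge: "M + 1 \<le> card ?T" using nat_mult_le_cancel1[OF g_pos] by blast
  then show "M \<le> card ?T" by simp
  have T_le: "card ?T \<le> M + b" using card_pts_pol_le[OF assms(1) RS(2) RT] .
  \<comment> \<open>Let t be the number of points of T on the generator; the right side is 2 t - 1,
    plus 1 if the generator is blocked. If it is blocked or t >= 2, this is at least t + 1, enough
    for the trivial bound on the left. Otherwise its support points lie in {R, X}, the sum condition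
    removes X from \<open>?X\<close>, and both sides are 1. After summation the cost is twice the
    excess of \<open>card ?T\<close> over \<open>M + 1\<close>, plus the blocked generators.\<close>
  have clean: "1 + card {X \<in> ?X. X \<in> \<mu>} \<le> card {X \<in> ?T. X \<in> \<mu>} +
       (card {X \<in> ?T. X \<in> \<mu>} - 1) + (if \<mu> \<in> ?b1 then 1 else 0)"
    if \<mu>: "\<mu> \<in> ?G" for \<mu>
  proof (cases "\<mu> \<in> ?b1 \<or> card {X \<in> ?T. X \<in> \<mu>} \<noteq> 1")
    case True
    have "card {X \<in> ?X. X \<in> \<mu>} \<le> card {X \<in> ?T. X \<in> \<mu>}"
      using fT by (intro card_mono) auto
    then show ?thesis using True meets[OF \<mu>] by auto
  next
    case False
    then obtain X where X: "{X \<in> ?T. X \<in> \<mu>} = {X}" by (metis card_1_singletonE)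
    have fin: "finite \<mu>" using Gens_subset \<mu> finite_Pts finite_subset by blast
    have "p dvd c Y" if "Y \<in> \<mu> - {R, X}" for Y
    proof (rule ccontr)
      assume "\<not> p dvd c Y"
      then have "Y \<in> S" using that Gens_subset \<mu> by (auto simp: S_def)
      moreover have "Y \<notin> ?T" using X that by blast
      moreover have "perp R Y" using Gens_perp \<mu> that by auto
      ultimately show False using False that \<mu> by auto
    qed
    then have 1: "p dvd (\<Sum>Y\<in>\<mu> - {R, X}. c Y)" by (rule dvd_sum)
    have "X \<noteq> R" "X \<in> \<mu>" using X RT by auto
    then have "(\<Sum>Y\<in>\<mu>. c Y) = (c R + c X) + (\<Sum>Y\<in>\<mu> - {R, X}. c Y)"
      using sum.subset_diff[of "{R, X}" \<mu> c] fin \<mu> by auto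
    then have "p dvd c R + c X"
      using 1 sum_Gens \<mu> by (metis (lifting) dvd_add_left_iff mem_Collect_eq)
    then have "{X \<in> ?X. X \<in> \<mu>} = {}"
    proof -
      have "Z = X" if "Z \<in> ?T" "Z \<in> \<mu>" for Z using X that by blast
      then show ?thesis using \<open>p dvd c R + c X\<close> by (force simp: add.commute)
    qed
    then have "card {X \<in> ?X. X \<in> \<mu>} = 0" by (simp only: card.empty)
    then show ?thesis using X by simp
  qed
  have "(\<Sum>\<mu>\<in>?G. 1 + card {X \<in> ?X. X \<in> \<mu>}) \<le>
     (\<Sum>\<mu>\<in>?G. card {X \<in> ?T. X \<in> \<mu>} + (card {X \<in> ?T. X \<in> \<mu>} - 1) + (if \<mu> \<in> ?b1 then 1 else 0))"
    by (rule sum_mono) (rule clean)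
  also have "\<dots> = card ?T * g + (card ?T * g - g * (M + 1)) + card ?b1"
  proof -
    have "(\<Sum>\<mu>\<in>?G. card {X \<in> ?T. X \<in> \<mu>} - 1) = card ?T * g - g * (M + 1)"
      using sum_subtractf_nat[of ?G "\<lambda>_. 1" "\<lambda>\<mu>. card {X \<in> ?T. X \<in> \<mu>}"] meets total cG by simp
    moreover have "(\<Sum>\<mu>\<in>?G. if \<mu> \<in> ?b1 then 1 else 0) = card ?b1"
    proof -
      have "?G \<inter> ?b1 = ?b1" by blast
      then show ?thesis using sum.inter_restrict[OF finG, of "\<lambda>_. 1::nat" ?b1] by simp
    qed
    ultimately show ?thesis by (simp add: sum.distrib total)
  qed
  also have "(\<Sum>\<mu>\<in>?G. 1 + card {X \<in> ?X. X \<in> \<mu>}) = g * (M + 1) + card ?X * g"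
  proof -
    have "(\<Sum>\<mu>\<in>?G. card {X \<in> ?X. X \<in> \<mu>}) = card ?X * g"
      using double_count[OF finG, of ?X "\<lambda>\<mu> X. X \<in> \<mu>"] through fT by simp
    then show ?thesis using cG by (simp add: sum_Suc)
  qed
  finally have "g * (M + 1) + card ?X * g \<le> card ?T * g + (card ?T * g - g * (M + 1)) + K * b * g"
    using b1 by linarith
  also have "\<dots> = g * (card ?T + (card ?T - (M + 1)) + K * b)"
    by (simp add: algebra_simps diff_mult_distrib2)
  finally have "g * (M + 1 + card ?X) \<le> g * (card ?T + (card ?T - (M + 1)) + K * b)"
    by (simp add: algebra_simps)
  then have "M + 1 + card ?X \<le> card ?T + (card ?T - (M + 1)) + K * b"
    using nat_mult_le_cancel1[OF g_pos] by blast
  then show "card ?X \<le> (K + 2) * b" using T_le by (simp add: algebra_simps)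
qed

section \<open>Descent: subtracting a polar pair lowers the weight\<close>

lemma weight_drop:
  fixes s s' u t :: nat
  assumes "s' \<le> d + (x + (y + i))" "a \<le> e + (x + y)" "u + t = a + i" "s = e + d"
    and "x \<le> z" "y \<le> z" "m \<le> t" "m \<le> u" "i \<le> b" "16 * z \<le> m" "b \<le> z"
  shows "s' + m \<le> s"
  using assms by linarith

text \<open>The coefficient is \<open>c R\<close> for a good point R of a dense section U. One use
  of \<open>good_constant\<close> gives the value - c R almost everywhere on the polar section T.
  Going back from T to U needs a good point of T that carries this typical value.\<close>

lemma descent:
  assumes "S \<noteq> {}"
  shows "\<exists>i\<in>Sub. \<exists>\<alpha>. card {P \<in> Pts. \<not> p dvd c P - \<alpha> * (of_bool (P \<in> pts i) - of_bool (P \<in> pts (pol i)))}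
     + M \<le> card S"
proof -
  obtain i where i: "i \<in> Sub" "M \<le> E * card (S \<inter> pts i)"
    using exists_dense_subspace[OF assms] by blast
  let ?T = "pts (pol i)" and ?U = "pts i"
  have pi: "pol i \<in> Sub" "pol (pol i) = i" using pol_Sub pol_pol i by auto
  have fin: "finite ?T" "finite ?U" "?T \<subseteq> Pts" "?U \<subseteq> Pts"
    using finite_pts pts_subset i(1) pi by auto
  have "2 * E * card {R. good i R} > 0" using many_good[OF i] M_pos by linarith
  then obtain R where R: "good i R" by (force simp: card_gt_0_iff)
  let ?X = "{X \<in> ?T. \<not> p dvd c X + c R}"
  have cX: "card ?X \<le> (K + 2) * b" and cT: "M \<le> card ?T"
    using good_constant[OF i(1) R] by auto
  have Rp: "\<not> p dvd c R" "R \<in> ?U" "R \<in> Pts" "R \<notin> ?T"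
    using R good_notin_pol[OF i(1) R] by (auto simp: good_def S_def)
  have "?T - ?X \<subseteq> S \<inter> ?T"
  proof
    fix X assume X: "X \<in> ?T - ?X"
    then have "p dvd c X + c R" by simp
    then have "\<not> p dvd c X" using Rp(1) by (metis dvd_add_right_iff)
    then show "X \<in> S \<inter> ?T" using X fin by (auto simp: S_def)
  qed
  then have "card (?T - ?X) \<le> card (S \<inter> ?T)" using finite_S by (intro card_mono) auto
  then have ST: "card ?T \<le> card (S \<inter> ?T) + card ?X"
    using fin by (simp add: card_Diff_subset)
  have b_K: "16 * ((K + 2) * b) \<le> M" using b_K_le by (simp only: mult.assoc)
  then have small: "2 * ((K + 2) * b) \<le> M" by linarith
  \<comment> \<open>Almost all of T lies in the support, so T is dense too, because \<open>E\<close>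
    is at least 2, and \<open>many_good\<close> applies to the polar subspace.\<close>
  have "2 * card (S \<inter> ?T) \<ge> M" using ST cX cT small by linarith
  also have "2 * card (S \<inter> ?T) \<le> E * card (S \<inter> ?T)" using E_ge by (rule mult_right_mono) simp
  finally have "M \<le> 2 * E * card {X. good (pol i) X}" using many_good[OF pi(1)] by blast
  \<comment> \<open>The exceptional points of T are fewer than its good points, so some good point
    is not exceptional.\<close>
  moreover have "2 * E * card ?X < M"
  proof -
    have "8 * E * card ?X \<le> 8 * E * ((K + 2) * b)" using cX by (rule mult_left_mono) simp
    moreover have "8 * E * ((K + 2) * b) = 8 * E * (K + 2) * b" by (simp only: mult.assoc)
    ultimately show ?thesis using b_E_le M_pos by linarith
  qed
  ultimately have "2 * E * card ?X < 2 * E * card {X. good (pol i) X}" by linarith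
  then have "card ?X < card {X. good (pol i) X}" by simp
  then have "\<not> {X. good (pol i) X} \<subseteq> ?X"
  proof -
    have "finite ?X" using fin by simp
    then show ?thesis using card_mono[of ?X "{X. good (pol i) X}"] \<open>card ?X < _\<close> by linarith
  qed
  then obtain X where X: "good (pol i) X" "X \<notin> ?X" by blast
  then have "X \<in> ?T" by (auto simp: good_def)
  then have dX: "p dvd c X + c R" using X by simp
  let ?Y = "{Y \<in> ?U. \<not> p dvd c Y + c X}"
  have cY: "card ?Y \<le> (K + 2) * b" and cU: "M \<le> card ?U"
    using good_constant[OF pi(1) X(1)] pi by auto
  have eqY: "p dvd c Y - c R" if "Y \<in> ?U - ?Y" for Y
  proof -
    have "p dvd (c Y + c X) - (c X + c R)" using that dX by (intro dvd_diff) auto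
    then show ?thesis by simp
  qed
  \<comment> \<open>R lies in U but not in T, so the points common to U and T lie in the proper
    hyperplane section of U by the polar of R.\<close>
  have I: "card (?U \<inter> ?T) \<le> b"
  proof -
    have "?U \<inter> ?T \<subseteq> {Z \<in> ?U. perp Z R}" using perp_pol[OF i(1) Rp(2)] perp_sym by auto
    then have "card (?U \<inter> ?T) \<le> card {Z \<in> ?U. perp Z R}" using fin by (intro card_mono) auto
    also have "\<dots> \<le> b" using card_hyperplane_section i(1) Rp by blast
    finally show ?thesis .
  qed
  let ?c' = "\<lambda>P. c P - c R * (of_bool (P \<in> ?U) - of_bool (P \<in> ?T))"
  let ?S' = "{P \<in> Pts. \<not> p dvd ?c' P}"
  have S': "?S' \<subseteq> (S - (?U \<union> ?T)) \<union> (?X \<union> (?Y \<union> (?U \<inter> ?T)))"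
    using eqY by (auto simp: S_def)
  have S: "(?U \<union> ?T) \<subseteq> (S \<inter> (?U \<union> ?T)) \<union> (?X \<union> ?Y)"
  proof
    fix P assume "P \<in> ?U \<union> ?T"
    then consider "P \<in> ?X" | "P \<in> ?Y" | "P \<in> ?T - ?X" | "P \<in> ?U - ?Y" by blast
    moreover have "P \<in> S" if "P \<in> ?U - ?Y"
    proof -
      have "\<not> p dvd c P"
      proof
        assume "p dvd c P"
        then have "p dvd c P - (c P - c R)" using eqY[OF that] by (rule dvd_diff)
        then show False using Rp(1) by simp
      qed
      then show ?thesis using that fin by (auto simp: S_def)
    qed
    moreover have "P \<in> S" if "P \<in> ?T - ?X" using that \<open>?T - ?X \<subseteq> S \<inter> ?T\<close> by blast
    ultimately show "P \<in> (S \<inter> (?U \<union> ?T)) \<union> (?X \<union> ?Y)" by cases blast+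
  qed
  have "card ?S' \<le> card (S - (?U \<union> ?T)) + (card ?X + (card ?Y + card (?U \<inter> ?T)))"
  proof -
    have "finite ((S - (?U \<union> ?T)) \<union> (?X \<union> (?Y \<union> (?U \<inter> ?T))))" using finite_S fin by simp
    then have "card ?S' \<le> card ((S - (?U \<union> ?T)) \<union> (?X \<union> (?Y \<union> (?U \<inter> ?T))))"
      using S' by (rule card_mono)
    also have "\<dots> \<le> card (S - (?U \<union> ?T)) + (card ?X + (card ?Y + card (?U \<inter> ?T)))"
      by (rule order.trans[OF card_Un_le add_left_mono[OF order.trans[OF card_Un_le add_left_mono[OF card_Un_le]]]])
    finally show ?thesis .
  qed
  moreover have "card (?U \<union> ?T) \<le> card (S \<inter> (?U \<union> ?T)) + (card ?X + card ?Y)"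
  proof -
    have "finite ((S \<inter> (?U \<union> ?T)) \<union> (?X \<union> ?Y))" using finite_S fin by simp
    then have "card (?U \<union> ?T) \<le> card ((S \<inter> (?U \<union> ?T)) \<union> (?X \<union> ?Y))"
      using S by (rule card_mono)
    also have "\<dots> \<le> card (S \<inter> (?U \<union> ?T)) + (card ?X + card ?Y)"
      by (rule order.trans[OF card_Un_le add_left_mono[OF card_Un_le]])
    finally show ?thesis .
  qed
  moreover have "card ?U + card ?T = card (?U \<union> ?T) + card (?U \<inter> ?T)"
    by (rule card_Un_Int) (use fin in auto)
  moreover have "card S = card (S \<inter> (?U \<union> ?T)) + card (S - (?U \<union> ?T))"
    using card_Int_Diff[OF finite_S] .
  \<comment> \<open>The weight falls by at least |U| + |T| minus twice the total size of
    \<open>?X\<close>, \<open>?Y\<close> and the intersection of U and T, hence by at least 2 * M -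
    6 * (K + 2) * b.\<close>
  ultimately have "card ?S' + M \<le> card S"
    using cX cY cT cU I b_K by (rule weight_drop) simp
  then show ?thesis by (intro bexI[of _ i] exI[of _ "c R"] i(1))
qed

end

text \<open>\<open>D\<close> fixes the constants, while \<open>k\<close> bounds the current weight
  in units of \<open>M\<close>. Subtracting a polar pair preserves the congruences because a
  generator meets a section and its polar in equally many points. The predicate \<open>W\<close>
  will be membership of the reduced word in the span.\<close>

lemma (in polar_configuration) code_word_induct:
  fixes p :: int and c :: "'x \<Rightarrow> int"
  assumes sum_Gens: "\<And>\<mu>. \<mu> \<in> Gens \<Longrightarrow> p dvd (\<Sum>P\<in>\<mu>. c P)"
    and "D > 0" "16 * (2 * D) ^ Suc n * (2 * D * (2 * D) ^ Suc n + 2) \<le> q"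
    and "k \<le> D" "card {P \<in> Pts. \<not> p dvd c P} \<le> k * M"
    and zero: "\<And>c. (\<And>P. P \<in> Pts \<Longrightarrow> p dvd c P) \<Longrightarrow> W c"
    and step: "\<And>c i \<alpha>. \<lbrakk>i \<in> Sub;
        W (\<lambda>P. c P - \<alpha> * (of_bool (P \<in> pts i) - of_bool (P \<in> pts (pol i))))\<rbrakk> \<Longrightarrow> W c"
  shows "W c"
  using assms(1,4,5)
proof (induction k arbitrary: c)
  case 0
  then have "{P \<in> Pts. \<not> p dvd c P} = {}" using finite_Pts by simp
  then show ?case by (intro zero) blast
next
  case (Suc k)
  show ?case
  proof (cases "{P \<in> Pts. \<not> p dvd c P} = {}")
    case True
    then show ?thesis by (intro zero) blast
  next
    case False
    have "card {P \<in> Pts. \<not> p dvd c P} \<le> D * M"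
      using Suc.prems(2) by (intro order.trans[OF Suc.prems(3)] mult_right_mono) auto
    then interpret code_word Pts perp Gens Sub pts pol flat q n M b g p c D
      using Suc.prems(1) assms(2,3) by unfold_locales auto
    obtain i \<alpha> where i: "i \<in> Sub" and
      le: "card {P \<in> Pts. \<not> p dvd c P - \<alpha> * (of_bool (P \<in> pts i) - of_bool (P \<in> pts (pol i)))}
        + M \<le> card S"
      using descent False by (auto simp: S_def)
    let ?c = "\<lambda>P. c P - \<alpha> * (of_bool (P \<in> pts i) - of_bool (P \<in> pts (pol i)))"
    have "p dvd (\<Sum>P\<in>\<mu>. ?c P)" if \<mu>: "\<mu> \<in> Gens" for \<mu>
    proof -
      have "finite \<mu>" using Gens_subset[OF \<mu>] finite_Pts finite_subset by blast
      then have "(\<Sum>P\<in>\<mu>. of_bool (P \<in> pts i) - of_bool (P \<in> pts (pol i)) :: int) = 0"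
        using card_Gens_Int_pol[OF i \<mu>] by (simp add: sum_subtractf sum.If_cases of_bool_def Int_def)
      then have "(\<Sum>P\<in>\<mu>. ?c P) = (\<Sum>P\<in>\<mu>. c P)"
        by (simp add: sum_subtractf sum_distrib_left[symmetric])
      then show ?thesis using Suc.prems(1) \<mu> by simp
    qed
    moreover have "card {P \<in> Pts. \<not> p dvd ?c P} \<le> k * M"
      using le Suc.prems(3) by (simp add: S_def)
    ultimately have "W ?c" using Suc.prems(2) by (intro Suc.IH) auto
    then show ?thesis using i step by blast
  qed
qed

section \<open>Fields with $q^2$ elements\<close>

lemma (in cring) binomial:
  fixes n :: nat
  assumes [simp]: "x \<in> carrier R" "y \<in> carrier R"
  shows "(x \<oplus> y) [^] n = (\<Oplus>k\<in>{..n}. add_pow R (n choose k) (x [^] k \<otimes> y [^] (n - k)))"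
proof (induction n)
  case 0
  show ?case by (simp add: add.nat_pow_eone)
next
  case (Suc n)
  let ?P = "\<lambda>k. x [^] Suc k \<otimes> y [^] (n - k)"
  let ?T = "\<lambda>k. add_pow R (n choose k) (x [^] k \<otimes> y [^] (n - k))"
  have X: "(\<Oplus>k\<in>{..n}. ?T k) \<otimes> x = (\<Oplus>k\<in>{..n}. add_pow R (n choose k) (?P k))"
    by (subst finsum_ldistr) (auto intro!: finsum_cong' simp: add_pow_ldistr add_pow_rdistr m_ac)
  have "(\<Oplus>k\<in>{..n}. ?T k) \<otimes> y = (\<Oplus>k\<in>{..n}. add_pow R (n choose k) (x [^] k \<otimes> y [^] (Suc n - k)))"
    by (subst finsum_ldistr) (auto intro!: finsum_cong' simp: add_pow_ldistr m_assoc Suc_diff_le)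
  also have "\<dots> = (\<Oplus>k\<in>{..Suc n}. add_pow R (n choose k) (x [^] k \<otimes> y [^] (Suc n - k)))"
    using finsum_Suc[of "\<lambda>k. add_pow R (n choose k) (x [^] k \<otimes> y [^] (Suc n - k))" n]
    by (simp add: binomial_eq_0 add.nat_pow_0)
  also have "\<dots> = (\<Oplus>k\<in>{..n}. add_pow R (n choose Suc k) (?P k)) \<oplus> y [^] Suc n"
    by (subst finsum_Suc2) (auto simp: add.nat_pow_eone)
  finally have Y: "(\<Oplus>k\<in>{..n}. ?T k) \<otimes> y = \<dots>" .
  have "(\<Oplus>k\<in>{..Suc n}. add_pow R (Suc n choose k) (x [^] k \<otimes> y [^] (Suc n - k)))
    = (\<Oplus>k\<in>{..n}. add_pow R (n choose k) (?P k) \<oplus> add_pow R (n choose Suc k) (?P k)) \<oplus> y [^] Suc n"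
    by (subst finsum_Suc2) (auto simp: add.nat_pow_eone add.nat_pow_mult[symmetric])
  also have "\<dots> = ((\<Oplus>k\<in>{..n}. add_pow R (n choose k) (?P k)) \<oplus> (\<Oplus>k\<in>{..n}. add_pow R (n choose Suc k) (?P k)))
    \<oplus> y [^] Suc n"
    by (subst finsum_addf) auto
  also have "\<dots> = (\<Oplus>k\<in>{..n}. ?T k) \<otimes> x \<oplus> (\<Oplus>k\<in>{..n}. ?T k) \<otimes> y"
    by (simp only: X Y) (rule a_assoc; auto)
  also have "\<dots> = (\<Oplus>k\<in>{..n}. ?T k) \<otimes> (x \<oplus> y)"
    by (rule r_distr[symmetric]) auto
  also have "\<dots> = (x \<oplus> y) [^] Suc n" using Suc by simp
  finally show ?case by simp
qed

text \<open>The order of the additive group kills 1, so a power of p does. In a field that power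
  factors into copies of p times 1, one of which must vanish.\<close>

lemma (in field) add_pow_prime_eq_zero:
  assumes "prime p" "card (carrier R) = p ^ k" "x \<in> carrier R"
  shows "add_pow R (p) x = \<zero>"
proof -
  have "add_pow R (p ^ k) \<one> = \<zero>"
    using add.pow_order_eq_1[of \<one>] assms by (simp add: order_def)
  then have "add_pow R (p) \<one> = \<zero>"
  proof (induction k)
    case (Suc k)
    have "add_pow R (p ^ Suc k) \<one> = (add_pow R (p) \<one>) \<otimes> (add_pow R (p ^ k) \<one>)"
      by (simp add: add_pow_ldistr add.nat_pow_pow mult.commute)
    then have "add_pow R (p) \<one> = \<zero> \<or> add_pow R (p ^ k) \<one> = \<zero>"
      using Suc.prems integral_iff by simp
    then show ?case using Suc.IH by blast
  qed (simp add: add.nat_pow_eone)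
  then show ?thesis using add_pow_ldistr[of \<one> x p] assms(3) by simp
qed

lemma (in field) frobenius_add:
  assumes "prime p" "card (carrier R) = p ^ k" and [simp]: "x \<in> carrier R" "y \<in> carrier R"
  shows "(x \<oplus> y) [^] (p ^ h) = x [^] (p ^ h) \<oplus> y [^] (p ^ h)"
proof (induction h)
  case (Suc h)
  have *: "(u \<oplus> v) [^] p = u [^] p \<oplus> v [^] p" if [simp]: "u \<in> carrier R" "v \<in> carrier R" for u v
  proof -
    let ?T = "\<lambda>k. add_pow R (p choose k) (u [^] k \<otimes> v [^] (p - k))"
    have "?T k = \<zero>" if "k \<in> {..p} - {0, p}" for k
    proof -
      have "p dvd p choose k" using that assms(1) by (intro dvd_choose_prime) auto
      then obtain m where "p choose k = p * m" ..
      then show ?thesis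
        using add_pow_prime_eq_zero[OF assms(1,2)] by (simp add: add.nat_pow_pow[symmetric])
    qed
    then have "(\<Oplus>k\<in>{..p}. ?T k) = (\<Oplus>k\<in>{0, p}. ?T k)"
      by (intro add.finprod_mono_neutral_cong_right) auto
    also have "\<dots> = u [^] p \<oplus> v [^] p"
      using prime_gt_0_nat[OF assms(1)] by (simp add: add.nat_pow_eone a_comm)
    finally show ?thesis by (simp add: binomial)
  qed
  have "z [^] (p ^ Suc h) = (z [^] (p ^ h)) [^] p" if "z \<in> carrier R" for z
    using that by (simp add: nat_pow_pow mult.commute)
  then show ?case using Suc * by simp
qed simp

section \<open>Conjugation, trace and norm over the fixed field\<close>

locale unitary_field = field R for R (structure) +
  fixes q :: nat
  assumes card_carrier: "card (carrier R) = q\<^sup>2"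
    and conj_add: "\<lbrakk>x \<in> carrier R; y \<in> carrier R\<rbrakk> \<Longrightarrow> (x \<oplus> y) [^] q = x [^] q \<oplus> y [^] q"
begin

lemma finite_carrier: "finite (carrier R)" and q_ge_2: "q \<ge> 2"
proof -
  \<comment> \<open>At q = 0 additivity would read 1 = 1 + 1. Excluding it also excludes an infinite
    carrier, whose \<open>card\<close> is 0.\<close>
  have "q \<noteq> 0"
  proof
    assume "q = 0"
    then have "\<zero> \<oplus> \<zero> = \<one> \<oplus> \<one>" "(\<one> \<oplus> \<one>) = \<one>" using conj_add[of \<one> \<one>] by auto
    then show False by simp
  qed
  then show fin: "finite (carrier R)" using card_carrier by (intro card_ge_0_finite) simp
  have "card {\<zero>, \<one>} \<le> card (carrier R)" using fin by (intro card_mono) auto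
  then have "q \<noteq> 1" using card_carrier by auto
  with \<open>q \<noteq> 0\<close> show "q \<ge> 2" by simp
qed

lemma q_gt_0 [simp]: "q > 0"
  using q_ge_2 by simp

lemma conj_zero [simp]: "\<zero> [^] q = \<zero>"
  by (simp add: nat_pow_zero)

lemma pow_eq_zero_iff': "x \<in> carrier R \<Longrightarrow> x [^] Suc k = \<zero> \<longleftrightarrow> x = \<zero>"
  by (induction k) (auto simp: integral_iff)

lemma conj_conj [simp]:
  assumes "x \<in> carrier R"
  shows "(x [^] q) [^] q = x"
proof (cases "x = \<zero>")
  case False
  interpret M: group "mult_of R" by (rule field_mult_group)
  have "x [^] (q\<^sup>2 - 1) = \<one>"
    using M.pow_order_eq_1[of x] False assms finite_carrier card_carrier
    by (simp add: order_mult_of order_def nat_pow_mult_of)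
  moreover have "q\<^sup>2 = Suc (q\<^sup>2 - 1)" by simp
  ultimately have "x [^] q\<^sup>2 = x" using assms by (metis l_one nat_pow_Suc)
  then show ?thesis using assms by (simp add: nat_pow_pow power2_eq_square)
qed simp

lemma conj_minus: "x \<in> carrier R \<Longrightarrow> (\<ominus> x) [^] q = \<ominus> (x [^] q)"
  using conj_add[of x "\<ominus> x"] by (simp add: r_neg minus_equality[symmetric] a_comm)

lemma pow_q_minus_1_eq_one:
  assumes "x \<in> carrier R" "x \<noteq> \<zero>" "x [^] q = x"
  shows "x [^] (q - 1) = \<one>"
proof -
  have "x [^] (q - 1) \<otimes> x = \<one> \<otimes> x"
    using assms nat_pow_Suc[of x "q - 1"] q_gt_0 by simp
  then show ?thesis using assms m_rcancel[of x "x [^] (q - 1)" \<one>] by simp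
qed

lemma card_fixed_le: "card {x \<in> carrier R. x [^] q = x} \<le> q"
proof -
  have "{x \<in> carrier R. x [^] q = x} \<subseteq> insert \<zero> {x \<in> carrier R. x [^] (q - 1) = \<one>}"
    using pow_q_minus_1_eq_one by auto
  then have "card {x \<in> carrier R. x [^] q = x} \<le> card (insert \<zero> {x \<in> carrier R. x [^] (q - 1) = \<one>})"
    using finite_carrier by (intro card_mono) auto
  also have "\<dots> \<le> Suc (card {x \<in> carrier R. x [^] (q - 1) = \<one>})"
    by (rule card_insert_le_m1) auto
  also have "\<dots> \<le> Suc (q - 1)"
    using num_roots_le_deg[OF finite_carrier, of "q - 1"] q_ge_2 by simp
  finally show ?thesis using q_ge_2 by simp
qed

text \<open>Dividing by one fixed member is injective; this compares both trace kernels and norm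
  fibres with sets of roots of a polynomial.\<close>

lemma card_quotients_le:
  assumes "t0 \<in> carrier R" "t0 \<noteq> \<zero>" "A \<subseteq> carrier R" "B \<subseteq> carrier R"
    and "\<And>t. t \<in> A \<Longrightarrow> t \<otimes> inv t0 \<in> B"
  shows "card A \<le> card B"
proof (rule card_inj_on_le[of "\<lambda>t. t \<otimes> inv t0"])
  have "inv t0 \<in> carrier R" "t0 \<otimes> inv t0 = \<one>" using assms(1,2) by (auto simp: field_Units)
  then have "inv t0 \<in> carrier R" "inv t0 \<noteq> \<zero>" using assms(1) by auto
  then show "inj_on (\<lambda>t. t \<otimes> inv t0) A" using assms(3) m_rcancel by (intro inj_onI) (metis subsetD)
qed (use assms finite_carrier finite_subset in auto)

text \<open>Trace zero means that conjugation is negation, so the quotient of two such elements is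
  fixed by conjugation.\<close>

lemma card_trace_kernel_le: "card {t \<in> carrier R. t \<oplus> t [^] q = \<zero>} \<le> q"
proof (cases "{t \<in> carrier R. t \<oplus> t [^] q = \<zero>} \<subseteq> {\<zero>}")
  case True
  then have "card {t \<in> carrier R. t \<oplus> t [^] q = \<zero>} \<le> card {\<zero>}" by (intro card_mono) auto
  then show ?thesis using q_ge_2 by simp
next
  case False
  then obtain t0 where t0: "t0 \<in> carrier R" "t0 \<oplus> t0 [^] q = \<zero>" "t0 \<noteq> \<zero>" by blast
  have i: "inv t0 \<in> carrier R" "t0 \<otimes> inv t0 = \<one>" using t0 by (auto simp: field_Units)
  have neg: "t [^] q = \<ominus> t" if "t \<in> carrier R" "t \<oplus> t [^] q = \<zero>" for t
    using that by (metis a_comm minus_equality nat_pow_closed)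
  have "(t0 \<otimes> inv t0) [^] q = \<one>" using i by simp
  then have "(\<ominus> t0) \<otimes> (inv t0) [^] q = \<one>"
    using t0 i neg[of t0] nat_pow_distrib[of t0 "inv t0" q] by metis
  then have "t0 \<otimes> (\<ominus> ((inv t0) [^] q)) = t0 \<otimes> inv t0" using t0 i by (simp add: l_minus r_minus)
  then have inv: "\<ominus> ((inv t0) [^] q) = inv t0" using t0 i m_lcancel by (metis a_inv_closed nat_pow_closed)
  have "(t \<otimes> inv t0) [^] q = t \<otimes> inv t0" if "t \<in> carrier R" "t \<oplus> t [^] q = \<zero>" for t
  proof -
    have "(t \<otimes> inv t0) [^] q = (\<ominus> t) \<otimes> (inv t0) [^] q"
      using that i neg by (simp add: nat_pow_distrib)
    also have "\<dots> = t \<otimes> (\<ominus> ((inv t0) [^] q))" using that i by (simp add: l_minus r_minus)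
    finally show ?thesis using inv by simp
  qed
  then have "card {t \<in> carrier R. t \<oplus> t [^] q = \<zero>} \<le> card {x \<in> carrier R. x [^] q = x}"
    using i t0 by (intro card_quotients_le[of t0]) auto
  then show ?thesis using card_fixed_le by simp
qed

lemma card_trace_fibre_le:
  assumes "y \<in> carrier R"
  shows "card {t \<in> carrier R. t \<oplus> t [^] q = y} \<le> q"
proof (cases "{t \<in> carrier R. t \<oplus> t [^] q = y} = {}")
  case False
  then obtain t0 where t0: "t0 \<in> carrier R" "t0 \<oplus> t0 [^] q = y" by blast
  have "card {t \<in> carrier R. t \<oplus> t [^] q = y} \<le> card {t \<in> carrier R. t \<oplus> t [^] q = \<zero>}"
  proof (rule card_inj_on_le[of "\<lambda>t. t \<ominus> t0"])
    show "inj_on (\<lambda>t. t \<ominus> t0) {t \<in> carrier R. t \<oplus> t [^] q = y}"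
      using t0 by (intro inj_onI) (auto simp: minus_eq)
    show "(\<lambda>t. t \<ominus> t0) ` {t \<in> carrier R. t \<oplus> t [^] q = y} \<subseteq> {t \<in> carrier R. t \<oplus> t [^] q = \<zero>}"
    proof safe
      fix t assume t: "t \<in> carrier R" "y = t \<oplus> t [^] q"
      have "(t \<ominus> t0) \<oplus> (t \<ominus> t0) [^] q = (t \<oplus> t [^] q) \<ominus> (t0 \<oplus> t0 [^] q)"
        using t t0(1) by (simp add: minus_eq conj_add conj_minus minus_add a_ac)
      then show "(t \<ominus> t0) \<oplus> (t \<ominus> t0) [^] q = \<zero>" using t t0 by simp
    qed (use t0 in auto)
  qed (use finite_carrier in simp)
  then show ?thesis using card_trace_kernel_le by simp
qed (use q_ge_2 in \<open>metis card.empty zero_le\<close>)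

text \<open>Traces are fixed by conjugation, so there are at most q values, each with at most q
  preimages. As the fibres share out all q^2 elements, none can be smaller.\<close>

lemma card_trace_fibre:
  assumes "y \<in> carrier R" "y [^] q = y"
  shows "card {t \<in> carrier R. t \<oplus> t [^] q = y} = q"
proof (rule ccontr)
  let ?F = "{x \<in> carrier R. x [^] q = x}"
  let ?f = "\<lambda>y. card {t \<in> carrier R. t \<oplus> t [^] q = y}"
  assume "?f y \<noteq> q"
  then have less: "?f y < q" using card_trace_fibre_le[OF assms(1)] by simp
  have "(\<lambda>t. t \<oplus> t [^] q) ` carrier R \<subseteq> ?F" by (auto simp: conj_add a_comm)
  then have "card (carrier R) = (\<Sum>y\<in>?F. ?f y)"
    using finite_carrier card_eq_sum
      sum.group[of "carrier R" ?F "\<lambda>t. t \<oplus> t [^] q" "\<lambda>_. 1::nat"] by simp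
  also have "\<dots> < (\<Sum>y\<in>?F. q)"
    using assms less finite_carrier card_trace_fibre_le
    by (intro sum_strict_mono_ex1) auto
  also have "\<dots> \<le> q * q" using card_fixed_le by simp
  finally show False using card_carrier by (simp add: power2_eq_square)
qed

lemma card_norm_fibre_le:
  assumes "a \<in> carrier R"
  shows "card {t \<in> carrier R. t [^] (q + 1) = a} \<le> q + 1"
proof (cases "\<exists>t\<in>carrier R. t [^] (q + 1) = a \<and> t \<noteq> \<zero>")
  case False
  then have "card {t \<in> carrier R. t [^] (q + 1) = a} \<le> card {\<zero>}" by (intro card_mono) auto
  then show ?thesis by simp
next
  case True
  then obtain t0 where t0: "t0 \<in> carrier R" "t0 [^] (q + 1) = a" "t0 \<noteq> \<zero>" by blast
  have i: "inv t0 \<in> carrier R" "t0 \<otimes> inv t0 = \<one>" using t0 by (auto simp: field_Units)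
  have "(t \<otimes> inv t0) [^] (q + 1) = \<one>" if "t \<in> carrier R" "t [^] (q + 1) = a" for t
  proof -
    have "(t \<otimes> inv t0) [^] (q + 1) = (t0 \<otimes> inv t0) [^] (q + 1)"
      using that i t0 nat_pow_distrib[of t "inv t0" "q + 1"] nat_pow_distrib[of t0 "inv t0" "q + 1"]
      by metis
    then show ?thesis using i(2) by (simp only: nat_pow_one)
  qed
  then have "card {t \<in> carrier R. t [^] (q + 1) = a} \<le> card {x \<in> carrier R. x [^] (q + 1) = \<one>}"
    using i t0 by (intro card_quotients_le[of t0]) auto
  also have "\<dots> \<le> q + 1" by (rule num_roots_le_deg[OF finite_carrier]) simp
  finally show ?thesis .
qed

text \<open>Norms of nonzero elements satisfy y^(q-1) = 1, an equation with at most q - 1 roots, one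
  of them -1. If -1 were missed, at most q - 2 values with fibres of size at most q + 1 would have
  to cover q^2 - 1 elements. The element found here supplies the maximal totally isotropic subspace
  in coordinates.\<close>

lemma exists_norm_minus_one: "\<exists>a\<in>carrier R. a [^] (q + 1) = \<ominus> \<one>"
proof (rule ccontr)
  assume *: "\<not> ?thesis"
  let ?U = "{x \<in> carrier R. x [^] (q - 1) = \<one>}" and ?C = "carrier R - {\<zero>}"
  have m1: "\<ominus> \<one> \<in> ?U" using pow_q_minus_1_eq_one[of "\<ominus> \<one>"] conj_minus[of \<one>] by simp
  have "(x [^] (q + 1)) [^] (q - 1) = \<one>" if x: "x \<in> ?C" for x
  proof (rule pow_q_minus_1_eq_one)
    show "(x [^] (q + 1)) [^] q = x [^] (q + 1)"
      using x by (simp add: nat_pow_distrib m_comm)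
    show "x [^] (q + 1) \<noteq> \<zero>" using x pow_eq_zero_iff'[of x q] by simp
  qed (use x in auto)
  then have "(\<lambda>t. t [^] (q + 1)) ` ?C \<subseteq> ?U - {\<ominus> \<one>}" using * by auto
  then have "card ?C = (\<Sum>y\<in>?U - {\<ominus> \<one>}. card {t \<in> ?C. t [^] (q + 1) = y})"
    using finite_carrier
      sum.group[of ?C "?U - {\<ominus> \<one>}" "\<lambda>t. t [^] (q + 1)" "\<lambda>_. 1::nat"] by simp
  also have "\<dots> \<le> (\<Sum>y\<in>?U - {\<ominus> \<one>}. q + 1)"
  proof (rule sum_mono)
    fix y assume "y \<in> ?U - {\<ominus> \<one>}"
    then have "card {t \<in> carrier R. t [^] (q + 1) = y} \<le> q + 1" by (intro card_norm_fibre_le) auto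
    moreover have "card {t \<in> ?C. t [^] (q + 1) = y} \<le> card {t \<in> carrier R. t [^] (q + 1) = y}"
      using finite_carrier by (intro card_mono) auto
    ultimately show "card {t \<in> ?C. t [^] (q + 1) = y} \<le> q + 1" by linarith
  qed
  also have "\<dots> = (card ?U - 1) * (q + 1)" using m1 finite_carrier by simp
  also have "\<dots> \<le> (q - 1 - 1) * (q + 1)"
    using num_roots_le_deg[OF finite_carrier, of "q - 1"] q_ge_2
    by (intro mult_right_mono diff_le_mono) auto
  finally have "q\<^sup>2 - 1 \<le> (q - 2) * (q + 1)" using card_carrier by (simp add: numeral_2_eq_2)
  moreover obtain k where "q = k + 2" using q_ge_2 le_Suc_ex by (metis add.commute)
  ultimately show False by (simp add: power2_eq_square)
qed

end

section \<open>Hermitian spaces\<close>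

locale hermitian_space = vectorspace K V + unitary_field K q
  for K :: "('a, 'b) ring_scheme" and V :: "('a, 'c, 'd) module_scheme" and q :: nat +
  fixes h :: "'c \<Rightarrow> 'c \<Rightarrow> 'a"
  assumes finite_V: "finite (carrier V)"
    and h_closed [simp]: "\<lbrakk>x \<in> carrier V; y \<in> carrier V\<rbrakk> \<Longrightarrow> h x y \<in> carrier K"
    and h_add: "\<lbrakk>x \<in> carrier V; y \<in> carrier V; z \<in> carrier V\<rbrakk> \<Longrightarrow>
      h (x \<oplus>\<^bsub>V\<^esub> y) z = h x z \<oplus>\<^bsub>K\<^esub> h y z"
    and h_smult: "\<lbrakk>k \<in> carrier K; x \<in> carrier V; z \<in> carrier V\<rbrakk> \<Longrightarrow>
      h (k \<odot>\<^bsub>V\<^esub> x) z = k \<otimes>\<^bsub>K\<^esub> h x z"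
    and h_conj: "\<lbrakk>x \<in> carrier V; y \<in> carrier V\<rbrakk> \<Longrightarrow> h y x = h x y [^]\<^bsub>K\<^esub> q"
    and h_nondegenerate: "\<lbrakk>x \<in> carrier V; \<And>y. y \<in> carrier V \<Longrightarrow> h x y = \<zero>\<^bsub>K\<^esub>\<rbrakk> \<Longrightarrow> x = \<zero>\<^bsub>V\<^esub>"
begin

lemma h_add_right: "\<lbrakk>x \<in> carrier V; y \<in> carrier V; z \<in> carrier V\<rbrakk> \<Longrightarrow>
    h z (x \<oplus>\<^bsub>V\<^esub> y) = h z x \<oplus>\<^bsub>K\<^esub> h z y"
  using h_conj[of "x \<oplus>\<^bsub>V\<^esub> y" z] h_conj[of x z] h_conj[of y z] by (simp add: h_add conj_add)

lemma h_smult_right: "\<lbrakk>k \<in> carrier K; x \<in> carrier V; z \<in> carrier V\<rbrakk> \<Longrightarrow>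
    h z (k \<odot>\<^bsub>V\<^esub> x) = k [^]\<^bsub>K\<^esub> q \<otimes>\<^bsub>K\<^esub> h z x"
  using h_conj[of "k \<odot>\<^bsub>V\<^esub> x" z] h_conj[of x z] by (simp add: h_smult nat_pow_distrib)

lemma h_zero_left [simp]: "x \<in> carrier V \<Longrightarrow> h \<zero>\<^bsub>V\<^esub> x = \<zero>\<^bsub>K\<^esub>"
  using h_smult[of "\<zero>\<^bsub>K\<^esub>" "\<zero>\<^bsub>V\<^esub>" x] by simp

lemma h_zero_right [simp]: "x \<in> carrier V \<Longrightarrow> h x \<zero>\<^bsub>V\<^esub> = \<zero>\<^bsub>K\<^esub>"
  using h_conj[of "\<zero>\<^bsub>V\<^esub>" x] by simp

lemma h_eq_zero_commute: "\<lbrakk>x \<in> carrier V; y \<in> carrier V\<rbrakk> \<Longrightarrow> h x y = \<zero>\<^bsub>K\<^esub> \<longleftrightarrow> h y x = \<zero>\<^bsub>K\<^esub>"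
  using h_conj[of x y] h_conj[of y x] by (metis conj_zero)

lemma subspaceI:
  assumes "W \<subseteq> carrier V" "\<zero>\<^bsub>V\<^esub> \<in> W" "\<And>x y. \<lbrakk>x \<in> W; y \<in> W\<rbrakk> \<Longrightarrow> x \<oplus>\<^bsub>V\<^esub> y \<in> W"
    and "\<And>k x. \<lbrakk>k \<in> carrier K; x \<in> W\<rbrakk> \<Longrightarrow> k \<odot>\<^bsub>V\<^esub> x \<in> W"
  shows "VectorSpace.subspace K W V"
proof -
  have "vectorspace K V" "Module.module K V" by unfold_locales
  then show ?thesis using assms by (simp add: VectorSpace.subspace_def submodule_def)
qed

lemma subspace_closed:
  assumes "VectorSpace.subspace K W V"
  shows "W \<subseteq> carrier V" "x \<in> W \<Longrightarrow> x \<in> carrier V" "\<zero>\<^bsub>V\<^esub> \<in> W" "\<lbrakk>x \<in> W; y \<in> W\<rbrakk> \<Longrightarrow> x \<oplus>\<^bsub>V\<^esub> y \<in> W"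
    "\<lbrakk>k \<in> carrier K; x \<in> W\<rbrakk> \<Longrightarrow> k \<odot>\<^bsub>V\<^esub> x \<in> W" "finite W"
proof -
  interpret W: submodule K W V using assms by (simp add: VectorSpace.subspace_def)
  show "W \<subseteq> carrier V" by (rule W.subset)
  then show "x \<in> W \<Longrightarrow> x \<in> carrier V" "finite W" using finite_V finite_subset by auto
  show "\<zero>\<^bsub>V\<^esub> \<in> W" by (rule W.zero_closed)
  show "\<lbrakk>x \<in> W; y \<in> W\<rbrakk> \<Longrightarrow> x \<oplus>\<^bsub>V\<^esub> y \<in> W" by (rule W.m_closed)
  show "\<lbrakk>k \<in> carrier K; x \<in> W\<rbrakk> \<Longrightarrow> k \<odot>\<^bsub>V\<^esub> x \<in> W" by (rule W.smult_closed)
qed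

lemma subspace_neg:
  assumes "VectorSpace.subspace K W V" "x \<in> W"
  shows "\<ominus>\<^bsub>V\<^esub> x \<in> W"
proof -
  have "(\<ominus>\<^bsub>K\<^esub> \<one>\<^bsub>K\<^esub>) \<odot>\<^bsub>V\<^esub> x \<in> W" using assms(2) by (intro subspace_closed(5)[OF assms(1)]) auto
  then show ?thesis using smult_minus_1[of x] subspace_closed(2)[OF assms] by simp
qed

lemma subspace_zero: "VectorSpace.subspace K {\<zero>\<^bsub>V\<^esub>} V"
  by (rule subspaceI) auto

lemma subspace_carrier: "VectorSpace.subspace K (carrier V) V"
  by (rule subspaceI) auto

lemma subspace_Int:
  assumes "VectorSpace.subspace K U V" "VectorSpace.subspace K W V"
  shows "VectorSpace.subspace K (U \<inter> W) V"
  using subspace_closed(1,3-5)[OF assms(1)] subspace_closed(1,3-5)[OF assms(2)]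
  by (intro subspaceI) auto

section \<open>Orthogonal complements and adjoining a vector\<close>

definition orth :: "'c set \<Rightarrow> 'c set" where
  "orth W = {y \<in> carrier V. \<forall>x\<in>W. h x y = \<zero>\<^bsub>K\<^esub>}"

lemma orth_subset: "orth W \<subseteq> carrier V"
  by (auto simp: orth_def)

lemma subspace_orth: "W \<subseteq> carrier V \<Longrightarrow> VectorSpace.subspace K (orth W) V"
proof (rule subspaceI)
  assume W: "W \<subseteq> carrier V"
  show "orth W \<subseteq> carrier V" by (rule orth_subset)
  show "\<zero>\<^bsub>V\<^esub> \<in> orth W" using W by (auto simp: orth_def)
  fix x assume x: "x \<in> orth W"
  {
    fix y assume y: "y \<in> orth W"
    have "h w (x \<oplus>\<^bsub>V\<^esub> y) = \<zero>\<^bsub>K\<^esub>" if "w \<in> W" for w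
      using that x y W h_add_right[of x y w] by (auto simp: orth_def)
    then show "x \<oplus>\<^bsub>V\<^esub> y \<in> orth W" using x y by (auto simp: orth_def)
  }
  fix k assume k: "k \<in> carrier K"
  have "h w (k \<odot>\<^bsub>V\<^esub> x) = \<zero>\<^bsub>K\<^esub>" if "w \<in> W" for w
    using that x k W h_smult_right[of k x w] by (auto simp: orth_def)
  then show "k \<odot>\<^bsub>V\<^esub> x \<in> orth W" using x k by (auto simp: orth_def)
qed

lemma orth_antimono: "U \<subseteq> W \<Longrightarrow> orth W \<subseteq> orth U"
  by (auto simp: orth_def)

lemma orth_commute: "\<lbrakk>U \<subseteq> carrier V; W \<subseteq> carrier V\<rbrakk> \<Longrightarrow> U \<subseteq> orth W \<longleftrightarrow> W \<subseteq> orth U"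
  unfolding orth_def using h_eq_zero_commute by blast

lemma subset_orth_orth: "W \<subseteq> carrier V \<Longrightarrow> W \<subseteq> orth (orth W)"
  using orth_commute[OF _ orth_subset] by blast

definition adjoin :: "'c set \<Rightarrow> 'c \<Rightarrow> 'c set" where
  "adjoin U x = (\<lambda>(u, k). u \<oplus>\<^bsub>V\<^esub> k \<odot>\<^bsub>V\<^esub> x) ` (U \<times> carrier K)"

lemma adjoinI: "\<lbrakk>u \<in> U; k \<in> carrier K; v = u \<oplus>\<^bsub>V\<^esub> k \<odot>\<^bsub>V\<^esub> x\<rbrakk> \<Longrightarrow> v \<in> adjoin U x"
  by (auto simp: adjoin_def)

lemma adjoinE:
  assumes "v \<in> adjoin U x"
  obtains u k where "u \<in> U" "k \<in> carrier K" "v = u \<oplus>\<^bsub>V\<^esub> k \<odot>\<^bsub>V\<^esub> x"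
  using assms by (auto simp: adjoin_def)

lemma subspace_adjoin:
  assumes U: "VectorSpace.subspace K U V" and x: "x \<in> carrier V"
  shows "VectorSpace.subspace K (adjoin U x) V"
proof (rule subspaceI)
  show "adjoin U x \<subseteq> carrier V" using x by (auto simp: adjoin_def subspace_closed[OF U])
  show "\<zero>\<^bsub>V\<^esub> \<in> adjoin U x"
    using x by (intro adjoinI[of "\<zero>\<^bsub>V\<^esub>" _ "\<zero>\<^bsub>K\<^esub>"]) (auto simp: subspace_closed[OF U])
  fix v assume "v \<in> adjoin U x"
  then obtain u k where v: "u \<in> U" "k \<in> carrier K" "v = u \<oplus>\<^bsub>V\<^esub> k \<odot>\<^bsub>V\<^esub> x" by (rule adjoinE)
  then have uV: "u \<in> carrier V" by (simp add: subspace_closed[OF U])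
  {
    fix w assume "w \<in> adjoin U x"
    then obtain u' k' where w: "u' \<in> U" "k' \<in> carrier K" "w = u' \<oplus>\<^bsub>V\<^esub> k' \<odot>\<^bsub>V\<^esub> x" by (rule adjoinE)
    then have "u' \<in> carrier V" by (simp add: subspace_closed[OF U])
    then have "v \<oplus>\<^bsub>V\<^esub> w = (u \<oplus>\<^bsub>V\<^esub> u') \<oplus>\<^bsub>V\<^esub> (k \<oplus>\<^bsub>K\<^esub> k') \<odot>\<^bsub>V\<^esub> x"
      using v w x uV by (simp add: smult_l_distr M.a_ac)
    then show "v \<oplus>\<^bsub>V\<^esub> w \<in> adjoin U x"
      using v w by (intro adjoinI) (auto simp: subspace_closed[OF U])
  }
  fix l assume l: "l \<in> carrier K"
  have "l \<odot>\<^bsub>V\<^esub> v = l \<odot>\<^bsub>V\<^esub> u \<oplus>\<^bsub>V\<^esub> (l \<otimes>\<^bsub>K\<^esub> k) \<odot>\<^bsub>V\<^esub> x"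
    using v l x uV by (simp add: smult_r_distr smult_assoc1)
  then show "l \<odot>\<^bsub>V\<^esub> v \<in> adjoin U x"
    using v l by (intro adjoinI) (auto simp: subspace_closed[OF U])
qed

lemma adjoin_supset: "\<lbrakk>VectorSpace.subspace K U V; x \<in> carrier V\<rbrakk> \<Longrightarrow> U \<subseteq> adjoin U x"
  by (intro subsetI adjoinI[of _ _ "\<zero>\<^bsub>K\<^esub>"]) (auto dest: subspace_closed(2))

lemma adjoin_self: "\<lbrakk>VectorSpace.subspace K U V; x \<in> carrier V\<rbrakk> \<Longrightarrow> x \<in> adjoin U x"
  by (intro adjoinI[of "\<zero>\<^bsub>V\<^esub>" _ "\<one>\<^bsub>K\<^esub>"]) (auto dest: subspace_closed(3))

lemma adjoin_least: "\<lbrakk>VectorSpace.subspace K W V; U \<subseteq> W; x \<in> W\<rbrakk> \<Longrightarrow> adjoin U x \<subseteq> W"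
  by (rule subsetI, erule adjoinE) (auto intro: subspace_closed(4,5))

lemma adjoin_subset_iff:
  "\<lbrakk>VectorSpace.subspace K U V; VectorSpace.subspace K W V; x \<in> carrier V\<rbrakk> \<Longrightarrow> adjoin U x \<subseteq> W \<longleftrightarrow> U \<subseteq> W \<and> x \<in> W"
  using adjoin_least[of W U x] adjoin_supset[of U x] adjoin_self[of U x] by blast

lemma orth_adjoin:
  assumes "VectorSpace.subspace K U V" "x \<in> carrier V"
  shows "orth (adjoin U x) = orth U \<inter> orth {x}"
proof -
  have U: "U \<subseteq> carrier V" using assms(1) by (rule subspace_closed)
  have "v \<in> orth (adjoin U x)" if "v \<in> orth U \<inter> orth {x}" for v
  proof -
    have "VectorSpace.subspace K (orth {v}) V" using that orth_subset by (intro subspace_orth) auto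
    moreover have "U \<subseteq> orth {v}" "x \<in> orth {v}"
      using that assms U h_eq_zero_commute unfolding orth_def by blast+
    ultimately have "adjoin U x \<subseteq> orth {v}" by (rule adjoin_least)
    then show ?thesis using orth_commute[of "{v}" "adjoin U x"] that orth_subset
        subspace_closed(1)[OF subspace_adjoin[OF assms]] by auto
  qed
  then show ?thesis
    using orth_antimono[OF adjoin_supset[OF assms]] orth_antimono[of "{x}" "adjoin U x"]
      adjoin_self[OF assms] by auto
qed

lemma smult_in_subspace_iff:
  assumes W: "VectorSpace.subspace K W V" "x \<in> carrier V" "k \<in> carrier K" "k \<noteq> \<zero>\<^bsub>K\<^esub>"
  shows "k \<odot>\<^bsub>V\<^esub> x \<in> W \<longleftrightarrow> x \<in> W"
proof
  assume *: "k \<odot>\<^bsub>V\<^esub> x \<in> W"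
  have i: "inv\<^bsub>K\<^esub> k \<in> carrier K" "inv\<^bsub>K\<^esub> k \<otimes>\<^bsub>K\<^esub> k = \<one>\<^bsub>K\<^esub>" using assms by (auto simp: field_Units)
  then have "inv\<^bsub>K\<^esub> k \<odot>\<^bsub>V\<^esub> (k \<odot>\<^bsub>V\<^esub> x) = x"
    using assms by (simp add: smult_assoc1[symmetric])
  then show "x \<in> W" using subspace_closed(5)[OF W(1) i(1) *] by simp
qed (use assms subspace_closed in auto)

lemma card_adjoin:
  assumes U: "VectorSpace.subspace K U V" and x: "x \<in> carrier V" "x \<notin> U"
  shows "card (adjoin U x) = q\<^sup>2 * card U"
proof -
  have "inj_on (\<lambda>(u, k). u \<oplus>\<^bsub>V\<^esub> k \<odot>\<^bsub>V\<^esub> x) (U \<times> carrier K)"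
  proof (intro inj_onI, clarify)
    fix u k u' k'
    assume u: "u \<in> U" "u' \<in> U" and k: "k \<in> carrier K" "k' \<in> carrier K"
      and eq: "u \<oplus>\<^bsub>V\<^esub> k \<odot>\<^bsub>V\<^esub> x = u' \<oplus>\<^bsub>V\<^esub> k' \<odot>\<^bsub>V\<^esub> x"
    have uV: "u \<in> carrier V" "u' \<in> carrier V" using u by (simp_all add: subspace_closed[OF U])
    have "(k \<ominus>\<^bsub>K\<^esub> k') \<odot>\<^bsub>V\<^esub> x = k \<odot>\<^bsub>V\<^esub> x \<oplus>\<^bsub>V\<^esub> \<ominus>\<^bsub>V\<^esub> (k' \<odot>\<^bsub>V\<^esub> x)"
      using k x by (simp add: R.minus_eq smult_l_distr smult_l_minus)
    also have "\<dots> = (\<ominus>\<^bsub>V\<^esub> u \<oplus>\<^bsub>V\<^esub> (u \<oplus>\<^bsub>V\<^esub> k \<odot>\<^bsub>V\<^esub> x)) \<oplus>\<^bsub>V\<^esub> \<ominus>\<^bsub>V\<^esub> (k' \<odot>\<^bsub>V\<^esub> x)"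
      using uV k x by (simp add: M.r_neg1)
    also have "\<dots> = \<ominus>\<^bsub>V\<^esub> u \<oplus>\<^bsub>V\<^esub> u'"
      using uV k x by (simp add: eq M.a_assoc M.r_neg)
    finally have "(k \<ominus>\<^bsub>K\<^esub> k') \<odot>\<^bsub>V\<^esub> x \<in> U"
      using u subspace_neg[OF U] subspace_closed(4)[OF U] by simp
    then have "k \<ominus>\<^bsub>K\<^esub> k' = \<zero>\<^bsub>K\<^esub>"
      using smult_in_subspace_iff[OF U x(1), of "k \<ominus>\<^bsub>K\<^esub> k'"] k x(2) by auto
    then have "k = k'" using k by simp
    then show "u = u' \<and> k = k'" using eq uV k x by simp
  qed
  then show ?thesis using card_carrier by (simp add: adjoin_def card_image card_cartesian_product)
qed

text \<open>This replaces induction on dimension: in a finite space, adjoining one missing vector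
  after another reaches W.\<close>

lemma subspace_chain_induct [consumes 3, case_names base step]:
  assumes "VectorSpace.subspace K U V" "VectorSpace.subspace K W V" "U \<subseteq> W"
    and base: "P U"
    and step: "\<And>Y x. \<lbrakk>VectorSpace.subspace K Y V; U \<subseteq> Y; Y \<subseteq> W; x \<in> W; x \<notin> Y; P Y\<rbrakk> \<Longrightarrow> P (adjoin Y x)"
  shows "P W"
proof -
  have fin: "finite W" by (simp add: subspace_closed[OF assms(2)])
  have "P W" if "VectorSpace.subspace K Y V" "U \<subseteq> Y" "Y \<subseteq> W" "P Y" for Y
    using that
  proof (induction "card W - card Y" arbitrary: Y rule: less_induct)
    case less
    show ?case
    proof (cases "Y = W")
      case False
      then obtain x where x: "x \<in> W" "x \<notin> Y" using less.prems by blast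
      then have xV: "x \<in> carrier V" by (simp add: subspace_closed[OF assms(2)])
      let ?Y = "adjoin Y x"
      have sub: "Y \<subseteq> ?Y" "x \<in> ?Y" "?Y \<subseteq> W"
        using adjoin_supset[OF less.prems(1) xV] adjoin_self[OF less.prems(1) xV]
          adjoin_least[OF assms(2) less.prems(3) x(1)] by blast+
      then have "Y \<subset> ?Y" using x by blast
      then have "card Y < card ?Y" "card ?Y \<le> card W"
        using psubset_card_mono[OF finite_subset[OF sub(3) fin]] card_mono[OF fin sub(3)] by auto
      then have "card W - card ?Y < card W - card Y" by linarith
      moreover have "P ?Y" using less.prems x by (intro step)
      ultimately show ?thesis
        using less.hyps[OF _ subspace_adjoin[OF less.prems(1) xV]] less.prems(2) sub by blast
    qed (use less.prems in simp)
  qed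
  from this[OF assms(1) order.refl assms(3) base] show ?thesis .
qed

text \<open>Subtracting the multiple of w with coefficient h v x / h w x makes any v in W orthogonal
  to x.\<close>

lemma hyperplane_section:
  assumes W: "VectorSpace.subspace K W V" and x: "x \<in> carrier V" and w: "w \<in> W" "w \<notin> orth {x}"
  shows "W = adjoin (W \<inter> orth {x}) w" and "card W = q\<^sup>2 * card (W \<inter> orth {x})"
proof -
  have wV: "w \<in> carrier V" using w by (simp add: subspace_closed[OF W])
  have "h x w \<noteq> \<zero>\<^bsub>K\<^esub>" using w wV by (simp add: orth_def)
  then have hwx: "h w x \<noteq> \<zero>\<^bsub>K\<^esub>" using h_eq_zero_commute wV x by blast
  let ?i = "inv\<^bsub>K\<^esub> (h w x)" and ?H = "W \<inter> orth {x}"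
  have i: "?i \<in> carrier K" "?i \<otimes>\<^bsub>K\<^esub> h w x = \<one>\<^bsub>K\<^esub>" using hwx wV x by (auto simp: field_Units)
  have H: "VectorSpace.subspace K ?H V" using W x by (intro subspace_Int subspace_orth) auto
  have "W \<subseteq> adjoin ?H w"
  proof
    fix v assume v: "v \<in> W"
    then have vV: "v \<in> carrier V" by (simp add: subspace_closed[OF W])
    let ?k = "h v x \<otimes>\<^bsub>K\<^esub> ?i"
    let ?u = "v \<oplus>\<^bsub>V\<^esub> (\<ominus>\<^bsub>K\<^esub> ?k) \<odot>\<^bsub>V\<^esub> w"
    have kK: "?k \<in> carrier K" using vV x i by simp
    have kw: "(\<ominus>\<^bsub>K\<^esub> ?k) \<odot>\<^bsub>V\<^esub> w = \<ominus>\<^bsub>V\<^esub> (?k \<odot>\<^bsub>V\<^esub> w)" using kK wV by (rule smult_l_minus)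
    have uW: "?u \<in> W" using v w kK by (simp add: subspace_closed[OF W])
    have "h ?u x = h v x \<oplus>\<^bsub>K\<^esub> \<ominus>\<^bsub>K\<^esub> (?k \<otimes>\<^bsub>K\<^esub> h w x)"
      using vV wV x kK by (simp add: h_add h_smult R.l_minus)
    also have "?k \<otimes>\<^bsub>K\<^esub> h w x = h v x" using vV wV x i by (simp add: m_assoc)
    finally have "h ?u x = \<zero>\<^bsub>K\<^esub>" using vV x by (simp add: R.r_neg)
    then have "?u \<in> ?H" using uW x by (auto simp: orth_def subspace_closed[OF W] h_eq_zero_commute)
    moreover have "v = ?u \<oplus>\<^bsub>V\<^esub> ?k \<odot>\<^bsub>V\<^esub> w"
      using vV wV kK by (simp add: kw M.a_assoc M.l_neg)
    ultimately show "v \<in> adjoin ?H w" using kK by (intro adjoinI)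
  qed
  moreover have "adjoin ?H w \<subseteq> W" using w by (intro adjoin_least[OF W]) auto
  ultimately show eq: "W = adjoin ?H w" by (rule subset_antisym)
  show "card W = q\<^sup>2 * card ?H"
    by (subst eq) (use card_adjoin[OF H wV] w in simp)
qed

section \<open>Cardinalities of orthogonal complements\<close>

lemma card_hyperplane_section_ge:
  assumes "VectorSpace.subspace K W V" "x \<in> carrier V"
  shows "card W \<le> q\<^sup>2 * card (W \<inter> orth {x})"
proof (cases "W \<subseteq> orth {x}")
  case True
  then show ?thesis using q_gt_0 by (simp add: Int_absorb2 del: q_gt_0)
next
  case False
  then obtain w where "w \<in> W" "w \<notin> orth {x}" by blast
  then show ?thesis using hyperplane_section(2)[OF assms] by simp
qed

text \<open>A new vector multiplies the size of U by q^2 and divides the size of the orthogonal part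
  of W by at most q^2, so the product cannot fall.\<close>

lemma card_pairing_mono:
  assumes "VectorSpace.subspace K U V" "VectorSpace.subspace K Y V" "U \<subseteq> Y" "VectorSpace.subspace K W V"
  shows "card U * card (W \<inter> orth U) \<le> card Y * card (W \<inter> orth Y)"
  using assms(1-3)
proof (induction rule: subspace_chain_induct)
  case (step Z x)
  have x: "x \<in> carrier V" using step(4) by (simp add: subspace_closed[OF assms(2)])
  have Z: "Z \<subseteq> carrier V" by (simp add: subspace_closed[OF step(1)])
  have "card (W \<inter> orth Z) \<le> q\<^sup>2 * card (W \<inter> orth Z \<inter> orth {x})"
    using assms(4) Z x by (intro card_hyperplane_section_ge subspace_Int subspace_orth) auto
  then have "card Z * card (W \<inter> orth Z) \<le> card Z * (q\<^sup>2 * card (W \<inter> orth Z \<inter> orth {x}))"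
    by (rule mult_left_mono) simp
  also have "\<dots> = card (adjoin Z x) * card (W \<inter> orth (adjoin Z x))"
    using step x by (simp add: card_adjoin orth_adjoin Int_assoc)
  finally show ?case using step(6) by linarith
qed simp

text \<open>Equality of row and column rank for the form restricted to \<open>U \<times> W\<close>.\<close>

lemma card_pairing:
  assumes U: "VectorSpace.subspace K U V" and W: "VectorSpace.subspace K W V"
  shows "card W * card (U \<inter> orth W) = card U * card (W \<inter> orth U)"
proof -
  have *: "card W * card (U \<inter> orth W) \<le> card U * card (W \<inter> orth U)"
    if U: "VectorSpace.subspace K U V" and W: "VectorSpace.subspace K W V" for U W
  proof -
    have sub: "U \<subseteq> carrier V" "W \<subseteq> carrier V" using U W by (simp_all add: subspace_closed)
    \<comment> \<open>The monotone chain is started at the part of U orthogonal to W, where all of W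
      survives. This is one inequality; exchanging U and W gives the other.\<close>
    then have "W \<subseteq> orth (U \<inter> orth W)" using orth_commute[of W "U \<inter> orth W"] by auto
    then have "W \<inter> orth (U \<inter> orth W) = W" by blast
    moreover have "VectorSpace.subspace K (U \<inter> orth W) V" using U sub by (intro subspace_Int subspace_orth)
    ultimately show ?thesis
      using card_pairing_mono[of "U \<inter> orth W" U W] U W by (simp add: mult.commute)
  qed
  show ?thesis using *[OF U W] *[OF W U] by (rule antisym)
qed

lemma orth_carrier: "orth (carrier V) = {\<zero>\<^bsub>V\<^esub>}"
proof -
  have "y = \<zero>\<^bsub>V\<^esub>" if "y \<in> orth (carrier V)" for y
    using that h_nondegenerate[of y] h_eq_zero_commute[of y] by (auto simp: orth_def)
  then show ?thesis by (auto simp: orth_def)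
qed

lemma card_orth:
  assumes "VectorSpace.subspace K U V"
  shows "card U * card (orth U) = card (carrier V)"
proof -
  have "U \<inter> {\<zero>\<^bsub>V\<^esub>} = {\<zero>\<^bsub>V\<^esub>}" "carrier V \<inter> orth U = orth U"
    using orth_subset subspace_closed(3)[OF assms] by auto
  then show ?thesis using card_pairing[OF assms subspace_carrier] by (simp add: orth_carrier)
qed

lemma card_subspace_gt_0: "VectorSpace.subspace K U V \<Longrightarrow> card U > 0"
  using subspace_closed(3,6)[of U] by (auto simp: card_gt_0_iff)

lemma orth_orth:
  assumes "VectorSpace.subspace K U V"
  shows "orth (orth U) = U"
proof -
  have sub: "U \<subseteq> carrier V" using assms by (rule subspace_closed)
  have O: "VectorSpace.subspace K (orth U) V" using sub by (rule subspace_orth)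
  have OO: "VectorSpace.subspace K (orth (orth U)) V" using orth_subset by (rule subspace_orth)
  have "card (orth U) * card U = card (orth U) * card (orth (orth U))"
    using card_orth[OF assms] card_orth[OF O] by (simp add: mult.commute)
  then have "card (orth (orth U)) = card U"
    using card_subspace_gt_0[OF O] by simp
  then show ?thesis
    using card_subset_eq[OF subspace_closed(6)[OF OO] subset_orth_orth[OF sub]] by simp
qed

end

section \<open>Counting isotropic vectors and generators\<close>

context hermitian_space
begin

lemma q2_gt_1: "1 < q\<^sup>2"
  using q_ge_2 by (intro one_less_power) auto

definition isotropic :: "'c set \<Rightarrow> 'c set" where
  "isotropic W = {v \<in> W. h v v = \<zero>\<^bsub>K\<^esub>}"

lemma h_translate:
  assumes "v \<in> carrier V" "R \<in> carrier V" "h R R = \<zero>\<^bsub>K\<^esub>" "t \<in> carrier K"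
  shows "h (v \<oplus>\<^bsub>V\<^esub> t \<odot>\<^bsub>V\<^esub> R) (v \<oplus>\<^bsub>V\<^esub> t \<odot>\<^bsub>V\<^esub> R) =
    h v v \<oplus>\<^bsub>K\<^esub> (t \<otimes>\<^bsub>K\<^esub> h R v \<oplus>\<^bsub>K\<^esub> (t \<otimes>\<^bsub>K\<^esub> h R v) [^]\<^bsub>K\<^esub> q)"
proof -
  have "h (v \<oplus>\<^bsub>V\<^esub> t \<odot>\<^bsub>V\<^esub> R) (v \<oplus>\<^bsub>V\<^esub> t \<odot>\<^bsub>V\<^esub> R) =
    (h v v \<oplus>\<^bsub>K\<^esub> t \<otimes>\<^bsub>K\<^esub> h R v) \<oplus>\<^bsub>K\<^esub> t [^]\<^bsub>K\<^esub> q \<otimes>\<^bsub>K\<^esub> h v R"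
    using assms by (simp add: h_add h_add_right h_smult h_smult_right)
  then show ?thesis
    using assms h_conj[of R v] by (simp add: nat_pow_distrib R.a_assoc)
qed

text \<open>Put z = t * h R v. By \<open>h_translate\<close>, isotropy says that the trace of z is -
  h v v, a value fixed by conjugation, and \<open>card_trace_fibre\<close> counts the
  solutions.\<close>

lemma card_isotropic_translates:
  assumes "v \<in> carrier V" "R \<in> carrier V" "h R R = \<zero>\<^bsub>K\<^esub>" "h R v \<noteq> \<zero>\<^bsub>K\<^esub>"
  shows "card {t \<in> carrier K. h (v \<oplus>\<^bsub>V\<^esub> t \<odot>\<^bsub>V\<^esub> R) (v \<oplus>\<^bsub>V\<^esub> t \<odot>\<^bsub>V\<^esub> R) = \<zero>\<^bsub>K\<^esub>} = q"
proof -
  let ?c = "h R v"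
  have c: "?c \<in> carrier K" "inv\<^bsub>K\<^esub> ?c \<in> carrier K" "inv\<^bsub>K\<^esub> ?c \<otimes>\<^bsub>K\<^esub> ?c = \<one>\<^bsub>K\<^esub>"
    using assms by (auto simp: field_Units)
  have vv: "h v v \<in> carrier K" "h v v [^]\<^bsub>K\<^esub> q = h v v"
    using assms h_conj[of v v] by auto
  have iff: "a \<oplus>\<^bsub>K\<^esub> b = \<zero>\<^bsub>K\<^esub> \<longleftrightarrow> b = \<ominus>\<^bsub>K\<^esub> a" if "a \<in> carrier K" "b \<in> carrier K" for a b
    using that by (metis R.minus_equality R.r_neg a_comm)
  have "bij_betw (\<lambda>t. t \<otimes>\<^bsub>K\<^esub> ?c)
      {t \<in> carrier K. h v v \<oplus>\<^bsub>K\<^esub> (t \<otimes>\<^bsub>K\<^esub> ?c \<oplus>\<^bsub>K\<^esub> (t \<otimes>\<^bsub>K\<^esub> ?c) [^]\<^bsub>K\<^esub> q) = \<zero>\<^bsub>K\<^esub>}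
      {z \<in> carrier K. z \<oplus>\<^bsub>K\<^esub> z [^]\<^bsub>K\<^esub> q = \<ominus>\<^bsub>K\<^esub> h v v}"
  proof (rule bij_betwI[of _ _ _ "\<lambda>z. z \<otimes>\<^bsub>K\<^esub> inv\<^bsub>K\<^esub> ?c"])
    have 1: "(z \<otimes>\<^bsub>K\<^esub> inv\<^bsub>K\<^esub> ?c) \<otimes>\<^bsub>K\<^esub> ?c = z" "(z \<otimes>\<^bsub>K\<^esub> ?c) \<otimes>\<^bsub>K\<^esub> inv\<^bsub>K\<^esub> ?c = z" if "z \<in> carrier K" for z
      using that c by (simp_all add: m_assoc m_comm[of ?c])
    show "(\<lambda>t. t \<otimes>\<^bsub>K\<^esub> ?c) \<in> {t \<in> carrier K. h v v \<oplus>\<^bsub>K\<^esub> (t \<otimes>\<^bsub>K\<^esub> ?c \<oplus>\<^bsub>K\<^esub> (t \<otimes>\<^bsub>K\<^esub> ?c) [^]\<^bsub>K\<^esub> q) = \<zero>\<^bsub>K\<^esub>}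
      \<rightarrow> {z \<in> carrier K. z \<oplus>\<^bsub>K\<^esub> z [^]\<^bsub>K\<^esub> q = \<ominus>\<^bsub>K\<^esub> h v v}"
      using vv c by (auto simp: iff)
    show "(\<lambda>z. z \<otimes>\<^bsub>K\<^esub> inv\<^bsub>K\<^esub> ?c) \<in> {z \<in> carrier K. z \<oplus>\<^bsub>K\<^esub> z [^]\<^bsub>K\<^esub> q = \<ominus>\<^bsub>K\<^esub> h v v} \<rightarrow>
      {t \<in> carrier K. h v v \<oplus>\<^bsub>K\<^esub> (t \<otimes>\<^bsub>K\<^esub> ?c \<oplus>\<^bsub>K\<^esub> (t \<otimes>\<^bsub>K\<^esub> ?c) [^]\<^bsub>K\<^esub> q) = \<zero>\<^bsub>K\<^esub>}"
      using vv c 1 by (auto simp: iff)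
  qed (use c in \<open>auto simp: m_assoc m_comm[of ?c]\<close>)
  then have "card {t \<in> carrier K. h v v \<oplus>\<^bsub>K\<^esub> (t \<otimes>\<^bsub>K\<^esub> ?c \<oplus>\<^bsub>K\<^esub> (t \<otimes>\<^bsub>K\<^esub> ?c) [^]\<^bsub>K\<^esub> q) = \<zero>\<^bsub>K\<^esub>}
    = card {z \<in> carrier K. z \<oplus>\<^bsub>K\<^esub> z [^]\<^bsub>K\<^esub> q = \<ominus>\<^bsub>K\<^esub> h v v}"
    by (rule bij_betw_same_card)
  also have "\<dots> = q" using vv by (intro card_trace_fibre) (auto simp: conj_minus)
  also have "{t \<in> carrier K. h v v \<oplus>\<^bsub>K\<^esub> (t \<otimes>\<^bsub>K\<^esub> ?c \<oplus>\<^bsub>K\<^esub> (t \<otimes>\<^bsub>K\<^esub> ?c) [^]\<^bsub>K\<^esub> q) = \<zero>\<^bsub>K\<^esub>} =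
    {t \<in> carrier K. h (v \<oplus>\<^bsub>V\<^esub> t \<odot>\<^bsub>V\<^esub> R) (v \<oplus>\<^bsub>V\<^esub> t \<odot>\<^bsub>V\<^esub> R) = \<zero>\<^bsub>K\<^esub>}"
    using h_translate[OF assms(1-3)] by auto
  finally show ?thesis .
qed

text \<open>Outside \<open>R\<^sup>\<bottom>\<close>, every line \<open>v + K R\<close> contains exactly \<open>q\<close> isotropic vectors.\<close>

lemma card_isotropic_hyperplane:
  assumes W: "VectorSpace.subspace K W V" and R: "R \<in> W" "h R R = \<zero>\<^bsub>K\<^esub>"
  shows "q * card (isotropic W) + card (W \<inter> orth {R}) = q * card (isotropic (W \<inter> orth {R})) + card W"
proof -
  have RV: "R \<in> carrier V" using W R(1) by (rule subspace_closed)
  let ?H = "orth {R}" and ?B = "W - orth {R}"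
  have H: "VectorSpace.subspace K ?H V" using RV by (intro subspace_orth) auto
  have RH: "R \<in> ?H" using R RV by (simp add: orth_def)
  have fin: "finite W" using W by (rule subspace_closed)
  have B: "v \<in> carrier V" "h R v \<noteq> \<zero>\<^bsub>K\<^esub>" if "v \<in> ?B" for v
    using that subspace_closed(2)[OF W] by (auto simp: orth_def)
  have closed: "v \<oplus>\<^bsub>V\<^esub> t \<odot>\<^bsub>V\<^esub> R \<in> ?B" if "v \<in> ?B" "t \<in> carrier K" for v t
  proof -
    have "h R (t \<odot>\<^bsub>V\<^esub> R) = \<zero>\<^bsub>K\<^esub>" using that RV R by (simp add: h_smult_right)
    then have "h R (v \<oplus>\<^bsub>V\<^esub> t \<odot>\<^bsub>V\<^esub> R) \<noteq> \<zero>\<^bsub>K\<^esub>" using that B RV by (simp add: h_add_right)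
    then show ?thesis using that R subspace_closed(4,5)[OF W] by (auto simp: orth_def)
  qed
  have "card ?B * q = (\<Sum>v\<in>?B. card {t \<in> carrier K. h (v \<oplus>\<^bsub>V\<^esub> t \<odot>\<^bsub>V\<^esub> R) (v \<oplus>\<^bsub>V\<^esub> t \<odot>\<^bsub>V\<^esub> R) = \<zero>\<^bsub>K\<^esub>})"
    using card_isotropic_translates B RV R by simp
  also have "\<dots> = (\<Sum>t\<in>carrier K. card {v \<in> ?B. h (v \<oplus>\<^bsub>V\<^esub> t \<odot>\<^bsub>V\<^esub> R) (v \<oplus>\<^bsub>V\<^esub> t \<odot>\<^bsub>V\<^esub> R) = \<zero>\<^bsub>K\<^esub>})"
    using fin finite_carrier by (intro double_count) auto
  \<comment> \<open>For fixed t, translation by t R permutes \<open>?B\<close>, so every t sees the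
    same number of isotropic vectors.\<close>
  also have "\<dots> = (\<Sum>t\<in>carrier K. card (isotropic ?B))"
  proof (rule sum.cong[OF refl], rule bij_betw_same_card)
    fix t assume t: "t \<in> carrier K"
    have inv: "(v \<oplus>\<^bsub>V\<^esub> t \<odot>\<^bsub>V\<^esub> R) \<oplus>\<^bsub>V\<^esub> (\<ominus>\<^bsub>K\<^esub> t) \<odot>\<^bsub>V\<^esub> R = v"
      "(v \<oplus>\<^bsub>V\<^esub> (\<ominus>\<^bsub>K\<^esub> t) \<odot>\<^bsub>V\<^esub> R) \<oplus>\<^bsub>V\<^esub> t \<odot>\<^bsub>V\<^esub> R = v" if "v \<in> carrier V" for v
      using that t RV by (simp_all add: smult_l_minus M.a_assoc M.r_neg M.l_neg)
    show "bij_betw (\<lambda>v. v \<oplus>\<^bsub>V\<^esub> t \<odot>\<^bsub>V\<^esub> R)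
      {v \<in> ?B. h (v \<oplus>\<^bsub>V\<^esub> t \<odot>\<^bsub>V\<^esub> R) (v \<oplus>\<^bsub>V\<^esub> t \<odot>\<^bsub>V\<^esub> R) = \<zero>\<^bsub>K\<^esub>} (isotropic ?B)"
    proof (rule bij_betwI[of _ _ _ "\<lambda>v. v \<oplus>\<^bsub>V\<^esub> (\<ominus>\<^bsub>K\<^esub> t) \<odot>\<^bsub>V\<^esub> R"])
      show "(\<lambda>v. v \<oplus>\<^bsub>V\<^esub> t \<odot>\<^bsub>V\<^esub> R) \<in>
        {v \<in> ?B. h (v \<oplus>\<^bsub>V\<^esub> t \<odot>\<^bsub>V\<^esub> R) (v \<oplus>\<^bsub>V\<^esub> t \<odot>\<^bsub>V\<^esub> R) = \<zero>\<^bsub>K\<^esub>} \<rightarrow> isotropic ?B"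
        using closed t by (auto simp: isotropic_def)
      show "(\<lambda>v. v \<oplus>\<^bsub>V\<^esub> (\<ominus>\<^bsub>K\<^esub> t) \<odot>\<^bsub>V\<^esub> R) \<in> isotropic ?B \<rightarrow>
        {v \<in> ?B. h (v \<oplus>\<^bsub>V\<^esub> t \<odot>\<^bsub>V\<^esub> R) (v \<oplus>\<^bsub>V\<^esub> t \<odot>\<^bsub>V\<^esub> R) = \<zero>\<^bsub>K\<^esub>}"
      proof
        fix v assume v: "v \<in> isotropic ?B"
        then have "v \<in> ?B" "h v v = \<zero>\<^bsub>K\<^esub>" by (simp_all add: isotropic_def)
        then show "v \<oplus>\<^bsub>V\<^esub> (\<ominus>\<^bsub>K\<^esub> t) \<odot>\<^bsub>V\<^esub> R \<in>
          {v \<in> ?B. h (v \<oplus>\<^bsub>V\<^esub> t \<odot>\<^bsub>V\<^esub> R) (v \<oplus>\<^bsub>V\<^esub> t \<odot>\<^bsub>V\<^esub> R) = \<zero>\<^bsub>K\<^esub>}"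
          using closed[of v "\<ominus>\<^bsub>K\<^esub> t"] t inv(2)[of v] B(1)[of v] by simp
      qed
    qed (use inv B(1) in \<open>auto simp: isotropic_def\<close>)
  qed
  also have "\<dots> = q * (q * card (isotropic ?B))" using card_carrier by (simp add: power2_eq_square)
  finally have 1: "card ?B = q * card (isotropic ?B)" using q_ge_2 by (simp add: mult.commute)
  have 2: "card W = card (W \<inter> ?H) + card ?B" using card_Int_Diff[OF fin] .
  have "isotropic W = isotropic (W \<inter> ?H) \<union> isotropic ?B" "isotropic (W \<inter> ?H) \<inter> isotropic ?B = {}"
    by (auto simp: isotropic_def)
  moreover have "finite (isotropic (W \<inter> ?H))" "finite (isotropic ?B)"
    using fin by (auto simp: isotropic_def)
  ultimately have 3: "card (isotropic W) = card (isotropic (W \<inter> ?H)) + card (isotropic ?B)"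
    using card_Un_disjoint[of "isotropic (W \<inter> ?H)" "isotropic ?B"] by simp
  show ?thesis using 1 2 3 by (simp add: distrib_left)
qed

text \<open>By \<open>card_isotropic_hyperplane\<close>, q times the number of isotropic vectors of
  Y^perp, minus the size of Y^perp, does not change when an isotropic vector of Y^perp is adjoined
  to Y. So its value at U is that at the zero subspace.\<close>

lemma card_isotropic_orth:
  assumes U: "VectorSpace.subspace K U V" and ti: "U \<subseteq> orth U"
  shows "q * card (isotropic (orth U)) + card (carrier V) = q * card (isotropic (carrier V)) + card (orth U)"
proof -
  have "{\<zero>\<^bsub>V\<^esub>} \<subseteq> U" by (simp add: subspace_closed(3)[OF U])
  with subspace_zero U show ?thesis
  proof (induction rule: subspace_chain_induct)
    case base
    have "orth {\<zero>\<^bsub>V\<^esub>} = carrier V" by (auto simp: orth_def)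
    then show ?case by simp
  next
    case (step Y x)
    have x: "x \<in> carrier V" using U step(4) by (rule subspace_closed)
    have Y: "Y \<subseteq> carrier V" using step(1) by (rule subspace_closed)
    have O: "VectorSpace.subspace K (orth Y) V" using Y by (rule subspace_orth)
    have "x \<in> orth Y" using step(3,4) ti by (auto simp: orth_def)
    moreover have "h x x = \<zero>\<^bsub>K\<^esub>" using step(4) ti by (auto simp: orth_def)
    ultimately have "q * card (isotropic (orth Y)) + card (orth Y \<inter> orth {x}) =
        q * card (isotropic (orth Y \<inter> orth {x})) + card (orth Y)"
      using card_isotropic_hyperplane[OF O] by blast
    then show ?case using step(6) by (simp add: orth_adjoin[OF step(1) x])
  qed
qed

end

section \<open>Polar spaces of rank m and their generators\<close>

locale hermitian_polar_space = hermitian_space K V q h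
  for K :: "('a, 'b) ring_scheme" and V :: "('a, 'c, 'd) module_scheme" and q h +
  fixes m :: nat
  assumes card_V: "card (carrier V) = (q\<^sup>2) ^ (2 * m)"
    and m_ge_2: "m \<ge> 2"
    and exists_generator:
      "\<exists>E. VectorSpace.subspace K E V \<and> E \<subseteq> orth E \<and> card E = (q\<^sup>2) ^ m"
begin

lemma card_orth_power:
  assumes "VectorSpace.subspace K U V" "card U = (q\<^sup>2) ^ k"
  shows "card (orth U) = (q\<^sup>2) ^ (2 * m - k)" and "k \<le> 2 * m"
proof -
  note gt1 = q2_gt_1
  have "card U \<le> card (carrier V)"
    using finite_V subspace_closed(1)[OF assms(1)] by (rule card_mono)
  then show k: "k \<le> 2 * m" using assms(2) card_V power_le_imp_le_exp[OF gt1] by simp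
  have "(q\<^sup>2) ^ k * card (orth U) = (q\<^sup>2) ^ k * (q\<^sup>2) ^ (2 * m - k)"
    using card_orth[OF assms(1)] assms(2) card_V k by (simp add: power_add[symmetric])
  then show "card (orth U) = (q\<^sup>2) ^ (2 * m - k)" using q_gt_0 by simp
qed

text \<open>The invariant of \<open>card_isotropic_orth\<close> is evaluated at a generator, which
  equals its own orthogonal space and consists of isotropic vectors.\<close>

lemma card_isotropic_orth':
  assumes "VectorSpace.subspace K U V" "U \<subseteq> orth U" "card U = (q\<^sup>2) ^ k"
  shows "q * card (isotropic (orth U)) + (q\<^sup>2) ^ m = q * (q\<^sup>2) ^ m + (q\<^sup>2) ^ (2 * m - k)"
proof -
  obtain E where E: "VectorSpace.subspace K E V" "E \<subseteq> orth E" "card E = (q\<^sup>2) ^ m"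
    using exists_generator by blast
  have cO: "card (orth E) = (q\<^sup>2) ^ m" using card_orth_power[OF E(1,3)] by simp
  have "E = orth E"
    using E cO finite_subset[OF orth_subset finite_V] by (intro card_subset_eq) auto
  then have "isotropic (orth E) = E" using E(2) by (auto simp: isotropic_def orth_def)
  then have "q * (q\<^sup>2) ^ m + card (carrier V) = q * card (isotropic (carrier V)) + (q\<^sup>2) ^ m"
    using card_isotropic_orth[OF E(1,2)] E(3) cO by simp
  then show ?thesis
    using card_isotropic_orth[OF assms(1,2)] card_orth_power[OF assms(1,3)] by simp
qed

definition generators :: "'c set set" where
  "generators = {\<mu>. VectorSpace.subspace K \<mu> V \<and> \<mu> \<subseteq> orth \<mu> \<and> card \<mu> = (q\<^sup>2) ^ m}"

lemma generatorD:
  assumes "\<mu> \<in> generators"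
  shows "VectorSpace.subspace K \<mu> V" "\<mu> \<subseteq> orth \<mu>" "card \<mu> = (q\<^sup>2) ^ m" "finite \<mu>" "orth \<mu> = \<mu>"
proof -
  show *: "VectorSpace.subspace K \<mu> V" "\<mu> \<subseteq> orth \<mu>" "card \<mu> = (q\<^sup>2) ^ m"
    using assms by (simp_all add: generators_def)
  show "finite \<mu>" using *(1) by (rule subspace_closed)
  show "orth \<mu> = \<mu>"
    using * card_orth_power(1)[OF *(1,3)] finite_subset[OF orth_subset finite_V]
    by (intro card_subset_eq[symmetric]) auto
qed

lemma finite_generators: "finite generators"
proof (rule finite_subset)
  show "generators \<subseteq> Pow (carrier V)" using generatorD(1) subspace_closed(1) by blast
qed (simp add: finite_V)

text \<open>Counts pairs of a generator through U and a vector v of it outside U. Adjoining any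
  isotropic v of U^perp to U gives a totally isotropic subspace one dimension larger, so v occurs
  with exactly g generators.\<close>

lemma card_generators_step:
  assumes U: "VectorSpace.subspace K U V" "U \<subseteq> orth U" "card U = (q\<^sup>2) ^ k" and "k < m"
    and g: "\<And>U'. \<lbrakk>VectorSpace.subspace K U' V; U' \<subseteq> orth U'; card U' = (q\<^sup>2) ^ Suc k\<rbrakk> \<Longrightarrow>
      card {\<mu> \<in> generators. U' \<subseteq> \<mu>} = g"
  shows "((q\<^sup>2) ^ m - (q\<^sup>2) ^ k) * card {\<mu> \<in> generators. U \<subseteq> \<mu>} =
    (card (isotropic (orth U)) - (q\<^sup>2) ^ k) * g"
proof -
  let ?G = "{\<mu> \<in> generators. U \<subseteq> \<mu>}" and ?I = "isotropic (orth U) - U"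
  have fU: "finite U" "U \<subseteq> carrier V" using U(1) by (auto dest: subspace_closed)
  have UI: "U \<subseteq> isotropic (orth U)" using U(2) by (auto simp: isotropic_def orth_def)
  have fI: "finite (isotropic (orth U))"
    using finite_subset[OF _ finite_V] orth_subset by (auto simp: isotropic_def)
  have "(\<Sum>\<mu>\<in>?G. card {v \<in> ?I. v \<in> \<mu>}) = (\<Sum>v\<in>?I. card {\<mu> \<in> ?G. v \<in> \<mu>})"
    using finite_generators fI by (intro double_count) auto
  moreover have "card {v \<in> ?I. v \<in> \<mu>} = (q\<^sup>2) ^ m - (q\<^sup>2) ^ k" if "\<mu> \<in> ?G" for \<mu>
  proof -
    have \<mu>: "\<mu> \<in> generators" "U \<subseteq> \<mu>" using that by auto
    have "\<mu> \<subseteq> isotropic (orth U)"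
      using generatorD(2)[OF \<mu>(1)] \<mu>(2) by (auto simp: isotropic_def orth_def)
    then have "{v \<in> ?I. v \<in> \<mu>} = \<mu> - U" by blast
    then show ?thesis using generatorD(3)[OF \<mu>(1)] \<mu>(2) fU U(3) by (simp add: card_Diff_subset)
  qed
  moreover have "card {\<mu> \<in> ?G. v \<in> \<mu>} = g" if "v \<in> ?I" for v
  proof -
    have v: "v \<in> orth U" "v \<notin> U" "h v v = \<zero>\<^bsub>K\<^esub>" using that by (auto simp: isotropic_def)
    then have vV: "v \<in> carrier V" using orth_subset by blast
    have sub: "VectorSpace.subspace K (adjoin U v) V" using U(1) vV by (rule subspace_adjoin)
    have O: "VectorSpace.subspace K (orth U \<inter> orth {v}) V" using fU vV by (intro subspace_Int subspace_orth) auto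
    have "U \<subseteq> orth {v}" using v(1) orth_commute[of "{v}" U] fU vV by simp
    moreover have "v \<in> orth {v}" using v vV by (simp add: orth_def)
    ultimately have "adjoin U v \<subseteq> orth (adjoin U v)"
      unfolding orth_adjoin[OF U(1) vV] using U(2) v(1) by (intro adjoin_least[OF O]) auto
    then have "card {\<mu> \<in> generators. adjoin U v \<subseteq> \<mu>} = g"
      using sub card_adjoin[OF U(1) vV v(2)] U(3) by (intro g) auto
    also have "{\<mu> \<in> generators. adjoin U v \<subseteq> \<mu>} = {\<mu> \<in> ?G. v \<in> \<mu>}"
      using adjoin_subset_iff[OF U(1) generatorD(1) vV] by auto
    finally show ?thesis .
  qed
  ultimately have "card ?G * ((q\<^sup>2) ^ m - (q\<^sup>2) ^ k) = card ?I * g" by simp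
  also have "card ?I = card (isotropic (orth U)) - (q\<^sup>2) ^ k"
    using UI fU U(3) by (simp add: card_Diff_subset)
  finally show ?thesis by (simp add: mult.commute)
qed

text \<open>Downward induction from k = m, where the only generator containing U is U. Both factors
  in \<open>card_generators_step\<close> are determined by k, so the number for k is determined by
  that for k + 1.\<close>

lemma card_generators_through:
  assumes "k \<le> m"
  shows "\<exists>g>0. \<forall>U. VectorSpace.subspace K U V \<longrightarrow> U \<subseteq> orth U \<longrightarrow> card U = (q\<^sup>2) ^ k \<longrightarrow>
    card {\<mu> \<in> generators. U \<subseteq> \<mu>} = g"
  using assms
proof (induction k rule: inc_induct)
  case base
  have "{\<mu> \<in> generators. U \<subseteq> \<mu>} = {U}"
    if "VectorSpace.subspace K U V" "U \<subseteq> orth U" "card U = (q\<^sup>2) ^ m" for U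
  proof -
    have "U \<in> generators" using that by (simp add: generators_def)
    moreover have "\<mu> = U" if "\<mu> \<in> generators" "U \<subseteq> \<mu>" for \<mu>
      using card_subset_eq[OF generatorD(4)[OF that(1)] that(2)] generatorD(3)[OF that(1)] \<open>card U = _\<close> by simp
    ultimately show ?thesis by auto
  qed
  then show ?case by (intro exI[of _ 1]) simp
next
  case (step k)
  then obtain g where g: "g > 0" "\<And>U. \<lbrakk>VectorSpace.subspace K U V; U \<subseteq> orth U; card U = (q\<^sup>2) ^ Suc k\<rbrakk> \<Longrightarrow>
    card {\<mu> \<in> generators. U \<subseteq> \<mu>} = g" by blast
  define I where "I = (q * (q\<^sup>2) ^ m + (q\<^sup>2) ^ (2 * m - k) - (q\<^sup>2) ^ m) div q"
  note gt1 = q2_gt_1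
  have lt: "(q\<^sup>2) ^ k < (q\<^sup>2) ^ m" using step(2) gt1 by (intro power_strict_increasing) auto
  have le: "(q\<^sup>2) ^ m \<le> (q\<^sup>2) ^ (2 * m - k)" using step(2) gt1 by (intro power_increasing) auto
  have *: "((q\<^sup>2) ^ m - (q\<^sup>2) ^ k) * card {\<mu> \<in> generators. U \<subseteq> \<mu>} = (I - (q\<^sup>2) ^ k) * g"
    if U: "VectorSpace.subspace K U V" "U \<subseteq> orth U" "card U = (q\<^sup>2) ^ k" for U
  proof -
    have "q * card (isotropic (orth U)) = q * (q\<^sup>2) ^ m + (q\<^sup>2) ^ (2 * m - k) - (q\<^sup>2) ^ m"
      using card_isotropic_orth'[OF U] by linarith
    then have "card (isotropic (orth U)) = I"
      using q_gt_0 unfolding I_def by (metis nonzero_mult_div_cancel_left less_numeral_extra(3))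
    then show ?thesis using card_generators_step[OF U step(2) g(2)] by simp
  qed
  have "I \<ge> (q\<^sup>2) ^ m"
  proof -
    have "q * (q\<^sup>2) ^ m \<le> q * (q\<^sup>2) ^ m + (q\<^sup>2) ^ (2 * m - k) - (q\<^sup>2) ^ m" using le by linarith
    then show ?thesis unfolding I_def using q_gt_0 by (simp add: less_eq_div_iff_mult_less_eq mult.commute)
  qed
  then have pos: "(I - (q\<^sup>2) ^ k) * g > 0" using lt g(1) by simp
  let ?g = "((I - (q\<^sup>2) ^ k) * g) div ((q\<^sup>2) ^ m - (q\<^sup>2) ^ k)"
  have eq: "card {\<mu> \<in> generators. U \<subseteq> \<mu>} = ?g" and "card {\<mu> \<in> generators. U \<subseteq> \<mu>} > 0"
    if U: "VectorSpace.subspace K U V" "U \<subseteq> orth U" "card U = (q\<^sup>2) ^ k" for U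
  proof -
    have "(q\<^sup>2) ^ m - (q\<^sup>2) ^ k > 0" using lt by simp
    then show "card {\<mu> \<in> generators. U \<subseteq> \<mu>} = ?g" using *[OF U]
      by (metis nonzero_mult_div_cancel_left less_numeral_extra(3))
    show "card {\<mu> \<in> generators. U \<subseteq> \<mu>} > 0" using *[OF U] pos by (metis gr0I mult_0_right)
  qed
  show ?case
  proof (cases "\<exists>U. VectorSpace.subspace K U V \<and> U \<subseteq> orth U \<and> card U = (q\<^sup>2) ^ k")
    case True
    then show ?thesis using eq \<open>\<And>U. _ \<Longrightarrow> _ \<Longrightarrow> _ \<Longrightarrow> card {\<mu> \<in> generators. U \<subseteq> \<mu>} > 0\<close>
      by (intro exI[of _ ?g]) force
  next
    \<comment> \<open>With no totally isotropic subspace of this size, any positive number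
      serves.\<close>
    case False
    then show ?thesis by (intro exI[of _ 1]) blast
  qed
qed

text \<open>With s = q^2 and M = q^(2m-3), the number of isotropic vectors orthogonal to a point is
  I = s^m + M s^m - M s. Then I - s = (s^m - s)(M + 1), so one step of the flag count multiplies by
  M + 1.\<close>

lemma card_generators_ratio:
  assumes "VectorSpace.subspace K U V" "U \<subseteq> orth U" "card U = q\<^sup>2"
    and g: "\<And>U'. \<lbrakk>VectorSpace.subspace K U' V; U' \<subseteq> orth U'; card U' = (q\<^sup>2) ^ 2\<rbrakk> \<Longrightarrow>
      card {\<mu> \<in> generators. U' \<subseteq> \<mu>} = g"
  shows "card {\<mu> \<in> generators. U \<subseteq> \<mu>} = g * (q ^ (2 * m - 3) + 1)"
proof -
  obtain k where m: "m = k + 2" using m_ge_2 by (metis le_Suc_ex add.commute)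
  let ?I = "card (isotropic (orth U))" and ?s = "q\<^sup>2 :: nat" and ?M = "q ^ (2 * k + 1) :: nat"
  have U1: "card U = ?s ^ 1" using assms(3) by simp
  have step: "(?s ^ m - ?s ^ 1) * card {\<mu> \<in> generators. U \<subseteq> \<mu>} = (?I - ?s ^ 1) * g"
    using assms(1,2) U1 m_ge_2 g by (intro card_generators_step) (auto simp: numeral_2_eq_2)
  have le: "?s ^ 1 < ?s ^ m"
    using q2_gt_1 m_ge_2 by (intro power_strict_increasing) auto
  have "q * ?I + ?s ^ m = q * ?s ^ m + ?s ^ (2 * m - 1)"
    using card_isotropic_orth'[OF assms(1,2) U1] .
  also have "?s ^ (2 * m - 1) = q * (?M * ?s ^ m)"
    by (simp add: m power_mult[symmetric] power_add[symmetric] power_Suc[symmetric] del: power_Suc)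
  also have "?s ^ m = q * (q * ?s ^ (k + 1))"
    by (simp add: m power2_eq_square)
  finally have "q * (?I + q * ?s ^ (k + 1)) = q * (?s ^ m + ?M * ?s ^ m)"
    by (simp add: distrib_left m power2_eq_square mult.assoc mult.left_commute)
  then have "?I + q * ?s ^ (k + 1) = ?s ^ m + ?M * ?s ^ m" using q_gt_0 by simp
  moreover have "q * ?s ^ (k + 1) = ?M * ?s"
    using power_mult[of q 2 k] by (simp add: ac_simps)
  ultimately have "?I + ?M * ?s = ?s ^ m + ?M * ?s ^ m" by metis
  then have "?I - ?s ^ 1 = (?s ^ m - ?s ^ 1) * (?M + 1)"
    using le by (simp add: diff_mult_distrib algebra_simps)
  then have "(?s ^ m - ?s ^ 1) * card {\<mu> \<in> generators. U \<subseteq> \<mu>} = (?s ^ m - ?s ^ 1) * (g * (?M + 1))"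
    using step by (simp only: mult.assoc mult.commute)
  then have "card {\<mu> \<in> generators. U \<subseteq> \<mu>} = g * (?M + 1)" using le by (simp del: mult_Suc_right)
  then show ?thesis by (simp add: m)
qed

end

section \<open>Points of the Hermitian variety\<close>

context hermitian_space
begin

text \<open>If h y x were nonzero, only q of the q^2 choices of t would make x + t y
  isotropic.\<close>

lemma subspace_isotropic_imp_orth:
  assumes W: "VectorSpace.subspace K W V" and iso: "\<And>v. v \<in> W \<Longrightarrow> h v v = \<zero>\<^bsub>K\<^esub>"
  shows "W \<subseteq> orth W"
proof -
  have "h y x = \<zero>\<^bsub>K\<^esub>" if xy: "x \<in> W" "y \<in> W" for x y
  proof (rule ccontr)
    assume ne: "h y x \<noteq> \<zero>\<^bsub>K\<^esub>"
    have "{t \<in> carrier K. h (x \<oplus>\<^bsub>V\<^esub> t \<odot>\<^bsub>V\<^esub> y) (x \<oplus>\<^bsub>V\<^esub> t \<odot>\<^bsub>V\<^esub> y) = \<zero>\<^bsub>K\<^esub>} = carrier K"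
      using iso xy subspace_closed(4,5)[OF W] by auto
    then have "card (carrier K) = q"
      using card_isotropic_translates[of x y] ne xy iso subspace_closed(2)[OF W] by metis
    then show False using card_carrier q_ge_2 by (simp add: power2_eq_square)
  qed
  then show ?thesis using subspace_closed(1)[OF W] by (auto simp: orth_def)
qed

definition points :: "'c set \<Rightarrow> 'c set set" where
  "points W = {P. VectorSpace.subspace K P V \<and> card P = q\<^sup>2 \<and> P \<subseteq> isotropic W}"

lemma pointsD:
  assumes "P \<in> points W"
  shows "VectorSpace.subspace K P V" "card P = q\<^sup>2" "P \<subseteq> W" "P \<subseteq> orth P" "P \<subseteq> carrier V" "finite P"
    "v \<in> P \<Longrightarrow> h v v = \<zero>\<^bsub>K\<^esub>"
proof -
  show *: "VectorSpace.subspace K P V" "card P = q\<^sup>2" and "P \<subseteq> W" and iso: "v \<in> P \<Longrightarrow> h v v = \<zero>\<^bsub>K\<^esub>" for v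
    using assms by (auto simp: points_def isotropic_def)
  show "P \<subseteq> orth P" using *(1) iso by (rule subspace_isotropic_imp_orth)
  show "P \<subseteq> carrier V" "finite P" using *(1) by (auto dest: subspace_closed)
qed

lemma points_iff: "P \<in> points W \<longleftrightarrow> P \<in> points (carrier V) \<and> P \<subseteq> W"
  using pointsD(5) by (auto simp: points_def isotropic_def)

lemma points_subset_all: "points W \<subseteq> points (carrier V)"
  using points_iff by auto

lemma finite_points: "finite (points W)"
proof (rule finite_subset)
  show "points W \<subseteq> Pow (carrier V)" using pointsD(5) by blast
qed (simp add: finite_V)

lemma points_Int: "points (U \<inter> W) = points U \<inter> points W"
  by (auto simp: points_def isotropic_def)

lemma nonzero_in_subspace:
  assumes "VectorSpace.subspace K W V" "card W > 1"
  obtains v where "v \<in> W" "v \<noteq> \<zero>\<^bsub>V\<^esub>"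
proof -
  have "\<not> W \<subseteq> {\<zero>\<^bsub>V\<^esub>}" using assms(2) card_mono[of "{\<zero>\<^bsub>V\<^esub>}" W] by auto
  then show ?thesis using that by blast
qed

lemma eq_adjoin_zero:
  assumes P: "VectorSpace.subspace K P V" "card P = q\<^sup>2" and v: "v \<in> P" "v \<noteq> \<zero>\<^bsub>V\<^esub>"
  shows "P = adjoin {\<zero>\<^bsub>V\<^esub>} v"
proof -
  have vV: "v \<in> carrier V" using P(1) v(1) by (rule subspace_closed)
  have "adjoin {\<zero>\<^bsub>V\<^esub>} v \<subseteq> P" using P(1) v(1) subspace_closed(3)[OF P(1)] by (intro adjoin_least) auto
  moreover have "card (adjoin {\<zero>\<^bsub>V\<^esub>} v) = card P"
    using card_adjoin[OF subspace_zero vV] v(2) P(2) by simp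
  ultimately show ?thesis using card_subset_eq[OF subspace_closed(6)[OF P(1)]] by blast
qed

lemma adjoin_zero_points:
  assumes W: "VectorSpace.subspace K W V" and v: "v \<in> isotropic W" "v \<noteq> \<zero>\<^bsub>V\<^esub>"
  shows "adjoin {\<zero>\<^bsub>V\<^esub>} v \<in> points W" and "v \<in> adjoin {\<zero>\<^bsub>V\<^esub>} v"
proof -
  have vW: "v \<in> W" "h v v = \<zero>\<^bsub>K\<^esub>" using v by (auto simp: isotropic_def)
  have vV: "v \<in> carrier V" using W vW(1) by (rule subspace_closed)
  show "v \<in> adjoin {\<zero>\<^bsub>V\<^esub>} v" using subspace_zero vV by (rule adjoin_self)
  have "adjoin {\<zero>\<^bsub>V\<^esub>} v \<subseteq> W" using W vW(1) subspace_closed(3)[OF W] by (intro adjoin_least) auto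
  moreover have "h w w = \<zero>\<^bsub>K\<^esub>" if "w \<in> adjoin {\<zero>\<^bsub>V\<^esub>} v" for w
    using that vV vW by (auto elim!: adjoinE simp: h_smult h_smult_right)
  ultimately show "adjoin {\<zero>\<^bsub>V\<^esub>} v \<in> points W"
    using card_adjoin[OF subspace_zero vV] v(2) subspace_adjoin[OF subspace_zero vV]
    by (auto simp: points_def isotropic_def)
qed

lemma card_points:
  assumes W: "VectorSpace.subspace K W V"
  shows "card (points W) * (q\<^sup>2 - 1) = card (isotropic W) - 1"
proof -
  let ?I = "isotropic W - {\<zero>\<^bsub>V\<^esub>}"
  have z: "\<zero>\<^bsub>V\<^esub> \<in> isotropic W" using subspace_closed(3)[OF W] by (simp add: isotropic_def)
  have fin: "finite (isotropic W)" using subspace_closed(6)[OF W] by (simp add: isotropic_def)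
  have "(\<Sum>P\<in>points W. card {v \<in> ?I. v \<in> P}) = (\<Sum>v\<in>?I. card {P \<in> points W. v \<in> P})"
    using fin finite_points by (intro double_count) auto
  moreover have "card {v \<in> ?I. v \<in> P} = q\<^sup>2 - 1" if P: "P \<in> points W" for P
  proof -
    have "{v \<in> ?I. v \<in> P} = P - {\<zero>\<^bsub>V\<^esub>}" using P by (auto simp: points_def)
    then show ?thesis using pointsD(2,6)[OF P] subspace_closed(3)[OF pointsD(1)[OF P]]
      by (simp add: card_Diff_singleton)
  qed
  moreover have "card {P \<in> points W. v \<in> P} = 1" if v: "v \<in> ?I" for v
  proof -
    have "{P \<in> points W. v \<in> P} = {adjoin {\<zero>\<^bsub>V\<^esub>} v}"
      using adjoin_zero_points[OF W, of v] v eq_adjoin_zero[of _ v] pointsD(1,2) by blast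
    then show ?thesis by simp
  qed
  ultimately show ?thesis using fin z by (simp add: card_Diff_singleton)
qed

lemma card_points_totally_isotropic:
  assumes "VectorSpace.subspace K W V" "W \<subseteq> orth W"
  shows "card (points W) * (q\<^sup>2 - 1) = card W - 1"
proof -
  have "isotropic W = W" using assms(2) by (auto simp: isotropic_def orth_def)
  then show ?thesis using card_points[OF assms(1)] by simp
qed

text \<open>The factor 2 bounds q^2 / (q^2 - 1); it reappears in the constant \<open>b\<close> of
  the configuration.\<close>

lemma card_points_le:
  assumes W: "VectorSpace.subspace K W V" "card W \<le> (q\<^sup>2) ^ Suc k"
  shows "card (points W) \<le> 2 * (q\<^sup>2) ^ k"
proof -
  have "card (isotropic W) \<le> card W"
    using subspace_closed(6)[OF W(1)] by (intro card_mono) (auto simp: isotropic_def)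
  then have "card (points W) * (q\<^sup>2 - 1) \<le> (q\<^sup>2) ^ Suc k"
    using card_points[OF W(1)] W(2) by linarith
  also have "\<dots> = (q\<^sup>2) ^ k * q\<^sup>2" by simp
  also have "\<dots> \<le> (q\<^sup>2) ^ k * (2 * (q\<^sup>2 - 1))" using q2_gt_1 by (intro mult_left_mono) auto
  also have "\<dots> = (2 * (q\<^sup>2) ^ k) * (q\<^sup>2 - 1)" by (simp only: mult.assoc mult.left_commute)
  finally show ?thesis using q2_gt_1 by (simp only: mult_le_cancel2)
qed

text \<open>W is the orthogonal sum of \<open>?H\<close> and the line of v. Over each u in
  \<open>?H\<close>, the vector u + t v is isotropic only if the norm of t is - h u u / h v v, which
  allows at most q + 1 values of t.\<close>

lemma card_isotropic_le:
  assumes W: "VectorSpace.subspace K W V" and v: "v \<in> W" "h v v \<noteq> \<zero>\<^bsub>K\<^esub>"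
  shows "q\<^sup>2 * card (isotropic W) \<le> (q + 1) * card W"
proof -
  let ?H = "W \<inter> orth {v}"
  have vV: "v \<in> carrier V" using W v(1) by (rule subspace_closed)
  have v': "v \<notin> orth {v}" using v by (simp add: orth_def)
  note sec = hyperplane_section[OF W vV v(1) v']
  have fH: "finite ?H" using subspace_closed(6)[OF W] by simp
  let ?T = "\<lambda>u. {t \<in> carrier K. t [^]\<^bsub>K\<^esub> (q + 1) = (\<ominus>\<^bsub>K\<^esub> h u u) \<otimes>\<^bsub>K\<^esub> inv\<^bsub>K\<^esub> (h v v)}"
  let ?S = "\<lambda>u. (\<lambda>t. u \<oplus>\<^bsub>V\<^esub> t \<odot>\<^bsub>V\<^esub> v) ` ?T u"
  have inv: "inv\<^bsub>K\<^esub> (h v v) \<in> carrier K" "h v v \<otimes>\<^bsub>K\<^esub> inv\<^bsub>K\<^esub> (h v v) = \<one>\<^bsub>K\<^esub>"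
    using v(2) vV by (auto simp: field_Units)
  have "isotropic W \<subseteq> (\<Union>u\<in>?H. ?S u)"
  proof
    fix w assume w: "w \<in> isotropic W"
    then have "w \<in> adjoin ?H v" "h w w = \<zero>\<^bsub>K\<^esub>" using sec(1) by (auto simp: isotropic_def)
    then obtain u t where u: "u \<in> ?H" and t: "t \<in> carrier K" and wt: "w = u \<oplus>\<^bsub>V\<^esub> t \<odot>\<^bsub>V\<^esub> v" by (auto elim!: adjoinE)
    have uV: "u \<in> carrier V" "h u v = \<zero>\<^bsub>K\<^esub>" "h v u = \<zero>\<^bsub>K\<^esub>"
      using u vV h_eq_zero_commute[of v u] by (auto simp: orth_def)
    have tt: "t [^]\<^bsub>K\<^esub> q \<otimes>\<^bsub>K\<^esub> (t \<otimes>\<^bsub>K\<^esub> h v v) = t [^]\<^bsub>K\<^esub> (q + 1) \<otimes>\<^bsub>K\<^esub> h v v"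
      using t vV by (simp add: m_assoc)
    have "h w w = h u u \<oplus>\<^bsub>K\<^esub> t [^]\<^bsub>K\<^esub> (q + 1) \<otimes>\<^bsub>K\<^esub> h v v"
      using uV vV t unfolding wt tt[symmetric] by (simp add: h_add h_add_right h_smult h_smult_right m_lcomm)
    then have "t [^]\<^bsub>K\<^esub> (q + 1) \<otimes>\<^bsub>K\<^esub> h v v = \<ominus>\<^bsub>K\<^esub> h u u"
      using \<open>h w w = \<zero>\<^bsub>K\<^esub>\<close> uV(1) vV t
        R.minus_equality[of "t [^]\<^bsub>K\<^esub> (q + 1) \<otimes>\<^bsub>K\<^esub> h v v" "h u u"]
        R.a_comm[of "h u u" "t [^]\<^bsub>K\<^esub> (q + 1) \<otimes>\<^bsub>K\<^esub> h v v"] by simp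
    then have "(t [^]\<^bsub>K\<^esub> (q + 1) \<otimes>\<^bsub>K\<^esub> h v v) \<otimes>\<^bsub>K\<^esub> inv\<^bsub>K\<^esub> (h v v) = (\<ominus>\<^bsub>K\<^esub> h u u) \<otimes>\<^bsub>K\<^esub> inv\<^bsub>K\<^esub> (h v v)"
      by simp
    then have "t [^]\<^bsub>K\<^esub> (q + 1) = (\<ominus>\<^bsub>K\<^esub> h u u) \<otimes>\<^bsub>K\<^esub> inv\<^bsub>K\<^esub> (h v v)"
      using m_assoc[of "t [^]\<^bsub>K\<^esub> (q + 1)" "h v v" "inv\<^bsub>K\<^esub> (h v v)"] inv t vV
      by (metis h_closed nat_pow_closed r_one)
    then show "w \<in> (\<Union>u\<in>?H. ?S u)" using u t wt by blast
  qed
  moreover have "finite (\<Union>u\<in>?H. ?S u)" using fH finite_carrier by simp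
  ultimately have "card (isotropic W) \<le> card (\<Union>u\<in>?H. ?S u)" by (rule card_mono[rotated])
  also have "\<dots> \<le> (\<Sum>u\<in>?H. card (?S u))" using fH by (rule card_UN_le)
  also have "\<dots> \<le> (\<Sum>u\<in>?H. q + 1)"
  proof (rule sum_mono)
    fix u assume "u \<in> ?H"
    then have "u \<in> carrier V" using subspace_closed(1)[OF W] by blast
    then have "card (?T u) \<le> q + 1" using inv by (intro card_norm_fibre_le) auto
    moreover have "card (?S u) \<le> card (?T u)" using finite_carrier by (intro card_image_le) simp
    ultimately show "card (?S u) \<le> q + 1" by linarith
  qed
  finally have "card (isotropic W) \<le> card ?H * (q + 1)" by simp
  then have "q\<^sup>2 * card (isotropic W) \<le> q\<^sup>2 * (card ?H * (q + 1))" by (rule mult_left_mono) simp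
  then show ?thesis using sec(2) by (simp add: algebra_simps)
qed

end

section \<open>The Hermitian polar space as a polar configuration\<close>

context hermitian_polar_space
begin

definition middle_subspaces :: "'c set set" where
  "middle_subspaces = {\<pi>. VectorSpace.subspace K \<pi> V \<and> card \<pi> = (q\<^sup>2) ^ m}"

definition perp :: "'c set \<Rightarrow> 'c set \<Rightarrow> bool" where
  "perp X Y \<longleftrightarrow> X \<subseteq> carrier V \<and> Y \<subseteq> orth X"

text \<open>The subspace itself is hidden: the greedy choice only sees its points, to recognise
  independence, and the points of its polar, where the retained part of the support lies.\<close>

definition flat :: "nat \<Rightarrow> 'c set set \<Rightarrow> 'c set set \<Rightarrow> bool" where
  "flat k L N \<longleftrightarrow> (\<exists>U. VectorSpace.subspace K U V \<and> card U = (q\<^sup>2) ^ k \<and> L = points U \<and> N = points (orth U))"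

lemma perp_sym: "perp X Y \<Longrightarrow> perp Y X"
  unfolding perp_def using orth_commute orth_subset by blast

lemma point_vector:
  assumes "P \<in> points W"
  shows "\<exists>v. v \<in> P \<and> v \<in> carrier V \<and> orth P = orth {v} \<and>
    (\<forall>U. VectorSpace.subspace K U V \<longrightarrow> (P \<subseteq> U \<longleftrightarrow> v \<in> U))"
proof -
  obtain v where v: "v \<in> P" "v \<noteq> \<zero>\<^bsub>V\<^esub>"
    using nonzero_in_subspace[OF pointsD(1)[OF assms]] pointsD(2)[OF assms] q2_gt_1 by auto
  have vV: "v \<in> carrier V" using v pointsD(5)[OF assms] by blast
  have P: "P = adjoin {\<zero>\<^bsub>V\<^esub>} v" using eq_adjoin_zero[OF pointsD(1,2)[OF assms] v] .
  moreover have "orth {\<zero>\<^bsub>V\<^esub>} = carrier V" by (auto simp: orth_def)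
  then have "orth P = orth {v}" using orth_adjoin[OF subspace_zero vV] P orth_subset by auto
  moreover have "P \<subseteq> U \<longleftrightarrow> v \<in> U" if "VectorSpace.subspace K U V" for U
    using adjoin_subset_iff[OF subspace_zero that vV] subspace_closed(3)[OF that] P by auto
  ultimately show ?thesis using v vV by blast
qed

lemma subset_iff_points_subset:
  assumes "VectorSpace.subspace K \<mu> V" "\<mu> \<subseteq> orth \<mu>" "VectorSpace.subspace K W V"
  shows "points \<mu> \<subseteq> points W \<longleftrightarrow> \<mu> \<subseteq> W"
proof
  assume *: "points \<mu> \<subseteq> points W"
  show "\<mu> \<subseteq> W"
  proof
    fix v assume v: "v \<in> \<mu>"
    show "v \<in> W"
    proof (cases "v = \<zero>\<^bsub>V\<^esub>")
      case False
      have "v \<in> isotropic \<mu>" using v assms(2) by (auto simp: isotropic_def orth_def)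
      then have "adjoin {\<zero>\<^bsub>V\<^esub>} v \<in> points W" "v \<in> adjoin {\<zero>\<^bsub>V\<^esub>} v"
        using adjoin_zero_points[OF assms(1) _ False] * by auto
      then show ?thesis using pointsD(3) by blast
    qed (use subspace_closed(3)[OF assms(3)] in simp)
  qed
qed (auto simp: points_def isotropic_def)

lemma inj_on_points_generators: "inj_on points generators"
proof (rule inj_onI)
  fix \<mu> \<nu> assume *: "\<mu> \<in> generators" "\<nu> \<in> generators" "points \<mu> = points \<nu>"
  show "\<mu> = \<nu>"
    using subset_iff_points_subset[OF generatorD(1,2)[OF *(1)] generatorD(1)[OF *(2)]]
      subset_iff_points_subset[OF generatorD(1,2)[OF *(2)] generatorD(1)[OF *(1)]] *(3) by auto
qed

lemma card_point_generators: "card {N \<in> points ` generators. Q N} = card {\<mu> \<in> generators. Q (points \<mu>)}"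
proof -
  have "{N \<in> points ` generators. Q N} = points ` {\<mu> \<in> generators. Q (points \<mu>)}" by blast
  moreover have "inj_on points {\<mu> \<in> generators. Q (points \<mu>)}"
    using inj_on_points_generators by (rule inj_on_subset) auto
  ultimately show ?thesis by (simp add: card_image)
qed

lemma join_points:
  assumes X: "X \<in> points (carrier V)" and Y: "Y \<in> points (carrier V)" and "X \<noteq> Y" "perp X Y"
  obtains U where "VectorSpace.subspace K U V" "U \<subseteq> orth U" "card U = (q\<^sup>2) ^ 2"
    "\<And>W. VectorSpace.subspace K W V \<Longrightarrow> U \<subseteq> W \<longleftrightarrow> X \<subseteq> W \<and> Y \<subseteq> W"
proof -
  obtain y where y: "y \<in> Y" "y \<in> carrier V" "orth Y = orth {y}"
      "\<forall>U. VectorSpace.subspace K U V \<longrightarrow> (Y \<subseteq> U \<longleftrightarrow> y \<in> U)"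
    using point_vector[OF Y] by blast
  note XD = pointsD[OF X] and YD = pointsD[OF Y]
  have yX: "y \<notin> X"
  proof
    assume "y \<in> X"
    then have "Y \<subseteq> X" using y(4)[rule_format, OF XD(1)] by simp
    then have "Y = X" using XD(2,6) YD(2) card_subset_eq by metis
    then show False using assms(3) by simp
  qed
  let ?U = "adjoin X y"
  have iff: "?U \<subseteq> W \<longleftrightarrow> X \<subseteq> W \<and> Y \<subseteq> W" if "VectorSpace.subspace K W V" for W
    using adjoin_subset_iff[OF XD(1) that y(2)] y(4)[rule_format, OF that] by simp
  have O: "VectorSpace.subspace K (orth X \<inter> orth {y}) V" using XD(5) y(2) by (intro subspace_Int subspace_orth) auto
  have yX: "y \<in> orth X" and "y \<notin> X" using assms(4) y(1) yX by (auto simp: perp_def)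
  have "X \<subseteq> orth {y}" using orth_commute[of "{y}" X] yX XD(5) y(2) by simp
  moreover have "y \<in> orth {y}" using YD(7)[OF y(1)] y(2) by (simp add: orth_def)
  ultimately have "?U \<subseteq> orth ?U"
    unfolding orth_adjoin[OF XD(1) y(2)] using XD(4) yX by (intro adjoin_least[OF O]) auto
  moreover have "card ?U = (q\<^sup>2) ^ 2"
    using card_adjoin[OF XD(1) y(2) \<open>y \<notin> X\<close>] XD(2) by (simp add: power2_eq_square)
  ultimately show ?thesis using that[of ?U] subspace_adjoin[OF XD(1) y(2)] iff by blast
qed

text \<open>Such a generator contains a whole line on X inside T, hence at least q^2 points of T
  besides X. Each of these lies with X on at most g generators, and T has at most 2 * q^(2m-2)
  points; division by q^2 gives the bound.\<close>

lemma card_generators_meeting: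
  assumes g: "\<And>X Y. \<lbrakk>X \<in> points (carrier V); Y \<in> points (carrier V); X \<noteq> Y; perp X Y\<rbrakk> \<Longrightarrow>
      card {\<mu> \<in> generators. X \<subseteq> \<mu> \<and> Y \<subseteq> \<mu>} = g"
    and T: "VectorSpace.subspace K T V" "card T = (q\<^sup>2) ^ m" and X: "X \<in> points T"
  shows "card {\<mu> \<in> generators. X \<subseteq> \<mu> \<and> (\<exists>Y\<in>points T. Y \<subseteq> \<mu> \<and> Y \<noteq> X)} \<le> g * (2 * q ^ (2 * m - 4))"
proof -
  obtain k where m: "m = k + 2" using m_ge_2 by (metis le_Suc_ex add.commute)
  let ?A = "{\<mu> \<in> generators. X \<subseteq> \<mu> \<and> (\<exists>Y\<in>points T. Y \<subseteq> \<mu> \<and> Y \<noteq> X)}" and ?T = "points T - {X}"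
  have XP: "X \<in> points (carrier V)" using X points_subset_all by auto
  have ge: "q\<^sup>2 \<le> card {Y \<in> ?T. Y \<subseteq> \<mu>}" if A: "\<mu> \<in> ?A" for \<mu>
  proof -
    obtain Y where Y: "Y \<in> points T" "Y \<subseteq> \<mu>" "Y \<noteq> X" and \<mu>: "\<mu> \<in> generators" "X \<subseteq> \<mu>" using A by blast
    have YP: "Y \<in> points (carrier V)" using Y(1) points_subset_all by auto
    have "perp X Y" using generatorD(2)[OF \<mu>(1)] Y(2) \<mu>(2) pointsD(5)[OF X] unfolding perp_def orth_def by blast
    then obtain U where U: "VectorSpace.subspace K U V" "U \<subseteq> orth U" "card U = (q\<^sup>2) ^ 2"
      "\<And>W. VectorSpace.subspace K W V \<Longrightarrow> U \<subseteq> W \<longleftrightarrow> X \<subseteq> W \<and> Y \<subseteq> W"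
      using join_points[OF XP YP] Y(3) by metis
    have "X \<subseteq> U" using U(4)[OF U(1)] by simp
    have "U \<subseteq> T" "U \<subseteq> \<mu>" using U(4)[OF T(1)] U(4)[OF generatorD(1)[OF \<mu>(1)]] Y \<mu> pointsD(3) X by auto
    then have "points U - {X} \<subseteq> {Y \<in> ?T. Y \<subseteq> \<mu>}"
      using points_iff[of _ U] points_iff[of _ T] by auto
    then have le: "card (points U - {X}) \<le> card {Y \<in> ?T. Y \<subseteq> \<mu>}"
      using finite_points by (intro card_mono) auto
    have XU: "X \<in> points U" using XP \<open>X \<subseteq> U\<close> points_iff[of X U] by simp
    have "s ^ 2 - 1 = (s + 1) * (s - 1)" for s :: nat
      by (cases s) (simp_all add: power2_eq_square)
    then have "card (points U) * (q\<^sup>2 - 1) = (q\<^sup>2 + 1) * (q\<^sup>2 - 1)"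
      using card_points_totally_isotropic[OF U(1,2)] U(3) by metis
    moreover have "q\<^sup>2 - 1 \<noteq> 0" using q2_gt_1 by simp
    ultimately have "card (points U) = q\<^sup>2 + 1" by (metis mult_cancel2)
    then show ?thesis using le XU finite_points by (simp add: card_Diff_singleton)
  qed
  have "q\<^sup>2 * card ?A \<le> (\<Sum>\<mu>\<in>?A. card {Y \<in> ?T. Y \<subseteq> \<mu>})"
    using sum_bounded_below[of ?A "q\<^sup>2"] ge by (simp add: mult.commute)
  also have "\<dots> = (\<Sum>Y\<in>?T. card {\<mu> \<in> ?A. Y \<subseteq> \<mu>})"
    using finite_generators finite_points by (intro double_count) auto
  also have "\<dots> \<le> (\<Sum>Y\<in>?T. g)"
  proof (rule sum_mono)
    fix Y assume Y: "Y \<in> ?T"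
    then have YP: "Y \<in> points (carrier V)" using points_subset_all by auto
    have le: "card {\<mu> \<in> ?A. Y \<subseteq> \<mu>} \<le> card {\<mu> \<in> generators. X \<subseteq> \<mu> \<and> Y \<subseteq> \<mu>}"
      using finite_generators by (intro card_mono) auto
    show "card {\<mu> \<in> ?A. Y \<subseteq> \<mu>} \<le> g"
    proof (cases "perp X Y")
      case True
      then show ?thesis using g[OF XP YP] Y le by auto
    next
      case False
      have "\<not> (X \<subseteq> \<mu> \<and> Y \<subseteq> \<mu>)" if "\<mu> \<in> generators" for \<mu>
        using False generatorD(2)[OF that] pointsD(5)[OF X] unfolding perp_def orth_def by blast
      then have "{\<mu> \<in> generators. X \<subseteq> \<mu> \<and> Y \<subseteq> \<mu>} = {}" by blast
      then have "card {\<mu> \<in> generators. X \<subseteq> \<mu> \<and> Y \<subseteq> \<mu>} = 0" by (simp only: card.empty)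
      then show ?thesis using le by linarith
    qed
  qed
  also have "\<dots> \<le> card (points T) * g" using finite_points by (simp add: card_Diff1_le)
  also have "\<dots> \<le> 2 * (q\<^sup>2) ^ Suc k * g"
    using card_points_le[OF T(1), of "Suc k"] T(2) by (simp add: m)
  finally have "q\<^sup>2 * card ?A \<le> q\<^sup>2 * (g * (2 * (q\<^sup>2) ^ k))" by (simp add: algebra_simps)
  then have "card ?A \<le> g * (2 * (q\<^sup>2) ^ k)" using q2_gt_1 by (simp only: mult_le_cancel1)
  then show ?thesis by (simp add: m power_mult)
qed

lemma middle_subspacesD:
  assumes "\<pi> \<in> middle_subspaces"
  shows "VectorSpace.subspace K \<pi> V" "card \<pi> = (q\<^sup>2) ^ m" "\<pi> \<subseteq> carrier V" "finite \<pi>"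
    "VectorSpace.subspace K (orth \<pi>) V" "card (orth \<pi>) = (q\<^sup>2) ^ m" "orth (orth \<pi>) = \<pi>"
proof -
  show *: "VectorSpace.subspace K \<pi> V" "card \<pi> = (q\<^sup>2) ^ m" using assms by (auto simp: middle_subspaces_def)
  show "\<pi> \<subseteq> carrier V" "finite \<pi>" using *(1) by (auto dest: subspace_closed)
  then show "VectorSpace.subspace K (orth \<pi>) V" by (intro subspace_orth)
  show "card (orth \<pi>) = (q\<^sup>2) ^ m" using card_orth_power(1)[OF *] by simp
  show "orth (orth \<pi>) = \<pi>" using *(1) by (rule orth_orth)
qed

text \<open>This is \<open>card_pairing\<close> for two subspaces of equal size, one of which is its
  own orthogonal space. It is why polar pairs give code words, and why generators through a point of
  an n-space meet the polar n-space.\<close>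

lemma card_generator_Int_orth:
  assumes "\<pi> \<in> middle_subspaces" "\<mu> \<in> generators"
  shows "card (\<mu> \<inter> orth \<pi>) = card (\<mu> \<inter> \<pi>)"
  using card_pairing[OF middle_subspacesD(1)[OF assms(1)] generatorD(1)[OF assms(2)]]
    middle_subspacesD(2)[OF assms(1)] generatorD(3,5)[OF assms(2)] q_gt_0
  by (simp add: Int_commute)

text \<open>X separates pi from its orthogonal space. As both have the same size, the latter is not
  totally isotropic, and \<open>card_isotropic_le\<close> bounds its points by q^(2m-2) / (q -
  1).\<close>

lemma card_points_orth_le:
  assumes \<pi>: "\<pi> \<in> middle_subspaces" and X: "X \<in> points \<pi>" "X \<notin> points (orth \<pi>)"
  shows "card (points (orth \<pi>)) \<le> q ^ (2 * m - 3) + 2 * q ^ (2 * m - 4)"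
proof -
  obtain k where m: "m = k + 2" using m_ge_2 by (metis le_Suc_ex add.commute)
  note D = middle_subspacesD[OF \<pi>]
  have "\<not> orth \<pi> \<subseteq> orth (orth \<pi>)"
  proof
    assume "orth \<pi> \<subseteq> orth (orth \<pi>)"
    then have "orth \<pi> = \<pi>" using D card_subset_eq by metis
    then show False using X by simp
  qed
  then obtain v where v: "v \<in> orth \<pi>" "h v v \<noteq> \<zero>\<^bsub>K\<^esub>"
    using subspace_isotropic_imp_orth[OF D(5)] by blast
  \<comment> \<open>\<open>Suc r\<close> is q - 1 without truncated subtraction; the last estimate
    rests on q^2 <= (q + 2)(q - 1).\<close>
  obtain r where r: "q = r + 2" using q_ge_2 by (metis le_Suc_ex add.commute)
  let ?N = "card (points (orth \<pi>))" and ?A = "q ^ (2 * k)"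
  have "q\<^sup>2 * card (isotropic (orth \<pi>)) \<le> (q + 1) * (q\<^sup>2 * (q\<^sup>2 * ?A))"
    using card_isotropic_le[OF D(5) v] D(6) by (simp add: m power_mult)
  then have "q\<^sup>2 * card (isotropic (orth \<pi>)) \<le> q\<^sup>2 * ((q + 1) * (q\<^sup>2 * ?A))"
    by (simp only: ac_simps)
  then have "card (isotropic (orth \<pi>)) \<le> (q + 1) * (q\<^sup>2 * ?A)"
    using q2_gt_1 by (simp only: mult_le_cancel1)
  then have "?N * (q\<^sup>2 - 1) \<le> (q + 1) * (q\<^sup>2 * ?A)" using card_points[OF D(5)] by linarith
  moreover have "q\<^sup>2 - 1 = (q + 1) * Suc r" by (simp add: r power2_eq_square)
  ultimately have "?N * ((q + 1) * Suc r) \<le> (q + 1) * (q\<^sup>2 * ?A)" by metis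
  then have "(q + 1) * (?N * Suc r) \<le> (q + 1) * (q\<^sup>2 * ?A)" by (simp only: mult.left_commute)
  then have "?N * Suc r \<le> q\<^sup>2 * ?A" by (simp only: mult_le_cancel1)
  also have "\<dots> \<le> (q * ?A + 2 * ?A) * Suc r"
  proof -
    have "q\<^sup>2 \<le> (q + 2) * Suc r" by (simp add: r power2_eq_square)
    then have "q\<^sup>2 * ?A \<le> ((q + 2) * Suc r) * ?A" by (rule mult_right_mono) simp
    then show ?thesis by (simp add: algebra_simps)
  qed
  finally have "?N \<le> q * ?A + 2 * ?A" by (simp only: mult_le_cancel2)
  then show ?thesis by (simp add: m)
qed

theorem polar_configuration:
  "\<exists>g. polar_configuration (points (carrier V)) perp (points ` generators) middle_subspaces points orth
    flat q (m - 1) (q ^ (2 * m - 3)) (2 * q ^ (2 * m - 4)) g"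
proof -
  obtain k where m: "m = k + 2" using m_ge_2 by (metis le_Suc_ex add.commute)
  \<comment> \<open>\<open>g\<close> is the number of generators through a totally isotropic
    line.\<close>
  obtain g where g: "g > 0" "\<And>U. \<lbrakk>VectorSpace.subspace K U V; U \<subseteq> orth U; card U = (q\<^sup>2) ^ 2\<rbrakk> \<Longrightarrow>
    card {\<mu> \<in> generators. U \<subseteq> \<mu>} = g"
    using card_generators_through[OF m_ge_2] by blast
  have pair: "card {\<mu> \<in> generators. X \<subseteq> \<mu> \<and> Y \<subseteq> \<mu>} = g"
    if XY: "X \<in> points (carrier V)" "Y \<in> points (carrier V)" "X \<noteq> Y" "perp X Y" for X Y
  proof -
    obtain U where U: "VectorSpace.subspace K U V" "U \<subseteq> orth U" "card U = (q\<^sup>2) ^ 2"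
      "\<And>W. VectorSpace.subspace K W V \<Longrightarrow> U \<subseteq> W \<longleftrightarrow> X \<subseteq> W \<and> Y \<subseteq> W"
      using join_points[OF XY] by metis
    have "{\<mu> \<in> generators. X \<subseteq> \<mu> \<and> Y \<subseteq> \<mu>} = {\<mu> \<in> generators. U \<subseteq> \<mu>}"
      using U(4)[OF generatorD(1)] by auto
    then show ?thesis using g(2)[OF U(1-3)] by simp
  qed
  have in_points: "X \<in> points \<mu> \<longleftrightarrow> X \<subseteq> \<mu>" if "X \<in> points (carrier V)" for X \<mu>
    using points_iff[of X \<mu>] that by simp
  show ?thesis
  proof (intro exI[of _ g], unfold_locales)
    show "finite (points (carrier V))" by (rule finite_points)
    show "perp X Y \<Longrightarrow> perp Y X" for X Y by (rule perp_sym)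
    show "\<mu> \<subseteq> points (carrier V)" if "\<mu> \<in> points ` generators" for \<mu>
      using that points_subset_all by auto
    show "perp X Y" if N: "N \<in> points ` generators" and XY: "X \<in> N" "Y \<in> N" for N X Y
    proof -
      obtain \<nu> where \<nu>: "\<nu> \<in> generators" "N = points \<nu>" using N by blast
      then have "X \<subseteq> \<nu>" "Y \<subseteq> \<nu>" "X \<subseteq> carrier V" using XY pointsD(3,5) by auto
      then show ?thesis using generatorD(2)[OF \<nu>(1)] orth_antimono[of X \<nu>] unfolding perp_def by auto
    qed
    show "0 < g" by (rule g(1))
    show "0 < q ^ (2 * m - 3)" by simp
    show "2 * q ^ (2 * m - 4) * q = 2 * q ^ (2 * m - 3)" by (simp add: m)
    show "card {\<mu> \<in> points ` generators. X \<in> \<mu> \<and> Y \<in> \<mu>} = g"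
      if "X \<in> points (carrier V)" "Y \<in> points (carrier V)" "X \<noteq> Y" "perp X Y" for X Y
      using pair[OF that] in_points[OF that(1)] in_points[OF that(2)] by (simp add: card_point_generators)
    show "card {\<mu> \<in> points ` generators. X \<in> \<mu>} = g * (q ^ (2 * m - 3) + 1)"
      if "X \<in> points (carrier V)" for X
      using card_generators_ratio[OF pointsD(1,4,2)[OF that]] g(2) in_points[OF that]
      by (simp add: card_point_generators)
    show "points \<pi> \<subseteq> points (carrier V)" for \<pi> by (rule points_subset_all)
    show "orth \<pi> \<in> middle_subspaces" if "\<pi> \<in> middle_subspaces" for \<pi>
      using middle_subspacesD(5,6)[OF that] by (simp add: middle_subspaces_def)
    show "orth (orth \<pi>) = \<pi>" if "\<pi> \<in> middle_subspaces" for \<pi>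
      using that by (rule middle_subspacesD)
    show "perp X Y" if "X \<in> points \<pi>" "Y \<in> points (orth \<pi>)" for \<pi> X Y
      using pointsD(5)[OF that(1)] pointsD(3)[OF that(2)] orth_antimono[OF pointsD(3)[OF that(1)]]
      by (simp add: perp_def)
    show "card {X \<in> points \<pi>. perp X Y} \<le> 2 * q ^ (2 * m - 4)"
      if \<pi>: "\<pi> \<in> middle_subspaces" and Y: "Y \<in> points (carrier V)" "Y \<notin> points (orth \<pi>)" for \<pi> Y
    proof -
      note D = middle_subspacesD[OF \<pi>]
      obtain y where "y \<in> Y" and y: "y \<in> carrier V" "orth Y = orth {y}"
        "\<forall>U. VectorSpace.subspace K U V \<longrightarrow> (Y \<subseteq> U \<longleftrightarrow> y \<in> U)"
        using point_vector[OF Y(1)] by blast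
      have "y \<notin> orth \<pi>" using y(3)[rule_format, OF D(5)] Y(2) in_points[OF Y(1), of "orth \<pi>"] by simp
      then have "\<not> \<pi> \<subseteq> orth {y}" using orth_commute[of "{y}" \<pi>] D(3) y(1) by simp
      then obtain w where "w \<in> \<pi>" "w \<notin> orth {y}" by blast
      then have "card \<pi> = q\<^sup>2 * card (\<pi> \<inter> orth {y})" by (rule hyperplane_section(2)[OF D(1) y(1)])
      then have "q\<^sup>2 * card (\<pi> \<inter> orth {y}) = q\<^sup>2 * (q\<^sup>2) ^ Suc k"
        using D(2) by (simp only: m add_2_eq_Suc' power_Suc)
      moreover have "q\<^sup>2 \<noteq> 0" using q2_gt_1 by simp
      ultimately have "card (\<pi> \<inter> orth {y}) = (q\<^sup>2) ^ Suc k" by (metis mult_cancel1)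
      moreover have "VectorSpace.subspace K (\<pi> \<inter> orth {y}) V"
        using D(1) y(1) by (intro subspace_Int subspace_orth) auto
      ultimately have "card (points (\<pi> \<inter> orth {y})) \<le> 2 * (q\<^sup>2) ^ k" by (intro card_points_le) auto
      moreover have "{X \<in> points \<pi>. perp X Y} \<subseteq> points (\<pi> \<inter> orth {y})"
      proof
        fix X assume X: "X \<in> {X \<in> points \<pi>. perp X Y}"
        then have "X \<subseteq> orth Y" using perp_sym[of X Y] by (simp add: perp_def)
        then show "X \<in> points (\<pi> \<inter> orth {y})" using X y(2) by (auto simp: points_def isotropic_def)
      qed
      then have "card {X \<in> points \<pi>. perp X Y} \<le> card (points (\<pi> \<inter> orth {y}))"
        using finite_points by (rule card_mono[rotated])
      ultimately show ?thesis by (simp add: m power_mult)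
    qed
    show "card {\<mu> \<in> points ` generators. X \<in> \<mu> \<and> (\<exists>Y\<in>points (orth \<pi>). Y \<in> \<mu> \<and> Y \<noteq> X)}
        \<le> g * (2 * q ^ (2 * m - 4))"
      if \<pi>: "\<pi> \<in> middle_subspaces" and X: "X \<in> points \<pi>" "X \<in> points (orth \<pi>)" for \<pi> X
    proof -
      have XP: "X \<in> points (carrier V)" using X(1) points_subset_all by auto
      have "Y \<in> points \<mu> \<longleftrightarrow> Y \<subseteq> \<mu>" if "Y \<in> points (orth \<pi>)" for Y \<mu>
        using that points_subset_all by (intro in_points) auto
      then have "{\<mu> \<in> generators. X \<in> points \<mu> \<and> (\<exists>Y\<in>points (orth \<pi>). Y \<in> points \<mu> \<and> Y \<noteq> X)} =
        {\<mu> \<in> generators. X \<subseteq> \<mu> \<and> (\<exists>Y\<in>points (orth \<pi>). Y \<subseteq> \<mu> \<and> Y \<noteq> X)}"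
        using in_points[OF XP] by simp
      then show ?thesis
        using card_generators_meeting[OF pair middle_subspacesD(5,6)[OF \<pi>] X(2)]
        by (simp add: card_point_generators)
    qed
    show "N \<inter> points (orth \<pi>) \<noteq> {}"
      if \<pi>: "\<pi> \<in> middle_subspaces" and X: "X \<in> points \<pi>" and N: "N \<in> points ` generators" "X \<in> N" for \<pi> X N
    proof -
      obtain \<mu> where \<mu>: "\<mu> \<in> generators" "N = points \<mu>" using N(1) by blast
      note D = middle_subspacesD[OF \<pi>]
      have sub: "VectorSpace.subspace K (\<mu> \<inter> orth \<pi>) V"
        using generatorD(1)[OF \<mu>(1)] D(5) by (rule subspace_Int)
      \<comment> \<open>The generator meets pi in at least the q^2 vectors of X, so it meets the
        orthogonal space in equally many, and a nonzero one of these spans the required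
        point.\<close>
      have "X \<subseteq> \<mu> \<inter> \<pi>" using X N(2) \<mu>(2) pointsD(3) by blast
      then have "card X \<le> card (\<mu> \<inter> \<pi>)" using D(4) by (intro card_mono) auto
      then have "1 < card (\<mu> \<inter> orth \<pi>)"
        using pointsD(2)[OF X] q2_gt_1 card_generator_Int_orth[OF \<pi> \<mu>(1)] by simp
      then obtain v where v: "v \<in> \<mu> \<inter> orth \<pi>" "v \<noteq> \<zero>\<^bsub>V\<^esub>" using nonzero_in_subspace[OF sub] by metis
      then have "v \<in> isotropic (\<mu> \<inter> orth \<pi>)"
        using generatorD(2)[OF \<mu>(1)] by (auto simp: isotropic_def orth_def)
      then have "points (\<mu> \<inter> orth \<pi>) \<noteq> {}" using adjoin_zero_points[OF sub _ v(2)] by blast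
      then show ?thesis by (simp add: points_Int \<mu>(2))
    qed
    show "card (points (orth \<pi>)) \<le> q ^ (2 * m - 3) + 2 * q ^ (2 * m - 4)"
      if "\<pi> \<in> middle_subspaces" "X \<in> points \<pi>" "X \<notin> points (orth \<pi>)" for \<pi> X
      using that by (rule card_points_orth_le)
    show "card (N \<inter> points \<pi>) = card (N \<inter> points (orth \<pi>))"
      if \<pi>: "\<pi> \<in> middle_subspaces" and N: "N \<in> points ` generators" for \<pi> N
    proof -
      obtain \<mu> where \<mu>: "\<mu> \<in> generators" "N = points \<mu>" using N(1) by blast
      have *: "card (N \<inter> points W) * (q\<^sup>2 - 1) = card (\<mu> \<inter> W) - 1" if W: "VectorSpace.subspace K W V" for W
      proof -
        have "\<mu> \<inter> W \<subseteq> orth (\<mu> \<inter> W)" using generatorD(2)[OF \<mu>(1)] by (auto simp: orth_def)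
        then show ?thesis
          using card_points_totally_isotropic[OF subspace_Int[OF generatorD(1)[OF \<mu>(1)] W]]
          by (simp add: points_Int \<mu>(2))
      qed
      have "card (N \<inter> points \<pi>) * (q\<^sup>2 - 1) = card (N \<inter> points (orth \<pi>)) * (q\<^sup>2 - 1)"
        using *[OF middle_subspacesD(1)[OF \<pi>]] *[OF middle_subspacesD(5)[OF \<pi>]]
          card_generator_Int_orth[OF \<pi> \<mu>(1)] by simp
      then show ?thesis using q2_gt_1 by simp
    qed
    show "flat 0 {} (points (carrier V))"
    proof -
      have "points {\<zero>\<^bsub>V\<^esub>} = {}"
      proof -
        have "card P \<le> 1" if "P \<subseteq> {\<zero>\<^bsub>V\<^esub>}" for P using card_mono[OF _ that] by simp
        then show ?thesis using pointsD(2,3) q2_gt_1 by (metis all_not_in_conv not_le)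
      qed
      moreover have "orth {\<zero>\<^bsub>V\<^esub>} = carrier V" by (auto simp: orth_def)
      ultimately show ?thesis using subspace_zero unfolding flat_def by (intro exI[of _ "{\<zero>\<^bsub>V\<^esub>}"]) simp
    qed
    show "L \<subseteq> points (carrier V)" if "flat j L N" for j L N
      using that points_subset_all unfolding flat_def by auto
    show "card L \<le> 2 * q ^ (2 * m - 4)" if L: "flat j L N" and j: "j \<le> m - 1" for j L N
    proof -
      obtain U where U: "VectorSpace.subspace K U V" "card U = (q\<^sup>2) ^ j" "L = points U"
        using L unfolding flat_def by blast
      have "(q\<^sup>2) ^ j \<le> (q\<^sup>2) ^ Suc k" using j q2_gt_1 by (intro power_increasing) (auto simp: m)
      then have "card L \<le> 2 * (q\<^sup>2) ^ k" using U by (auto intro: card_points_le)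
      then show ?thesis by (simp add: m power_mult)
    qed
    show "\<exists>L'. flat (Suc j) L' {X \<in> N. perp X P}"
      if L: "flat j L N" and P: "P \<in> points (carrier V)" "P \<notin> L" for j L N P
    proof -
      obtain U where U: "VectorSpace.subspace K U V" "card U = (q\<^sup>2) ^ j" "L = points U" "N = points (orth U)"
        using L unfolding flat_def by blast
      obtain v where "v \<in> P" and v: "v \<in> carrier V" "orth P = orth {v}"
        "\<forall>U. VectorSpace.subspace K U V \<longrightarrow> (P \<subseteq> U \<longleftrightarrow> v \<in> U)"
        using point_vector[OF P(1)] by blast
      have vU: "v \<notin> U" using v(3)[rule_format, OF U(1)] P(2) U(3) in_points[OF P(1), of U] by simp
      have "{X \<in> N. perp X P} = points (orth (adjoin U v))"
      proof -
        have "perp X P \<longleftrightarrow> X \<in> points (orth P)" if "X \<in> points (carrier V)" for X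
        proof -
          have "perp X P \<longleftrightarrow> perp P X" using perp_sym by blast
          also have "\<dots> \<longleftrightarrow> X \<in> points (orth P)"
            using in_points[OF that, of "orth P"] pointsD(5)[OF P(1)] by (simp add: perp_def)
          finally show ?thesis .
        qed
        then have "X \<in> {X \<in> N. perp X P} \<longleftrightarrow> X \<in> points (orth U) \<inter> points (orth P)" for X
          using U(4) points_subset_all[of "orth U"] by blast
        then have "{X \<in> N. perp X P} = points (orth U) \<inter> points (orth P)" by blast
        then show ?thesis by (simp add: orth_adjoin[OF U(1) v(1)] v(2) points_Int)
      qed
      then show ?thesis
        using subspace_adjoin[OF U(1) v(1)] card_adjoin[OF U(1) v(1) vU] U(2) unfolding flat_def
        by (intro exI[of _ "points (adjoin U v)"] exI[of _ "adjoin U v"]) simp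
    qed
    show "\<exists>\<pi>\<in>middle_subspaces. points \<pi> = N" if L: "flat (Suc (m - 1)) L N" for L N
    proof -
      have "Suc (m - 1) = m" using m by simp
      then obtain U where U: "VectorSpace.subspace K U V" "card U = (q\<^sup>2) ^ m" "N = points (orth U)"
        using L unfolding flat_def by metis
      then have "U \<in> middle_subspaces" by (simp add: middle_subspaces_def)
      from middle_subspacesD(5,6)[OF this] have "orth U \<in> middle_subspaces" by (simp add: middle_subspaces_def)
      then show ?thesis using U(3) by blast
    qed
  qed
qed

end

section \<open>Coordinate spaces\<close>

lemma (in vectorspace) card_eq_power_dim:
  assumes fin: "finite (carrier V)"
  shows "card (carrier V) = card (carrier K) ^ dim"
proof -
  have "span (carrier V) = carrier V"
    using in_own_span[of "carrier V"] span_is_subset2[of "carrier V"] by auto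
  then have "fin_dim" unfolding fin_dim_def using fin by blast
  then obtain B where B: "finite B" "basis B" using finite_basis_exists by blast
  have BV: "B \<subseteq> carrier V" using B(2) by (simp add: basis_def)
  have uniq: "\<forall>v. v \<in> carrier V \<longrightarrow> (\<exists>!a. a \<in> B \<rightarrow>\<^sub>E carrier K \<and> lincomb a B = v)"
    using basis_criterion[OF B(1) BV] B(2) by blast
  have cl: "lincomb a B \<in> carrier V" if "a \<in> B \<rightarrow>\<^sub>E carrier K" for a
    using that BV by (intro lincomb_closed) auto
  have "bij_betw (\<lambda>a. lincomb a B) (B \<rightarrow>\<^sub>E carrier K) (carrier V)"
    unfolding bij_betw_def
  proof (intro conjI inj_onI subset_antisym)
    fix a b assume "a \<in> B \<rightarrow>\<^sub>E carrier K" "b \<in> B \<rightarrow>\<^sub>E carrier K" "lincomb a B = lincomb b B"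
    then show "a = b" using uniq cl by metis
  next
    show "carrier V \<subseteq> (\<lambda>a. lincomb a B) ` (B \<rightarrow>\<^sub>E carrier K)" using uniq by blast
  qed (use cl in auto)
  then have "card (carrier V) = card (B \<rightarrow>\<^sub>E carrier K)" by (simp add: bij_betw_same_card)
  then show ?thesis using dim_basis[OF B] B(1) by (simp add: card_PiE)
qed

lemma (in unitary_field) conj_finsum:
  assumes "finite A" "f \<in> A \<rightarrow> carrier R"
  shows "(\<Oplus>i\<in>A. f i) [^] q = (\<Oplus>i\<in>A. f i [^] q)"
  using assms
proof (induction A rule: finite_induct)
  case (insert i A)
  then have "(\<Oplus>i\<in>A. f i) [^] q = (\<Oplus>i\<in>A. f i [^] q)" by auto
  then show ?case using insert by (subst (1 2) finsum_insert) (auto simp: conj_add Pi_iff)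
qed simp

lemma (in residues) finsum_eq_sum_mod:
  assumes "finite A" "c \<in> A \<rightarrow> carrier R"
  shows "(\<Oplus>x\<in>A. c x) = (\<Sum>x\<in>A. c x) mod m"
  using assms
proof (induction A rule: finite_induct)
  case (insert x A)
  then have "(\<Oplus>x\<in>A. c x) = (\<Sum>x\<in>A. c x) mod m" by auto
  then show ?case using insert by (subst finsum_insert) (auto simp: res_add_eq mod_simps)
qed (simp add: res_zero_eq)

section \<open>The standard Hermitian form on coordinate vectors\<close>

locale unitary_plain_field = unitary_field R q for R :: "'a ring" (structure) and q
begin

abbreviation "coords \<equiv> coord_space R"

lemma coord_space_simps:
  "carrier (coords N) = {0..N} \<rightarrow>\<^sub>E carrier R"
  "\<zero>\<^bsub>coords N\<^esub> = (\<lambda>i\<in>{0..N}. \<zero>)"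
  "x \<oplus>\<^bsub>coords N\<^esub> y = (\<lambda>i\<in>{0..N}. x i \<oplus> y i)"
  "k \<odot>\<^bsub>coords N\<^esub> x = (\<lambda>i\<in>{0..N}. k \<otimes> x i)"
  by (simp_all add: coord_space_def func_space_def)

lemma vectorspace_coord_space: "vectorspace R (coords N)"
  using func_space_is_module field_axioms by (simp add: coord_space_def vectorspace_def)

lemma hermitian_space_coord_space: "hermitian_space R (coords N) q (hermitian_form R N q)"
proof -
  interpret V: vectorspace R "coords N" by (rule vectorspace_coord_space)
  have mem [simp, intro]: "x i \<in> carrier R" if "x \<in> carrier (coords N)" "i \<le> N" for x i
    using that by (auto simp: coord_space_simps)
  show ?thesis
  proof unfold_locales
    show "finite (carrier (coords N))"
      using finite_carrier by (auto simp: coord_space_simps intro: finite_PiE)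
    fix x y assume x: "x \<in> carrier (coords N)" and y: "y \<in> carrier (coords N)"
    show "hermitian_form R N q x y \<in> carrier R"
      unfolding hermitian_form_def using x y by (intro finsum_closed) auto
    show "hermitian_form R N q y x = hermitian_form R N q x y [^] q"
      unfolding hermitian_form_def using x y
      by (subst conj_finsum) (auto intro!: finsum_cong' simp: nat_pow_distrib m_comm)
  next
    fix x y z assume x: "x \<in> carrier (coords N)" and y: "y \<in> carrier (coords N)"
      and z: "z \<in> carrier (coords N)"
    show "hermitian_form R N q (x \<oplus>\<^bsub>coords N\<^esub> y) z = hermitian_form R N q x z \<oplus> hermitian_form R N q y z"
    proof -
      have "hermitian_form R N q (x \<oplus>\<^bsub>coords N\<^esub> y) z =
          (\<Oplus>i\<in>{0..N}. x i \<otimes> z i [^] q \<oplus> y i \<otimes> z i [^] q)"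
        unfolding hermitian_form_def using x y z
        by (intro finsum_cong') (auto simp: coord_space_simps(3) l_distr)
      then show ?thesis
        unfolding hermitian_form_def using x y z by (subst (asm) finsum_addf) auto
    qed
  next
    fix k x z assume k: "k \<in> carrier R" and x: "x \<in> carrier (coords N)" and z: "z \<in> carrier (coords N)"
    show "hermitian_form R N q (k \<odot>\<^bsub>coords N\<^esub> x) z = k \<otimes> hermitian_form R N q x z"
      unfolding hermitian_form_def using x k z
      by (subst finsum_rdistr) (auto intro!: finsum_cong' simp: coord_space_simps(4) m_assoc)
  next
    fix x assume x: "x \<in> carrier (coords N)"
      and z: "\<And>y. y \<in> carrier (coords N) \<Longrightarrow> hermitian_form R N q x y = \<zero>"
    have "x i = \<zero>" if i: "i \<le> N" for i
    proof -
      let ?e = "\<lambda>j\<in>{0..N}. if i = j then \<one> else \<zero>"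
      have "?e \<in> carrier (coords N)" by (auto simp: coord_space_simps)
      then have "\<zero> = hermitian_form R N q x ?e" using z by simp
      also have "\<dots> = (\<Oplus>j\<in>{0..N}. if i = j then x j else \<zero>)"
        unfolding hermitian_form_def using x by (intro finsum_cong') auto
      also have "\<dots> = x i" using i x by (intro add.finprod_singleton) auto
      finally show ?thesis by simp
    qed
    then show "x = \<zero>\<^bsub>coords N\<^esub>"
      using x by (intro ext) (auto simp: coord_space_simps PiE_def extensional_def)
  qed
qed

text \<open>Coordinate i + n + 1 is forced to be a times coordinate i, where a has norm -1, so the
  terms of the form at i and i + n + 1 cancel.\<close>

lemma exists_totally_isotropic:
  "\<exists>E. VectorSpace.subspace R E (coords (2 * n + 1)) \<and>
    (\<forall>x\<in>E. \<forall>y\<in>E. hermitian_form R (2 * n + 1) q x y = \<zero>) \<and> card E = (q\<^sup>2) ^ (n + 1)"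
proof -
  let ?N = "2 * n + 1" and ?V = "coords (2 * n + 1)"
  interpret V: hermitian_space R ?V q "hermitian_form R ?N q" by (rule hermitian_space_coord_space)
  obtain a where a: "a \<in> carrier R" "a [^] (q + 1) = \<ominus> \<one>" using exists_norm_minus_one by blast
  let ?E = "{x \<in> carrier ?V. \<forall>i\<le>n. x (i + n + 1) = a \<otimes> x i}"
  have mem [simp, intro]: "x i \<in> carrier R" if "x \<in> carrier ?V" "i \<le> ?N" for x i
    using that by (auto simp: coord_space_simps)
  have "VectorSpace.subspace R ?E ?V"
  proof (rule V.subspaceI)
    show "\<zero>\<^bsub>?V\<^esub> \<in> ?E" using a by (auto simp: coord_space_simps)
    fix x assume x: "x \<in> ?E"
    {
      fix y assume y: "y \<in> ?E"
      have "x \<oplus>\<^bsub>?V\<^esub> y \<in> carrier ?V"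
        using x y by (intro V.subspace_closed(4)[OF V.subspace_carrier]) auto
      then show "x \<oplus>\<^bsub>?V\<^esub> y \<in> ?E" using x y a by (simp add: coord_space_simps(3) r_distr)
    }
    fix k assume k: "k \<in> carrier R"
    have "k \<odot>\<^bsub>?V\<^esub> x \<in> carrier ?V"
      using x k by (intro V.subspace_closed(5)[OF V.subspace_carrier]) auto
    then show "k \<odot>\<^bsub>?V\<^esub> x \<in> ?E" using x k a by (simp add: coord_space_simps(4) m_lcomm)
  qed auto
  moreover have "hermitian_form R ?N q x y = \<zero>" if x: "x \<in> ?E" and y: "y \<in> ?E" for x y
  proof -
    let ?f = "\<lambda>i. x i \<otimes> (y i [^] q)"
    have f: "?f i \<in> carrier R" if "i \<le> ?N" for i using x y that by auto
    have N: "{0..?N} = {0..n} \<union> (\<lambda>i. i + n + 1) ` {0..n}"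
    proof (intro subset_antisym subsetI)
      fix j assume "j \<in> {0..?N}"
      then show "j \<in> {0..n} \<union> (\<lambda>i. i + n + 1) ` {0..n}"
        by (cases "j \<le> n") (auto intro!: image_eqI[of _ _ "j - (n + 1)"])
    qed auto
    have "hermitian_form R ?N q x y = (\<Oplus>i\<in>{0..n}. ?f i) \<oplus> (\<Oplus>i\<in>(\<lambda>i. i + n + 1) ` {0..n}. ?f i)"
      unfolding hermitian_form_def N using f by (intro finsum_Un_disjoint) auto
    also have "(\<Oplus>i\<in>(\<lambda>i. i + n + 1) ` {0..n}. ?f i) = (\<Oplus>i\<in>{0..n}. ?f (i + n + 1))"
      using f by (intro finsum_reindex) (auto simp: inj_on_def)
    also have "(\<Oplus>i\<in>{0..n}. ?f i) \<oplus> (\<Oplus>i\<in>{0..n}. ?f (i + n + 1)) = (\<Oplus>i\<in>{0..n}. ?f i \<oplus> ?f (i + n + 1))"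
      using f by (intro finsum_addf[symmetric]) auto
    also have "\<dots> = (\<Oplus>i\<in>{0..n}. \<zero>)"
    proof (intro finsum_cong')
      fix i assume i: "i \<in> {0..n}"
      then have xi: "x i \<in> carrier R" "y i \<in> carrier R" using x y by auto
      have "?f (i + n + 1) = (a \<otimes> x i) \<otimes> (a \<otimes> y i) [^] q" using x y i by simp
      also have "\<dots> = a [^] (q + 1) \<otimes> ?f i"
        using a(1) xi by (simp add: nat_pow_distrib m_ac)
      finally show "?f i \<oplus> ?f (i + n + 1) = \<zero>" using a xi by (simp add: l_minus r_neg)
    qed auto
    finally show ?thesis by simp
  qed
  moreover have "card ?E = (q\<^sup>2) ^ (n + 1)"
  proof -
    let ?g = "\<lambda>y. \<lambda>i\<in>{0..?N}. if i \<le> n then y i else a \<otimes> y (i - n - 1)"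
    have "bij_betw (\<lambda>x. restrict x {0..n}) ?E ({0..n} \<rightarrow>\<^sub>E carrier R)"
    proof (rule bij_betwI[of _ _ _ ?g])
      show "(\<lambda>x. restrict x {0..n}) \<in> ?E \<rightarrow> {0..n} \<rightarrow>\<^sub>E carrier R" by auto
      show "?g \<in> ({0..n} \<rightarrow>\<^sub>E carrier R) \<rightarrow> ?E"
      proof
        fix y assume y: "y \<in> {0..n} \<rightarrow>\<^sub>E carrier R"
        then have "y i \<in> carrier R" if "i \<le> n" for i using that by auto
        then show "?g y \<in> ?E" using a by (auto simp: coord_space_simps)
      qed
      fix x assume x: "x \<in> ?E"
      show "?g (restrict x {0..n}) = x"
      proof
        fix i
        consider "i \<le> n" | j where "i = j + n + 1" "j \<le> n" | "i > ?N"
          by (metis add.assoc add.commute le_add_diff_inverse linorder_not_less mult_2 nat_add_left_cancel_le not_less_eq_eq Suc_eq_plus1)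
        then show "?g (restrict x {0..n}) i = x i"
        proof cases
          case 3
          then show ?thesis using x by (auto simp: coord_space_simps PiE_def extensional_def)
        qed (use x in auto)
      qed
    next
      fix y assume "y \<in> {0..n} \<rightarrow>\<^sub>E carrier R"
      then show "restrict (?g y) {0..n} = y"
        by (intro ext) (auto simp: PiE_def extensional_def)
    qed
    then have "card ?E = card ({0..n} \<rightarrow>\<^sub>E carrier R)" by (rule bij_betw_same_card)
    then show ?thesis using card_carrier by (simp add: card_PiE)
  qed
  ultimately show ?thesis by (intro exI[of _ ?E]) blast
qed

lemma hermitian_polar_space_coord_space:
  assumes "n \<ge> 1"
  shows "hermitian_polar_space R (coords (2 * n + 1)) q (hermitian_form R (2 * n + 1) q) (n + 1)"
proof -
  let ?N = "2 * n + 1" and ?V = "coords (2 * n + 1)"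
  interpret V: hermitian_space R ?V q "hermitian_form R ?N q" by (rule hermitian_space_coord_space)
  show ?thesis
  proof unfold_locales
    show "card (carrier ?V) = (q\<^sup>2) ^ (2 * (n + 1))"
      using card_carrier by (simp add: coord_space_simps card_PiE)
    show "2 \<le> n + 1" using assms by simp
    obtain E where E: "VectorSpace.subspace R E ?V"
      "\<forall>x\<in>E. \<forall>y\<in>E. hermitian_form R ?N q x y = \<zero>" "card E = (q\<^sup>2) ^ (n + 1)"
      using exists_totally_isotropic by blast
    then have "E \<subseteq> V.orth E" using V.subspace_closed(1)[OF E(1)] unfolding V.orth_def by blast
    then show "\<exists>E. VectorSpace.subspace R E ?V \<and> E \<subseteq> V.orth E \<and> card E = (q\<^sup>2) ^ (n + 1)"
      using E by blast
  qed
qed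

text \<open>Translates projective dimension into the number of vectors, the measure used in all
  counts above.\<close>

lemma pg_spaces_iff:
  "W \<in> pg_spaces R N k \<longleftrightarrow> VectorSpace.subspace R W (coords N) \<and> card W = (q\<^sup>2) ^ (k + 1)"
proof (cases "VectorSpace.subspace R W (coords N)")
  case True
  interpret V: hermitian_space R "coords N" q "hermitian_form R N q" by (rule hermitian_space_coord_space)
  interpret W: vectorspace R "(coords N)\<lparr>carrier := W\<rparr>" using True by (rule V.subspace_is_vs)
  have "card W = (q\<^sup>2) ^ W.dim"
    using W.card_eq_power_dim V.subspace_closed(6)[OF True] card_carrier by simp
  then have "card W = (q\<^sup>2) ^ (k + 1) \<longleftrightarrow> W.dim = k + 1"
    by (simp only: power_inject_exp[OF V.q2_gt_1])
  then show ?thesis using True by (simp add: pg_spaces_def)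
qed (simp add: pg_spaces_def)

end

context hermitian_polar_space
begin

text \<open>If all points of a subspace lie on the variety, all its vectors are isotropic, and
  \<open>subspace_isotropic_imp_orth\<close> makes it totally isotropic.\<close>

lemma generator_iff:
  "\<mu> \<in> generators \<longleftrightarrow> VectorSpace.subspace K \<mu> V \<and> card \<mu> = (q\<^sup>2) ^ m \<and>
    (\<forall>P. VectorSpace.subspace K P V \<and> card P = q\<^sup>2 \<and> P \<subseteq> \<mu> \<longrightarrow> P \<in> points (carrier V))"
  (is "_ \<longleftrightarrow> ?R")
proof
  assume \<mu>: "\<mu> \<in> generators"
  note D = generatorD[OF \<mu>]
  have "P \<in> points (carrier V)" if "VectorSpace.subspace K P V" "card P = q\<^sup>2" "P \<subseteq> \<mu>" for P
    using that D(2) subspace_closed(1)[OF that(1)] by (auto simp: points_def isotropic_def orth_def)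
  then show ?R using D by blast
next
  assume *: ?R
  have "h v v = \<zero>\<^bsub>K\<^esub>" if v: "v \<in> \<mu>" for v
  proof (cases "v = \<zero>\<^bsub>V\<^esub>")
    case False
    have vV: "v \<in> carrier V" using * v subspace_closed(2) by blast
    have "VectorSpace.subspace K (adjoin {\<zero>\<^bsub>V\<^esub>} v) V" using subspace_zero vV by (rule subspace_adjoin)
    moreover have "card (adjoin {\<zero>\<^bsub>V\<^esub>} v) = q\<^sup>2" using card_adjoin[OF subspace_zero vV] False by simp
    moreover have "adjoin {\<zero>\<^bsub>V\<^esub>} v \<subseteq> \<mu>" using * v subspace_closed(3) by (intro adjoin_least) auto
    ultimately have "adjoin {\<zero>\<^bsub>V\<^esub>} v \<in> points (carrier V)" using * by blast
    then show ?thesis using pointsD(7) adjoin_self[OF subspace_zero vV] by blast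
  qed simp
  then have "\<mu> \<subseteq> orth \<mu>" using * subspace_isotropic_imp_orth by blast
  then show "\<mu> \<in> generators" using * by (simp add: generators_def)
qed

end

section \<open>Code words\<close>

lemma word_space_simps:
  "carrier (word_space p F N q) = hermitian_points F N q \<rightarrow>\<^sub>E carrier (prime_field p)"
  "\<zero>\<^bsub>word_space p F N q\<^esub> = (\<lambda>P\<in>hermitian_points F N q. 0)"
  "x \<oplus>\<^bsub>word_space p F N q\<^esub> y = (\<lambda>P\<in>hermitian_points F N q. (x P + y P) mod int p)"
  "k \<odot>\<^bsub>word_space p F N q\<^esub> x = (\<lambda>P\<in>hermitian_points F N q. (k * x P) mod int p)"
  if "1 < p"
proof -
  interpret residues "int p" "prime_field p" using that by unfold_locales auto
  show "carrier (word_space p F N q) = hermitian_points F N q \<rightarrow>\<^sub>E carrier (prime_field p)"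
    "\<zero>\<^bsub>word_space p F N q\<^esub> = (\<lambda>P\<in>hermitian_points F N q. 0)"
    "x \<oplus>\<^bsub>word_space p F N q\<^esub> y = (\<lambda>P\<in>hermitian_points F N q. (x P + y P) mod int p)"
    "k \<odot>\<^bsub>word_space p F N q\<^esub> x = (\<lambda>P\<in>hermitian_points F N q. (k * x P) mod int p)"
    by (simp_all add: word_space_def func_space_def res_add_eq res_mult_eq res_zero_eq)
qed

text \<open>Expresses the generating words by integer arithmetic modulo p, the form in which the
  descent subtracts them.\<close>

lemma polar_pair_word_eq:
  assumes "1 < p"
  shows "\<alpha> \<odot>\<^bsub>word_space p F N q\<^esub> (incidence_vector p F N q U \<ominus>\<^bsub>word_space p F N q\<^esub> incidence_vector p F N q W) =
    (\<lambda>P\<in>hermitian_points F N q. (\<alpha> * (of_bool (P \<subseteq> U) - of_bool (P \<subseteq> W))) mod int p)"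
proof -
  interpret residues "int p" "prime_field p" using assms by unfold_locales auto
  have inc: "incidence_vector p F N q X \<in> carrier (word_space p F N q)" for X
    by (auto simp: incidence_vector_def word_space_simps[OF assms])
  have neg: "\<ominus>\<^bsub>word_space p F N q\<^esub> incidence_vector p F N q W =
    (\<lambda>P. if P \<in> hermitian_points F N q then \<ominus>\<^bsub>prime_field p\<^esub> incidence_vector p F N q W P else undefined)"
    using func_space_neg[of "incidence_vector p F N q W" "hermitian_points F N q"] inc[of W]
    by (simp add: word_space_def)
  have "\<ominus>\<^bsub>prime_field p\<^esub> x = (- x) mod int p" for x by (rule res_neg_eq)
  then show ?thesis
    using assms unfolding a_minus_def neg word_space_simps[OF assms]
    by (auto simp: incidence_vector_def res_one_eq res_zero_eq mod_simps intro!: restrict_ext)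
qed

lemma submodule_word_span:
  assumes p: "1 < p" and N: "N = 2 * n + 1"
  shows "submodule (prime_field p)
    (LinearCombinations.module.span (prime_field p) (word_space p F N q) (polar_pair_words p F n q))
    (word_space p F N q)"
  and "polar_pair_words p F n q \<subseteq>
    LinearCombinations.module.span (prime_field p) (word_space p F N q) (polar_pair_words p F n q)"
proof -
  interpret residues "int p" "prime_field p" using p by unfold_locales auto
  interpret M: Module.module "prime_field p" "word_space p F N q"
    unfolding word_space_def by (rule func_space_is_module)
  have sub: "polar_pair_words p F n q \<subseteq> carrier (word_space p F N q)"
  proof
    fix w assume "w \<in> polar_pair_words p F n q"
    then obtain \<alpha> \<pi> where w: "w = (\<lambda>P\<in>hermitian_points F N q.
        (\<alpha> * (of_bool (P \<subseteq> \<pi>) - of_bool (P \<subseteq> hermitian_polarity F N q \<pi>))) mod int p)"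
      unfolding polar_pair_words_def polar_pair_word_eq[OF p] N by blast
    show "w \<in> carrier (word_space p F N q)"
      unfolding w word_space_simps[OF p] res_carrier_eq using p by auto
  qed
  show "submodule (prime_field p) (M.span (polar_pair_words p F n q)) (word_space p F N q)"
    using sub by (rule M.span_is_submodule)
  show "polar_pair_words p F n q \<subseteq> M.span (polar_pair_words p F n q)"
    using sub by (rule M.in_own_span)
qed

lemma (in unitary_plain_field) dual_code_subset_span:
  fixes p n D :: nat
  assumes p: "prime p" and n: "n \<ge> 1" and D: "D > 0"
    and q: "16 * (2 * D) ^ Suc n * (2 * D * (2 * D) ^ Suc n + 2) \<le> q"
    and c: "c \<in> dual_code p R n q" and wt: "wt p R (2 * n + 1) q c \<le> D * q ^ (2 * n - 1)"
  shows "c \<in> LinearCombinations.module.span (prime_field p) (word_space p R (2 * n + 1) q)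
    (polar_pair_words p R n q)"
proof -
  define N where "N = 2 * n + 1"
  have p1: "1 < p" using p by (rule prime_gt_1_nat)
  interpret Z: residues "int p" "prime_field p" using p1 by unfold_locales auto
  interpret V: hermitian_polar_space R "coords N" q "hermitian_form R N q" "n + 1"
    unfolding N_def using n by (rule hermitian_polar_space_coord_space)
  let ?H = "hermitian_points R N q" and ?W = "word_space p R N q"
  let ?span = "LinearCombinations.module.span (prime_field p) ?W (polar_pair_words p R n q)"
  have mem: "x i \<in> carrier R" if "x \<in> carrier (coords N)" "i \<le> N" for x i
    using that by (auto simp: coord_space_simps)
  have form: "hermitian_form R N q x x = (\<Oplus>i\<in>{0..N}. x i [^] (q + 1))" if "x \<in> carrier (coords N)" for x
    unfolding hermitian_form_def using mem[OF that] by (intro finsum_cong') (auto simp: m_comm)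
  have H: "?H = V.points (carrier (coords N))"
  proof -
    have "P \<in> ?H \<longleftrightarrow> P \<in> V.points (carrier (coords N))" for P
    proof (cases "VectorSpace.subspace R P (coords N)")
      case True
      then have P: "P \<subseteq> carrier (coords N)" by (rule V.subspace_closed)
      then have "(\<forall>x\<in>P. (\<Oplus>i\<in>{0..N}. x i [^] (q + 1)) = \<zero>) \<longleftrightarrow> P \<subseteq> V.isotropic (carrier (coords N))"
        using form by (auto simp: V.isotropic_def simp del: nat_pow_Suc)
      then show ?thesis
        using True by (simp add: hermitian_points_def pg_points_def pg_spaces_iff V.points_def)
    qed (simp add: hermitian_points_def pg_points_def pg_spaces_iff V.points_def)
    then show ?thesis by blast
  qed
  have G: "hermitian_generators R n q = V.generators"
  proof -
    have "(\<forall>P\<in>pg_points R N. P \<subseteq> \<mu> \<longrightarrow> P \<in> ?H) \<longleftrightarrow>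
        (\<forall>P. VectorSpace.subspace R P (coords N) \<and> card P = q\<^sup>2 \<and> P \<subseteq> \<mu> \<longrightarrow> P \<in> ?H)" for \<mu>
      using pg_spaces_iff[of _ N 0] by (auto simp: pg_points_def)
    then have "\<mu> \<in> hermitian_generators R n q \<longleftrightarrow> \<mu> \<in> V.generators" for \<mu>
      unfolding hermitian_generators_def V.generator_iff H[symmetric] N_def[symmetric] mem_Collect_eq
        pg_spaces_iff by blast
    then show ?thesis by blast
  qed
  have polarity: "hermitian_polarity R N q W = V.orth W" for W
    by (simp add: hermitian_polarity_def V.orth_def)
  have middle: "pg_spaces R N n = V.middle_subspaces"
    unfolding set_eq_iff pg_spaces_iff V.middle_subspaces_def mem_Collect_eq by blast
  have points: "{P \<in> ?H. P \<subseteq> \<mu>} = V.points \<mu>" for \<mu>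
    using V.points_iff[of _ \<mu>] by (auto simp: H)
  obtain g where "polar_configuration ?H V.perp (V.points ` V.generators) V.middle_subspaces V.points
      V.orth V.flat q (n + 1 - 1) (q ^ (2 * (n + 1) - 3)) (2 * q ^ (2 * (n + 1) - 4)) g"
    using V.polar_configuration unfolding H by blast
  then interpret polar_configuration ?H V.perp "V.points ` V.generators" V.middle_subspaces V.points
      V.orth V.flat q n "q ^ (2 * n - 1)" "2 * q ^ (2 * n - 2)" g
    by (simp add: numeral_3_eq_3 numeral_2_eq_2)
  have fH: "finite ?H" unfolding H by (rule V.finite_points)
  have cH: "c \<in> ?H \<rightarrow>\<^sub>E {0..int p - 1}"
    using c by (simp add: dual_code_def N_def word_space_simps[OF p1] Z.res_carrier_eq)
  have dvd_iff: "int p dvd c P \<longleftrightarrow> c P = 0" if "P \<in> ?H" for P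
  proof -
    have "0 \<le> c P" "c P < int p" using cH that by (auto dest: PiE_mem)
    then show ?thesis using zdvd_not_zless[of "c P" "int p"] by (cases "c P = 0") auto
  qed
  have sums: "int p dvd (\<Sum>P\<in>\<mu>. c P)" if "\<mu> \<in> V.points ` V.generators" for \<mu>
  proof -
    obtain \<nu> where \<nu>: "\<nu> \<in> V.generators" "\<mu> = V.points \<nu>" using \<open>\<mu> \<in> _\<close> by blast
    have "(\<Oplus>\<^bsub>prime_field p\<^esub>P\<in>{P \<in> ?H. P \<subseteq> \<nu>}. c P) = 0"
      using c \<nu>(1) by (auto simp: dual_code_def G N_def Z.res_zero_eq)
    moreover have "(\<Oplus>\<^bsub>prime_field p\<^esub>P\<in>{P \<in> ?H. P \<subseteq> \<nu>}. c P) = (\<Sum>P\<in>{P \<in> ?H. P \<subseteq> \<nu>}. c P) mod int p"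
      using fH cH by (intro Z.finsum_eq_sum_mod) (auto simp: Z.res_carrier_eq dest: PiE_mem)
    ultimately show ?thesis unfolding points \<nu>(2) by (simp add: dvd_eq_mod_eq_0)
  qed
  have "{P \<in> ?H. \<not> int p dvd c P} = {P \<in> ?H. c P \<noteq> \<zero>\<^bsub>prime_field p\<^esub>}"
    using dvd_iff by (auto simp: Z.res_zero_eq)
  then have weight: "card {P \<in> ?H. \<not> int p dvd c P} \<le> D * q ^ (2 * n - 1)"
    using wt by (simp add: wt_def N_def)
  interpret span: submodule "prime_field p" ?span ?W
    using p1 N_def by (rule submodule_word_span)
  have "(\<lambda>P\<in>?H. c P mod int p) \<in> ?span"
  \<comment> \<open>The descent leaves the range 0 to p - 1 and is blind to values off the variety.
    Reduction modulo p and restriction inside the predicate bring every intermediate function back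
    into the word space.\<close>
  proof (rule code_word_induct[of "int p" c D D "\<lambda>c. (\<lambda>P\<in>?H. c P mod int p) \<in> ?span"])
    fix c :: "(nat \<Rightarrow> 'a) set \<Rightarrow> int"
    assume "\<And>P. P \<in> ?H \<Longrightarrow> int p dvd c P"
    then have "(\<lambda>P\<in>?H. c P mod int p) = \<zero>\<^bsub>?W\<^esub>"
      by (auto simp: word_space_simps[OF p1] intro!: restrict_ext)
    then show "(\<lambda>P\<in>?H. c P mod int p) \<in> ?span" by simp
  next
    fix c :: "(nat \<Rightarrow> 'a) set \<Rightarrow> int" and \<pi> \<alpha>
    assume \<pi>: "\<pi> \<in> V.middle_subspaces"
    let ?w = "\<lambda>P. \<alpha> * (of_bool (P \<in> V.points \<pi>) - of_bool (P \<in> V.points (V.orth \<pi>))) :: int"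
    let ?v = "(\<alpha> mod int p) \<odot>\<^bsub>?W\<^esub> (incidence_vector p R N q \<pi> \<ominus>\<^bsub>?W\<^esub>
        incidence_vector p R N q (hermitian_polarity R N q \<pi>))"
    assume *: "(\<lambda>P\<in>?H. (c P - ?w P) mod int p) \<in> ?span"
    \<comment> \<open>The descent may return any integer coefficient, so it is replaced by its
      residue.\<close>
    have "\<alpha> mod int p \<in> carrier (prime_field p)" using p1 by (simp add: Z.res_carrier_eq)
    moreover have "\<pi> \<in> pg_spaces R N n" using \<pi> middle by simp
    ultimately have "?v \<in> polar_pair_words p R n q"
      unfolding polar_pair_words_def N_def[symmetric] by blast
    then have v: "?v \<in> ?span" using submodule_word_span(2)[OF p1 N_def] by (rule rev_subsetD)
    have "?v = (\<lambda>P\<in>?H. ?w P mod int p)"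
      unfolding polar_pair_word_eq[OF p1] polarity
    proof (intro restrict_ext)
      fix P assume "P \<in> ?H"
      then have "P \<in> V.points W \<longleftrightarrow> P \<subseteq> W" for W using V.points_iff[of P W] by (simp add: H)
      then show "(\<alpha> mod int p * (of_bool (P \<subseteq> \<pi>) - of_bool (P \<subseteq> V.orth \<pi>))) mod int p = ?w P mod int p"
        by (simp add: mod_mult_left_eq)
    qed
    then have "(\<lambda>P\<in>?H. (c P - ?w P) mod int p) \<oplus>\<^bsub>?W\<^esub> ?v = (\<lambda>P\<in>?H. c P mod int p)"
      unfolding word_space_simps[OF p1] by (auto simp: mod_simps intro!: restrict_ext)
    then show "(\<lambda>P\<in>?H. c P mod int p) \<in> ?span" using span.m_closed[OF * v] by simp
  qed (use sums D q weight in auto)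
  moreover have "(\<lambda>P\<in>?H. c P mod int p) = c"
  proof
    fix P
    show "(\<lambda>P\<in>?H. c P mod int p) P = c P"
    proof (cases "P \<in> ?H")
      case True
      then have "0 \<le> c P" "c P < int p" using cH by (auto dest: PiE_mem)
      then show ?thesis using True by simp
    qed (use cH in \<open>auto simp: PiE_def extensional_def\<close>)
  qed
  ultimately show ?thesis by (simp add: N_def)
qed

theorem theorem4p7:
  fixes p n :: nat and \<delta> :: real
  assumes "prime p" and "\<delta> > 0" and "n \<ge> 1"
  shows "\<exists>Q::real. \<forall>(h::nat) (q::nat) (F::'a ring) c.
    q = p ^ h \<longrightarrow> real q \<ge> Q \<longrightarrow> field F \<longrightarrow> card (carrier F) = q\<^sup>2 \<longrightarrow>
    c \<in> dual_code p F n q \<longrightarrow>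
    real (wt p F (2 * n + 1) q c) \<le> \<delta> * real q ^ (2 * n - 1) \<longrightarrow>
    c \<in> LinearCombinations.module.span (prime_field p) (word_space p F (2 * n + 1) q)
          (polar_pair_words p F n q)"
proof -
  \<comment> \<open>The induction removes one unit \<open>q ^ (2 * n - 1)\<close> of weight at a
    time, so the bound is rounded up to an integer. The threshold \<open>?Q\<close> is 16 * E * (K +
    2) for this \<open>D\<close>.\<close>
  define D where "D = nat \<lceil>\<delta>\<rceil>"
  let ?Q = "16 * (2 * D) ^ Suc n * (2 * D * (2 * D) ^ Suc n + 2)"
  have D: "D > 0" "\<delta> \<le> real D" using assms(2) by (auto simp: D_def)
  show ?thesis
  proof (intro exI[of _ "real ?Q"] allI impI)
    fix h q :: nat and F :: "'a ring" and c
    assume q: "q = p ^ h" "real q \<ge> real ?Q" and F: "field F" "card (carrier F) = q\<^sup>2"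
      and c: "c \<in> dual_code p F n q" "real (wt p F (2 * n + 1) q c) \<le> \<delta> * real q ^ (2 * n - 1)"
    \<comment> \<open>This exhibits p as the characteristic, so that the q-th power map with q = p^h
      is additive by \<open>frobenius_add\<close>.\<close>
    have "card (carrier F) = p ^ (h * 2)" using F(2) q(1) by (simp add: power_mult)
    then have "unitary_plain_field F q"
      unfolding unitary_plain_field_def unitary_field_def unitary_field_axioms_def
      using F field.frobenius_add[OF F(1) assms(1)] q(1) by blast
    moreover have "real (wt p F (2 * n + 1) q c) \<le> real (D * q ^ (2 * n - 1))"
      using c(2) mult_right_mono[OF D(2), of "real q ^ (2 * n - 1)"] by simp
    then have "wt p F (2 * n + 1) q c \<le> D * q ^ (2 * n - 1)" by (simp only: of_nat_le_iff)
    moreover have "?Q \<le> q" using q(2) by (simp only: of_nat_le_iff)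
    ultimately show "c \<in> LinearCombinations.module.span (prime_field p) (word_space p F (2 * n + 1) q)
        (polar_pair_words p F n q)"
      using unitary_plain_field.dual_code_subset_span[OF _ assms(1,3) D(1)] c(1) by blast
  qed
qed

end
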